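(* Let $x\subseteq\omega$ be ITRM-recognizable and let $y\subseteq\omega$ be ITRM-c-random with $x\le_{\mathrm{ITRM}}y$. Then $x$ is ITRM-computable.
   Context: Reals are subsets of $\omega$. An infinite time register machine (ITRM) has finitely many registers, each holding a natural number, and runs a finite register-machine program in transfinite ordinal time; with an oracle $x\subseteq\omega$ it may test whether the content of a register belongs to $x$. At successor times it acts as an ordinary register machine; at limit times the active program line is the $\liminf$ of the earlier program lines, and each register holds the $\liminf$ of its earlier contents if that is finite, and $0$ otherwise. $P^x\downarrow=i$ means program $P$ with oracle $x$ halts with output $i$. $x\le_{\mathrm{ITRM}}y$ iff there is a program $P$ such that for every $i\in\omega$, $P^y(i)$ halts with output $1$ if $i\in x$ and $0$ otherwise; ITRM-computable means $\le_{\mathrm{ITRM}}\emptyset$. A set $X$ of reals is ITRM-decidable iff there is a program $P$ with $P^{w}\downarrow=1$ for $w\in X$ and $P^{w}\downarrow=0$ for $w\notin X$. A real is ITRM-c-random iff it lies in no meager ITRM-decidable set. A real $x$ is ITRM-recognizable iff $\{x\}$ is ITRM-decidable. *)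

theory Defs
  imports Main
begin

text \<open>Instructions. Registers are indexed by natural numbers; a program (a finite list)
mentions only finitely many registers. Lines are numbered from 0; the machine halts as
soon as the active line is not a line of the program (line index >= length).\<close>

datatype instr =
    Zero nat
  | Incr nat
  | Copy nat nat
  | JumpEq nat nat nat
  | Oracle nat nat

type_synonym program = "instr list"
type_synonym config = "nat \<times> (nat \<Rightarrow> nat)"

fun exec :: "instr \<Rightarrow> nat set \<Rightarrow> config \<Rightarrow> config" where
  "exec (Zero r) x (l, R) = (Suc l, R(r := 0))"
| "exec (Incr r) x (l, R) = (Suc l, R(r := Suc (R r)))"
| "exec (Copy a b) x (l, R) = (Suc l, R(b := R a))"
| "exec (JumpEq a b q) x (l, R) = (if R a = R b then q else Suc l, R)"
| "exec (Oracle r q) x (l, R) = (if R r \<in> x then q else Suc l, R)"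

definition step :: "program \<Rightarrow> nat set \<Rightarrow> config \<Rightarrow> config" where
  "step P x c = exec (P ! fst c) x c"

text \<open>Time is modelled by a well-order W; strict predecessors of a time point t.\<close>

definition preds :: "('t \<times> 't) set \<Rightarrow> 't \<Rightarrow> 't set" where
  "preds W t = {s. (s, t) \<in> W \<and> s \<noteq> t}"

definition is_least :: "('t \<times> 't) set \<Rightarrow> 't \<Rightarrow> bool" where
  "is_least W t \<longleftrightarrow> t \<in> Field W \<and> (\<forall>s\<in>Field W. (t, s) \<in> W)"

definition is_greatest :: "('t \<times> 't) set \<Rightarrow> 't \<Rightarrow> bool" where
  "is_greatest W t \<longleftrightarrow> t \<in> Field W \<and> (\<forall>s\<in>Field W. (s, t) \<in> W)"

definition imm_pred :: "('t \<times> 't) set \<Rightarrow> 't \<Rightarrow> 't \<Rightarrow> bool" where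
  "imm_pred W s t \<longleftrightarrow> s \<in> preds W t \<and> \<not> (\<exists>u. u \<in> preds W t \<and> s \<in> preds W u)"

text \<open>liminf of a nat-valued function over the times strictly below t:
  sup over s < t of inf over s <= u < t of f u; returns 0 if this is infinite.\<close>

definition lim_inf :: "('t \<times> 't) set \<Rightarrow> 't \<Rightarrow> ('t \<Rightarrow> nat) \<Rightarrow> nat" where
  "lim_inf W t f =
     (let m = (\<lambda>s. Inf (f ` {u \<in> preds W t. (s, u) \<in> W})) in
      if finite (m ` preds W t) then Max (m ` preds W t) else 0)"

definition is_run :: "program \<Rightarrow> nat set \<Rightarrow> nat \<Rightarrow> ('t \<times> 't) set \<Rightarrow> ('t \<Rightarrow> config) \<Rightarrow> bool" where
  "is_run P x inp W c \<longleftrightarrow>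
     Well_order W \<and> Field W \<noteq> {} \<and>
     (\<forall>t\<in>Field W.
        (is_least W t \<longrightarrow> c t = (0, (\<lambda>r. 0)(0 := inp))) \<and>
        (\<forall>s. imm_pred W s t \<longrightarrow> c t = step P x (c s)) \<and>
        ((\<not> is_least W t \<and> \<not> (\<exists>s. imm_pred W s t)) \<longrightarrow>
            c t = (lim_inf W t (\<lambda>u. fst (c u)), (\<lambda>r. lim_inf W t (\<lambda>u. snd (c u) r)))) \<and>
        (\<forall>s\<in>preds W t. fst (c s) < length P))"

text \<open>P with oracle x on input inp halts with output v (read from register 0).
Time domains are well-orders on the type nat set; this suffices since ITRM halting
times are countable ordinals.\<close>

definition halts_with :: "program \<Rightarrow> nat set \<Rightarrow> nat \<Rightarrow> nat \<Rightarrow> bool" where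
  "halts_with P x inp v \<longleftrightarrow>
     (\<exists>(W :: (nat set \<times> nat set) set) c t.
        is_run P x inp W c \<and> is_greatest W t \<and>
        length P \<le> fst (c t) \<and> snd (c t) 0 = v)"

definition itrm_reducible :: "nat set \<Rightarrow> nat set \<Rightarrow> bool" where
  "itrm_reducible x y \<longleftrightarrow>
     (\<exists>P. \<forall>i. halts_with P y i (if i \<in> x then 1 else 0))"

definition itrm_computable :: "nat set \<Rightarrow> bool" where
  "itrm_computable x \<longleftrightarrow> itrm_reducible x {}"

definition itrm_decidable :: "nat set set \<Rightarrow> bool" where
  "itrm_decidable X \<longleftrightarrow>
     (\<exists>P. \<forall>w. halts_with P w 0 (if w \<in> X then 1 else 0))"

definition itrm_recognizable :: "nat set \<Rightarrow> bool" where
  "itrm_recognizable x \<longleftrightarrow> itrm_decidable {x}"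

definition cyl :: "bool list \<Rightarrow> nat set set" where
  "cyl \<sigma> = {x. \<forall>n < length \<sigma>. (n \<in> x) = \<sigma> ! n}"

definition nowhere_dense :: "nat set set \<Rightarrow> bool" where
  "nowhere_dense A \<longleftrightarrow> (\<forall>\<sigma>. \<exists>\<tau>. cyl (\<sigma> @ \<tau>) \<inter> A = {})"

definition meager :: "nat set set \<Rightarrow> bool" where
  "meager X \<longleftrightarrow> (\<exists>N :: nat \<Rightarrow> nat set set. (\<forall>n. nowhere_dense (N n)) \<and> X \<subseteq> (\<Union>n. N n))"

definition itrm_c_random :: "nat set \<Rightarrow> bool" where
  "itrm_c_random y \<longleftrightarrow> (\<forall>X. itrm_decidable X \<and> meager X \<longrightarrow> y \<notin> X)"

end

theory Submission
  imports Defs "HOL-Library.Nat_Bijection"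
begin

text \<open>Let \<open>Q\<close> recognize \<open>x\<close>, let \<open>P\<close> compute \<open>x\<close> from \<open>y\<close>, and let \<open>A\<close> be the set of oracles from which
\<open>P\<close> computes \<open>x\<close>. If \<open>A\<close> is decidable then it is not meager, as \<open>y\<close> is an element; so some basic open
set forces \<open>A\<close>, hence decides \<open>x\<close>, and \<open>x\<close> is computable if forcing is. Both gaps are closed by a class
of predicates of an oracle and a number that contains arithmetic and is closed under the formation of
well-founded parts, that is, under hyperjumps. The class is closed under category forcing, because
the forcing relation of a well-founded part is again a well-founded part. Its members are decidable
by machines that search trees depth-first. Halting of a given program belongs to the class: while no
register overflows, a limit configuration \<open>e\<close> is reached by hitting all components of \<open>e\<close> over and over
again without ever falling below \<open>e\<close>, so the configurations before the first overflow form an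
inductively defined set and the configuration at the overflow is arithmetical in it. Passing in
this way from overflow to overflow is the step function of a new machine. At the k-th iteration of
the construction, any further step passes overflows of at least k different registers. Hence for
large k a single step leads to the end of any halting run.\<close>

section \<open>A class of predicates closed under well-founded parts\<close>

text \<open>A decider must halt on every oracle, but \<open>P\<close> may diverge on oracles other
  than \<open>y\<close>, so membership in \<open>A\<close> cannot be tested by running
  \<open>P\<close>. Hence halting is replaced by \<open>Hp\<close>, a predicate with a truth value
  at every oracle that agrees with the outcome wherever the program halts, and it is built from
  well-founded parts, which a machine can decide outright. The recognizing program halts on every
  oracle, so its \<open>Hp\<close> is exactly equality with \<open>x\<close>, whatever real is
  extracted from the oracle. Runs live on arbitrary well-orders of reals. To be compared they are
  moved to one axis longer than all of these, where a run can be prolonged past its halting time;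
  the deciding runs are moved back from it. Overflow is the obstacle to definability: repeated hits
  certify a finite limit, but not that a 0 stems from an infinite one. That finitely many levels
  suffice rests on the convention for overflow: it leaves 0, so a component that stays positive on
  the way to its own overflow cannot overflow on that stretch.\<close>

abbreviation pr :: "nat => nat => nat" where "pr a b \<equiv> prod_encode (a, b)"
definition p1 :: "nat => nat" where "p1 n = fst (prod_decode n)"
definition p2 :: "nat => nat" where "p2 n = snd (prod_decode n)"

lemma p1_pr [simp]: "p1 (pr a b) = a" and p2_pr [simp]: "p2 (pr a b) = b"
  and pr_p1_p2 [simp]: "pr (p1 n) (p2 n) = n"
  by (simp_all add: p1_def p2_def)

lemma p1_le: "p1 n \<le> n" and p2_le: "p2 n \<le> n"
  by (metis pr_p1_p2 le_prod_encode_1, metis pr_p1_p2 le_prod_encode_2)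

text \<open>The unary primitive recursive functions: on paired arguments, iterating a unary function
  replaces the recursion scheme.\<close>

inductive Fn :: "(nat => nat) => bool" where
  Fn_id: "Fn (\<lambda>n. n)"
| Fn_0: "Fn (\<lambda>n. 0)"
| Fn_Suc: "Fn f ==> Fn (\<lambda>n. Suc (f n))"
| Fn_p1: "Fn f ==> Fn (\<lambda>n. p1 (f n))"
| Fn_p2: "Fn f ==> Fn (\<lambda>n. p2 (f n))"
| Fn_pr: "Fn f ==> Fn g ==> Fn (\<lambda>n. pr (f n) (g n))"
| Fn_iter: "Fn f ==> Fn (\<lambda>n. (f ^^ p1 n) (p2 n))"
| Fn_comp: "Fn f ==> Fn g ==> Fn (\<lambda>n. f (g n))"

named_theorems Fnc

lemma Fn_const: "Fn (\<lambda>n. k)"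
  by (induction k) (auto intro: Fn_0 Fn_Suc)

lemma Fn_funpow: "Fn h ==> Fn f ==> Fn g ==> Fn (\<lambda>n. (h ^^ f n) (g n))"
  using Fn_comp[OF Fn_iter[of h] Fn_pr[of f g]] by simp

lemma Fn_add: "Fn f ==> Fn g ==> Fn (\<lambda>n. f n + g n)"
proof -
  have *: "(Suc ^^ a) b = a + b" for a b by (induction a) auto
  assume "Fn f" "Fn g"
  from Fn_funpow[OF Fn_Suc[OF Fn_id] this] show ?thesis by (simp add: *)
qed

lemmas [Fnc] = Fn_id Fn_const Fn_Suc Fn_p1 Fn_p2 Fn_pr Fn_add

text \<open>The rules of \<open>W R\<close> are indexed by \<open>b\<close>: from all \<open>c\<close> with \<open>R a b c\<close> infer \<open>a\<close>.\<close>
inductive W :: "(nat => nat => nat => bool) => nat => bool" for R where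
  W_intro: "(!!c. R a b c ==> W R c) ==> W R a"

text \<open>The rules are kept few because the class is used by induction over them
  (\<open>C_oracle_sub\<close>, \<open>C_force\<close>, \<open>C_computes\<close>). Quantifiers are
  recovered as well-founded parts in \<open>C_ex\<close>, and a parameter of a well-founded part has
  to be packed into its elements.\<close>

inductive C :: "(nat set => nat => bool) => bool" where
  C_orc: "Fn f ==> C (\<lambda>z n. f n \<in> z)"
| C_eq: "Fn f ==> Fn g ==> C (\<lambda>z n. f n = g n)"
| C_neg: "C p ==> C (\<lambda>z n. \<not> p z n)"
| C_conj: "C p ==> C q ==> C (\<lambda>z n. p z n \<and> q z n)"
| C_sub: "C p ==> Fn f ==> C (\<lambda>z n. p z (f n))"
| C_W: "C (\<lambda>z n. R z (p1 n) (p1 (p2 n)) (p2 (p2 n))) ==> C (\<lambda>z n. W (R z) n)"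

named_theorems Cc

lemma C_disj: "C p ==> C q ==> C (\<lambda>z n. p z n \<or> q z n)"
  using C_neg[OF C_conj[OF C_neg C_neg], of p q] by simp
lemma C_imp: "C p ==> C q ==> C (\<lambda>z n. p z n --> q z n)"
  unfolding imp_conv_disj by (intro C_disj C_neg)

text \<open>If \<open>p a b\<close> fails, the rule with index \<open>b\<close> has every number as
  a premise, \<open>a\<close> included, and derives nothing; if it holds, the rule is an axiom. The
  same device encodes side conditions further on.\<close>

lemma W_ex: "W (\<lambda>a b c. \<not> p a b) a \<longleftrightarrow> (\<exists>b. p a b)"
proof
  show "W (\<lambda>a b c. \<not> p a b) a ==> \<exists>b. p a b" by (induction rule: W.induct) blast
qed (auto intro: W_intro)

lemma C_ex:
  assumes "C (\<lambda>z n. p z (p1 n) (p2 n))" shows "C (\<lambda>z n. \<exists>b. p z n b)"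
proof -
  have "C (\<lambda>z n. \<not> p z (p1 n) (p1 (p2 n)))"
    using C_neg[OF C_sub[OF assms Fn_pr[OF Fn_p1[OF Fn_id] Fn_p1[OF Fn_p2[OF Fn_id]]]]] by simp
  from C_W[of "\<lambda>z a b c. \<not> p z a b", OF this] show ?thesis by (simp add: W_ex)
qed

lemma C_all:
  assumes "C (\<lambda>z n. p z (p1 n) (p2 n))" shows "C (\<lambda>z n. \<forall>b. p z n b)"
  using C_neg[OF C_ex[of "\<lambda>z a b. \<not> p z a b"]] C_neg[OF assms] by simp

lemma C_W':
  assumes "C (\<lambda>z n. R z (p1 n) (p1 (p2 n)) (p2 (p2 n)))" "Fn f"
  shows "C (\<lambda>z n. W (R z) (f n))"
  using C_sub[OF C_W[OF assms(1)] assms(2)] .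

lemma C_app2:
  assumes "C (\<lambda>z n. p z (p1 n) (p2 n))" "Fn f" "Fn g"
  shows "C (\<lambda>z n. p z (f n) (g n))"
  using C_sub[OF assms(1) Fn_pr[OF assms(2,3)]] by simp

lemma C_app3:
  assumes "C (\<lambda>z n. p z (p1 n) (p1 (p2 n)) (p2 (p2 n)))" "Fn f" "Fn g" "Fn h"
  shows "C (\<lambda>z n. p z (f n) (g n) (h n))"
  using C_sub[OF assms(1) Fn_pr[OF assms(2) Fn_pr[OF assms(3,4)]]] by simp

lemma C_le: "Fn f ==> Fn g ==> C (\<lambda>z n. f n \<le> g n)"
proof -
  assume a: "Fn f" "Fn g"
  have "C (\<lambda>z n. \<exists>d. g n = f n + d)"
    by (intro C_ex C_eq Fnc Fn_comp[OF a(1)] Fn_comp[OF a(2)])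
  then show ?thesis by (simp add: le_iff_add)
qed

lemma C_less: "Fn f ==> Fn g ==> C (\<lambda>z n. f n < g n)"
  using C_le[of "\<lambda>n. Suc (f n)" g] by (simp add: Fnc Suc_le_eq)

lemma C_const: "C (\<lambda>z n. P)"
  using C_eq[of "\<lambda>n. 0" "\<lambda>n. 0"] C_neg[OF C_eq[of "\<lambda>n. 0" "\<lambda>n. 0"]] by (cases P) (simp_all add: Fnc)

lemma C_if: "C p ==> C q ==> C r ==> C (\<lambda>z n. if p z n then q z n else r z n)"
  unfolding if_bool_eq_conj by (intro C_conj C_imp C_neg)

lemma C_iff: "C p ==> C q ==> C (\<lambda>z n. p z n \<longleftrightarrow> q z n)"
  unfolding iff_conv_conj_imp by (intro C_conj C_imp)

lemmas [Cc] = C_const C_eq C_le C_less C_neg C_conj C_disj C_imp C_iff C_if C_ex C_all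

text \<open>Lets the recognizing program be applied to the real that another program extracts from
  \<open>z\<close>.\<close>

lemma C_oracle_sub:
  assumes "C p" and q: "C q" shows "C (\<lambda>z n. p {i. q z i} n)"
  using assms(1)
proof induction
  case (C_orc f) then show ?case using C_sub[OF q] by simp
next
  case (C_W R)
  show ?case using C.C_W[of "\<lambda>z. R {i. q z i}", OF C_W.IH] .
qed (auto intro: C.intros)

subsection \<open>Coded sequences of finite support\<close>

text \<open>The tail of a sequence is the first component of the pair: \<open>p1 n < n\<close> for all \<open>n > 0\<close>, whereas
\<open>p2 1 = 1\<close>.\<close>
definition cmp :: "nat => nat => nat" where "cmp j c = p2 ((p1 ^^ j) c)"

lemma Fn_cmp [Fnc]: "Fn f ==> Fn g ==> Fn (\<lambda>n. cmp (f n) (g n))"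
  unfolding cmp_def by (intro Fn_p1 Fn_funpow Fn_id Fn_p2)

lemma p1_p2_0 [simp]: "p1 0 = 0" "p2 0 = 0"
  using p1_le[of 0] p2_le[of 0] by auto

lemma p1_less: "n > 0 ==> p1 n < n"
proof -
  assume n: "n > 0"
  have 1: "n = triangle (p1 n + p2 n) + p1 n" 
    using pr_p1_p2[of n] by (simp only: prod_encode_def prod.case)
  moreover have "triangle k \<ge> k" for k by (induction k) auto
  ultimately have "triangle (p1 n + p2 n) \<ge> p1 n + p2 n" by blast
  show ?thesis
  proof (cases "p1 n + p2 n = 0")
    case True then show ?thesis using n by simp
  next
    case False
    then have "triangle (p1 n + p2 n) > 0" using \<open>triangle (p1 n + p2 n) \<ge> p1 n + p2 n\<close> by linarith
    then show ?thesis using 1 by linarith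
  qed
qed

lemma cmp_0 [simp]: "cmp 0 c = p2 c" and cmp_Suc [simp]: "cmp (Suc j) c = cmp j (p1 c)"
  by (simp_all add: cmp_def funpow_swap1)

text \<open>The pairing is a bijection with \<open>pr 0 0 = 0\<close>, so only 0 codes the zero
  sequence. Hence codes are unique, and a limit state is determined by the limits of its
  components.\<close>

lemma cmp_inj: "(!!j. cmp j c = cmp j d) ==> c = d"
proof (induction c arbitrary: d rule: less_induct)
  case (less c)
  have z: "x = 0" if "!!j. cmp j x = 0" for x
    using that
  proof (induction x rule: less_induct)
    case (less x)
    show ?case
    proof (rule ccontr)
      assume "x \<noteq> 0"
      then have "p1 x = 0" using less.IH[of "p1 x"] p1_less[of x] less.prems[of "Suc _"] by simp
      moreover have "p2 x = 0" using less.prems[of 0] by simp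
      ultimately show False using \<open>x \<noteq> 0\<close> pr_p1_p2[of x] by (simp add: prod_encode_def)
    qed
  qed
  have zc: "cmp j 0 = 0" for j by (induction j) auto
  show ?case
  proof (cases "c = 0")
    case True
    then have "cmp j d = 0" for j using less.prems[of j] zc by simp
    then show ?thesis using z[of d] True by simp
  next
    case False
    have "p1 c = p1 d" using less.IH[of "p1 c" "p1 d"] p1_less[of c] False less.prems[of "Suc _"] by simp
    moreover have "p2 c = p2 d" using less.prems[of 0] by simp
    ultimately show ?thesis by (metis pr_p1_p2)
  qed
qed

lemma cmp_ex: "\<exists>c. \<forall>j. cmp j c = (if j < N then v j else 0)"
proof (induction N arbitrary: v)
  case 0
  have "cmp j 0 = 0" for j by (induction j) auto
  then show ?case by auto
next
  case (Suc N)
  from Suc[of "\<lambda>j. v (Suc j)"] obtain c where c: "!!j. cmp j c = (if j < N then v (Suc j) else 0)" by blast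
  have "cmp j (pr c (v 0)) = (if j < Suc N then v j else 0)" for j
    by (cases j) (auto simp: c)
  then show ?case by blast
qed

definition enc :: "nat => (nat => nat) => nat" where
  "enc N v = (SOME c. \<forall>j. cmp j c = (if j < N then v j else 0))"

lemma cmp_enc [simp]: "cmp j (enc N v) = (if j < N then v j else 0)"
  using someI_ex[OF cmp_ex[of N v]] unfolding enc_def by blast

section \<open>Category forcing\<close>

text \<open>A condition is a number \<open>s\<close> coding a binary string of length
  \<open>p1 s\<close>, so that forcing is a predicate of numbers and can itself belong to
  \<open>C\<close>. Components of \<open>p2 s\<close> beyond the length carry no meaning.\<close>

definition cy :: "nat => nat set set" where
  "cy s = {z. \<forall>n < p1 s. n \<in> z \<longleftrightarrow> cmp n (p2 s) \<noteq> 0}"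
definition ext :: "nat => nat => bool" where
  "ext t s \<longleftrightarrow> p1 s \<le> p1 t \<and> (\<forall>n < p1 s. cmp n (p2 t) \<noteq> 0 \<longleftrightarrow> cmp n (p2 s) \<noteq> 0)"

lemma ext_refl [simp]: "ext s s" by (simp add: ext_def)
lemma ext_trans: "ext u t ==> ext t s ==> ext u s" unfolding ext_def by fastforce
lemma ext_cy: "ext t s ==> z \<in> cy t ==> z \<in> cy s" unfolding ext_def cy_def by fastforce
lemma cy_linear: "z \<in> cy s ==> z \<in> cy t ==> ext t s \<or> ext s t"
  unfolding ext_def cy_def using nat_le_linear[of "p1 s" "p1 t"] by fastforce

definition bits :: "nat => bool list" where
  "bits s = map (\<lambda>n. cmp n (p2 s) \<noteq> 0) [0..<p1 s]"

lemma cyl_bits: "cyl (bits s) = cy s" by (auto simp: cyl_def cy_def bits_def)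

lemma bits_surj: "\<exists>s. bits s = \<sigma>"
  by (rule exI[of _ "pr (length \<sigma>) (enc (length \<sigma>) (\<lambda>n. if \<sigma> ! n then 1 else 0))"])
     (auto simp: bits_def intro: nth_equalityI)

lemma ext_bits: "ext t s \<longleftrightarrow> (\<exists>\<tau>. bits t = bits s @ \<tau>)"
proof
  assume e: "ext t s"
  then have "take (p1 s) (bits t) = bits s" by (intro nth_equalityI) (auto simp: ext_def bits_def)
  then show "\<exists>\<tau>. bits t = bits s @ \<tau>" by (metis append_take_drop_id)
next
  assume "\<exists>\<tau>. bits t = bits s @ \<tau>"
  then obtain \<tau> where t: "bits t = bits s @ \<tau>" ..
  then have l: "p1 s \<le> p1 t" 
  proof -
    have "length (bits t) = length (bits s) + length \<tau>" using t by simp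
    then show ?thesis by (simp add: bits_def)
  qed
  have "bits t ! n = bits s ! n" if "n < p1 s" for n using that t by (simp add: nth_append bits_def)
  then show "ext t s" using l by (auto simp: ext_def bits_def)
qed

lemma nowhere_dense_iff: "nowhere_dense A \<longleftrightarrow> (\<forall>s. \<exists>t. ext t s \<and> cy t \<inter> A = {})"
  unfolding nowhere_dense_def
proof safe
  fix s assume "\<forall>\<sigma>. \<exists>\<tau>. cyl (\<sigma> @ \<tau>) \<inter> A = {}"
  then obtain \<tau> where \<tau>: "cyl (bits s @ \<tau>) \<inter> A = {}" by blast
  obtain t where "bits t = bits s @ \<tau>" using bits_surj by blast
  with \<tau> show "\<exists>t. ext t s \<and> cy t \<inter> A = {}" by (metis cyl_bits ext_bits)
next
  fix \<sigma> assume a: "\<forall>s. \<exists>t. ext t s \<and> cy t \<inter> A = {}"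
  obtain s where "bits s = \<sigma>" using bits_surj by blast
  with a show "\<exists>\<tau>. cyl (\<sigma> @ \<tau>) \<inter> A = {}" by (metis cyl_bits ext_bits)
qed

section \<open>Meager sets and the Baire category theorem\<close>

lemma meager_subset: "meager B ==> A \<subseteq> B ==> meager A"
  unfolding meager_def by (meson subset_trans)

lemma meager_nowhere_dense: "nowhere_dense A ==> meager A"
  unfolding meager_def by (rule exI[of _ "\<lambda>_. A"]) auto

lemma meager_empty: "meager {}"
  by (rule meager_nowhere_dense) (simp add: nowhere_dense_def)

lemma meager_UN:
  assumes "!!n::nat. meager (A n)" shows "meager (\<Union>n. A n)"
proof -
  have "\<forall>n. \<exists>N :: nat => nat set set. (\<forall>k. nowhere_dense (N k)) \<and> A n \<subseteq> (\<Union>k. N k)"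
    using assms unfolding meager_def by blast
  then obtain N :: "nat => nat => nat set set"
    where N: "!!n k. nowhere_dense (N n k)" "!!n. A n \<subseteq> (\<Union>k. N n k)" by metis
  have "A n \<subseteq> (\<Union>k. N (p1 k) (p2 k))" for n
  proof
    fix z assume "z \<in> A n"
    then obtain k where "z \<in> N n k" using N(2) by blast
    then show "z \<in> (\<Union>k. N (p1 k) (p2 k))" by (intro UN_I[of "pr n k"]) auto
  qed
  then show ?thesis unfolding meager_def using N(1) by (intro exI[of _ "\<lambda>k. N (p1 k) (p2 k)"]) auto
qed

lemma meager_Un: assumes "meager A" "meager B" shows "meager (A \<union> B)"
proof -
  have "meager (\<Union>n::nat. if n = 0 then A else B)" using assms by (intro meager_UN) auto
  then show ?thesis by (rule meager_subset) (auto split: if_splits)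
qed

lemma baire: "\<not> meager (cy s)"
proof
  assume "meager (cy s)"
  then obtain N :: "nat => nat set set" where N: "!!n. nowhere_dense (N n)" "cy s \<subseteq> (\<Union>n. N n)"
    unfolding meager_def by blast
  have "\<forall>n u. \<exists>t. ext t u \<and> cy t \<inter> N n = {}" using N(1) nowhere_dense_iff by blast
  then obtain h where h: "!!n u. ext (h n u) u" "!!n u. cy (h n u) \<inter> N n = {}" by metis
  define t where "t = rec_nat s h"
  have t: "t 0 = s" "t (Suc n) = h n (t n)" for n by (simp_all add: t_def)
  have e: "ext (t (k + m)) (t k)" for k m by (induction m) (auto simp: t intro: ext_trans h)
  define z where "z = {n. \<exists>k. n < p1 (t k) \<and> cmp n (p2 (t k)) \<noteq> 0}"
  have "z \<in> cy (t k)" for k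
  proof -
    have "cmp n (p2 (t k)) \<noteq> 0" if "n < p1 (t k)" "n < p1 (t j)" "cmp n (p2 (t j)) \<noteq> 0" for n j
      using e[of k "j - k"] e[of j "k - j"] that unfolding ext_def by (cases "j \<le> k") auto
    then show ?thesis unfolding cy_def z_def by blast
  qed
  moreover from this[of 0] obtain n where "z \<in> N n" using N(2) t by auto
  ultimately show False using h(2)[of n "t n"] t by (metis disjoint_iff)
qed

text \<open>The form in which genericity is used: almost every real of \<open>cy s\<close> meets a
  set of conditions that is dense below \<open>s\<close>.\<close>

lemma meager_dense:
  assumes "!!t. ext t s ==> \<exists>u. ext u t \<and> P u"
  shows "meager {z \<in> cy s. \<forall>u. z \<in> cy u --> \<not> P u}"
proof (rule meager_nowhere_dense, unfold nowhere_dense_iff, intro allI)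
  fix t
  show "\<exists>u. ext u t \<and> cy u \<inter> {z \<in> cy s. \<forall>u. z \<in> cy u --> \<not> P u} = {}"
  proof (cases "\<exists>z. z \<in> cy t \<and> z \<in> cy s")
    case True
    then have "ext t s \<or> ext s t" using cy_linear by blast
    then obtain u where "ext u t" "P u" using assms ext_trans ext_refl by meson
    then show ?thesis by blast
  next
    case False
    then show ?thesis by (intro exI[of _ t]) auto
  qed
qed

text \<open>Forcing is defined semantically, as truth on a comeager part of the cylinder. The
  clauses of the usual recursive definition become the theorems \<open>force_neg\<close>,
  \<open>force_conj\<close> and \<open>force_W\<close>.\<close>

definition force :: "(nat set => nat => bool) => nat => nat => bool" where
  "force p s n \<longleftrightarrow> meager {z \<in> cy s. \<not> p z n}"

text \<open>The Baire property.\<close>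
definition decisive :: "(nat set => nat => bool) => bool" where
  "decisive p \<longleftrightarrow> (\<forall>s n. \<exists>t. ext t s \<and> (force p t n \<or> force (\<lambda>z n. \<not> p z n) t n))"

lemma force_ext: "force p s n ==> ext t s ==> force p t n"
  unfolding force_def by (erule meager_subset) (auto dest: ext_cy)

lemma force_consistent: "force p s n ==> force (\<lambda>z n. \<not> p z n) s n ==> False"
proof -
  assume "force p s n" "force (\<lambda>z n. \<not> p z n) s n"
  then have "meager ({z \<in> cy s. \<not> p z n} \<union> {z \<in> cy s. \<not> \<not> p z n})"
    unfolding force_def by (rule meager_Un)
  then have "meager (cy s)" by (rule meager_subset) auto
  then show False using baire by blast
qed

text \<open>The truth lemma. There are only countably many conditions and numbers, so one meager set
  can collect all failures: reals where a forced statement is false, and reals that meet no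
  condition deciding \<open>p\<close> at some \<open>n\<close>.\<close>

lemma decisive_generic:
  assumes "decisive p"
  obtains M where "meager M" "!!z n. z \<notin> M ==> p z n \<longleftrightarrow> (\<exists>s. z \<in> cy s \<and> force p s n)"
proof -
  let ?np = "\<lambda>z n. \<not> p z n"
  let ?A = "\<lambda>q s n. {z \<in> cy s. force q s n \<and> \<not> q z n}"
  let ?B = "\<lambda>n. {z \<in> cy 0. \<forall>u. z \<in> cy u --> \<not> (force p u n \<or> force ?np u n)}"
  let ?M = "(\<Union>s. \<Union>n. ?A p s n) \<union> (\<Union>s. \<Union>n. ?A ?np s n) \<union> (\<Union>n. ?B n)"
  have A: "meager (?A q s n)" for q s n
  proof (cases "force q s n")
    case True then show ?thesis unfolding force_def by (rule meager_subset) auto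
  next
    case False then show ?thesis using meager_empty by simp
  qed
  have B: "meager (?B n)" for n using assms unfolding decisive_def by (intro meager_dense) blast
  have M: "meager ?M" by (intro meager_Un meager_UN A B)
  have "p z n \<longleftrightarrow> (\<exists>s. z \<in> cy s \<and> force p s n)" if z: "z \<notin> ?M" for z n
  proof
    assume pz: "p z n"
    have "z \<in> cy 0" by (simp add: cy_def)
    then have "\<forall>n. \<exists>u. z \<in> cy u \<and> (force p u n \<or> force ?np u n)" using z by auto
    then obtain u where u: "z \<in> cy u" "force p u n \<or> force ?np u n" by blast
    moreover have "\<not> force ?np u n" using z u pz by auto
    ultimately show "\<exists>s. z \<in> cy s \<and> force p s n" by blast
  next
    assume "\<exists>s. z \<in> cy s \<and> force p s n"
    then show "p z n" using z by auto
  qed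
  with M that show ?thesis by blast
qed

lemma force_neg:
  assumes "decisive p"
  shows "force (\<lambda>z n. \<not> p z n) s n \<longleftrightarrow> (\<forall>t. ext t s --> \<not> force p t n)"
proof
  show "force (\<lambda>z n. \<not> p z n) s n ==> \<forall>t. ext t s --> \<not> force p t n"
    using force_ext[of "\<lambda>z n. \<not> p z n"] force_consistent by blast
next
  assume a: "\<forall>t. ext t s --> \<not> force p t n"
  obtain M where M: "meager M" "!!z n. z \<notin> M ==> p z n \<longleftrightarrow> (\<exists>s. z \<in> cy s \<and> force p s n)"
    using decisive_generic[OF assms] by blast
  have "{z \<in> cy s. p z n} \<subseteq> M"
  proof (clarify, rule ccontr)
    fix z assume z: "z \<in> cy s" "p z n" "z \<notin> M"
    then obtain u where u: "z \<in> cy u" "force p u n" using M by blast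
    then show False using cy_linear[OF z(1) u(1)] a force_ext[OF u(2)] ext_refl by blast
  qed
  then show "force (\<lambda>z n. \<not> p z n) s n" unfolding force_def using meager_subset[OF M(1)] by simp
qed

lemma decisive_neg: assumes "decisive p" shows "decisive (\<lambda>z n. \<not> p z n)"
  using assms unfolding decisive_def by (simp add: force_def) blast

lemma force_conj: "force (\<lambda>z n. p z n \<and> q z n) s n \<longleftrightarrow> force p s n \<and> force q s n"
proof -
  have "{z \<in> cy s. \<not> (p z n \<and> q z n)} = {z \<in> cy s. \<not> p z n} \<union> {z \<in> cy s. \<not> q z n}" by auto
  moreover have "meager (A \<union> B) \<longleftrightarrow> meager A \<and> meager B" for A B
    using meager_Un[of A B] meager_subset[of "A \<union> B" A] meager_subset[of "A \<union> B" B] by auto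
  ultimately show ?thesis unfolding force_def by simp
qed

lemma decisive_conj: assumes p: "decisive p" and q: "decisive q" shows "decisive (\<lambda>z n. p z n \<and> q z n)"
  unfolding decisive_def
proof (intro allI)
  fix s n
  obtain t where t: "ext t s" "force p t n \<or> force (\<lambda>z n. \<not> p z n) t n" using p unfolding decisive_def by blast
  obtain u where u: "ext u t" "force q u n \<or> force (\<lambda>z n. \<not> q z n) u n" using q unfolding decisive_def by blast
  have "force r u n ==> (!!z n. r z n ==> \<not> (p z n \<and> q z n)) ==> force (\<lambda>z n. \<not> (p z n \<and> q z n)) u n" for r
    unfolding force_def by (erule meager_subset) auto
  from this[of "\<lambda>z n. \<not> p z n"] this[of "\<lambda>z n. \<not> q z n"]
  show "\<exists>t. ext t s \<and> (force (\<lambda>z n. p z n \<and> q z n) t n \<or> force (\<lambda>z n. \<not> (p z n \<and> q z n)) t n)"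
    using t u force_ext[OF _ u(1)] ext_trans unfolding force_conj by blast
qed

text \<open>The rule of \<open>W\<close> read in forcing terms: the choice of \<open>b\<close> is
  made densely below \<open>s\<close>, and a premise \<open>c\<close> counts at each extension
  \<open>v\<close> that forces it. The definition is positive, hence again a well-founded
  part.\<close>

inductive Ws :: "(nat => nat => nat => nat => bool) => nat => nat => bool" for F where
  Ws_intro: "(!!t. ext t s ==> \<exists>u b. ext u t \<and> (\<forall>c v. ext v u --> F v a b c --> Ws F v c)) ==> Ws F s a"

text \<open>A rule of \<open>Ws\<close> alternates for all, exists, for all, whereas a rule of
  \<open>W\<close> has only exists, for all; so it is split in two. Elements with tag 0 stand for
  \<open>Ws F s a\<close> and pass to every \<open>t\<close>; elements with tag 1 choose
  \<open>u\<close> and \<open>b\<close> and return to tag 0. An index whose \<open>u\<close> does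
  not extend \<open>t\<close> makes every number a premise and is useless.\<close>

lemma Ws_W:
  "Ws F s a \<longleftrightarrow> W (\<lambda>A B D.
      (p1 A = 0 --> p1 D = 1 \<and> p2 (p2 D) = p2 (p2 A) \<and> ext (p1 (p2 D)) (p1 (p2 A))) \<and>
      (p1 A \<noteq> 0 --> ext (p1 B) (p1 (p2 A)) -->
         p1 D = 0 \<and> ext (p1 (p2 D)) (p1 B) \<and> F (p1 (p2 D)) (p2 (p2 A)) (p2 B) (p2 (p2 D))))
    (pr 0 (pr s a))" (is "_ \<longleftrightarrow> W ?R _")
proof
  assume "Ws F s a"
  then show "W ?R (pr 0 (pr s a))"
  proof induction
    case (Ws_intro s a)
    show ?case
    proof (rule W_intro[where b = 0])
      fix D assume R: "?R (pr 0 (pr s a)) 0 D"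
      define t where "t = p1 (p2 D)"
      have D: "D = pr 1 (pr t a)" using R unfolding t_def by (metis p1_pr p2_pr pr_p1_p2)
      have "ext t s" using R by (simp add: t_def)
      then obtain u b where ub: "ext u t"
        "!!c v. ext v u ==> F v a b c ==> W ?R (pr 0 (pr v c))" using Ws_intro.IH[OF \<open>ext t s\<close>] by meson
      show "W ?R D"
      proof (rule W_intro[where b = "pr u b"])
        fix E assume "?R D (pr u b) E"
        then have "p1 E = 0" "ext (p1 (p2 E)) u" "F (p1 (p2 E)) a b (p2 (p2 E))" using ub(1) D by auto
        note E = this
        have "W ?R (pr 0 (pr (p1 (p2 E)) (p2 (p2 E))))" by (rule ub(2)[OF E(2,3)])
        moreover have "pr 0 (pr (p1 (p2 E)) (p2 (p2 E))) = E" using E(1) pr_p1_p2[of E] by simp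
        ultimately show "W ?R E" by (simp only:)
      qed
    qed
  qed
next
  have "(p1 A = 0 --> Ws F (p1 (p2 A)) (p2 (p2 A))) \<and>
    (p1 A = 1 --> (\<exists>u b. ext u (p1 (p2 A)) \<and> (\<forall>c v. ext v u --> F v (p2 (p2 A)) b c --> Ws F v c)))"
    if "W ?R A" for A using that
  proof induction
    case (W_intro A B)
    define s where "s = p1 (p2 A)"
    define a where "a = p2 (p2 A)"
    have "Ws F s a" if 0: "p1 A = 0"
    proof (rule Ws_intro)
      fix t assume "ext t s"
      then have "?R A B (pr 1 (pr t a))" using 0 by (simp add: s_def a_def)
      from W_intro.IH[OF this] show "\<exists>u b. ext u t \<and> (\<forall>c v. ext v u --> F v a b c --> Ws F v c)" by simp
    qed
    moreover have "\<exists>u b. ext u s \<and> (\<forall>c v. ext v u --> F v a b c --> Ws F v c)" if 1: "p1 A = 1"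
    proof (cases "ext (p1 B) s")
      case True
      have "Ws F v c" if "ext v (p1 B)" "F v a (p2 B) c" for v c
      proof -
        have "?R A B (pr 0 (pr v c))" using that 1 by (simp add: s_def a_def)
        from W_intro.IH[OF this] show ?thesis by simp
      qed
      with True show ?thesis by blast
    next
      case False
      then have "?R A B A" using 1 by (simp add: s_def)
      from W_intro.IH[OF this] 1 show ?thesis by (simp add: s_def a_def)
    qed
    ultimately show ?case unfolding s_def a_def by blast
  qed
  from this[of "pr 0 (pr s a)"] show "W ?R (pr 0 (pr s a)) ==> Ws F s a" by simp
qed

text \<open>Take the \<open>t\<close> at which the rule fails. An extension of \<open>t\<close> in
  \<open>Ws\<close> would itself supply the \<open>u\<close> and \<open>b\<close> that are missing
  below \<open>t\<close>.\<close>

lemma not_Ws: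
  assumes "\<not> Ws F s a"
  obtains t where "ext t s" "!!u. ext u t ==> \<not> Ws F u a"
proof -
  from assms obtain t where t: "ext t s"
    "!!u b. ext u t ==> \<exists>c v. ext v u \<and> F v a b c \<and> \<not> Ws F v c"
    using Ws_intro[of s F a] by metis
  have "\<not> Ws F u a" if "ext u t" for u
  proof
    assume "Ws F u a"
    then obtain w b where "ext w u" "!!c v. ext v w ==> F v a b c ==> Ws F v c"
      using ext_refl by cases blast
    then show False using t(2)[of w b] ext_trans[OF _ \<open>ext u t\<close>] by blast
  qed
  with t(1) that show ?thesis by blast
qed

context
  fixes R :: "nat set => nat => nat => nat => bool" and q F
  defines "q \<equiv> \<lambda>z n. R z (p1 n) (p1 (p2 n)) (p2 (p2 n))"
    and "F \<equiv> \<lambda>s a b c. force q s (pr a (pr b c))"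
  assumes dec: "decisive q"
begin

lemma F_ext: "F s a b c ==> ext t s ==> F t a b c"
  unfolding F_def by (rule force_ext)

text \<open>Induction over \<open>Ws\<close>. A generic \<open>z\<close> below \<open>s\<close>
  meets a \<open>u\<close> that fixes \<open>b\<close>; if \<open>R z a b c\<close> holds, some
  \<open>v\<close> met by \<open>z\<close> forces it, and the induction hypothesis applies at the
  stronger of \<open>u\<close> and \<open>v\<close>, which are comparable.\<close>

lemma Ws_force:
  assumes "Ws F s a" shows "force (\<lambda>z n. W (R z) n) s a"
  using assms
proof induction
  case (Ws_intro s a)
  let ?w = "\<lambda>z n. W (R z) n"
  obtain M where M: "meager M" "!!z n. z \<notin> M ==> q z n \<longleftrightarrow> (\<exists>s. z \<in> cy s \<and> force q s n)"
    using decisive_generic[OF dec] by blast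
  let ?P = "\<lambda>u. \<exists>b. \<forall>c v. ext v u --> F v a b c --> force ?w v c"
  let ?A = "{z \<in> cy s. \<forall>u. z \<in> cy u --> \<not> ?P u}"
  define B where "B v c = {z \<in> cy v. force ?w v c \<and> \<not> ?w z c}" for v c
  have "meager (B v c)" for v c
  proof (cases "force ?w v c")
    case True then show ?thesis unfolding force_def by (rule meager_subset) (auto simp: B_def)
  next
    case False then show ?thesis using meager_empty by (simp add: B_def)
  qed
  moreover have "meager ?A" using Ws_intro.IH by (intro meager_dense) blast
  ultimately have m: "meager (M \<union> ?A \<union> (\<Union>v. \<Union>c. B v c))" by (intro meager_Un meager_UN M)
  have *: "?w z a" if z: "z \<in> cy s" "z \<notin> M \<union> ?A \<union> (\<Union>v. \<Union>c. B v c)" for z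
  proof -
    obtain u b where u: "z \<in> cy u" "!!c v. ext v u ==> F v a b c ==> force ?w v c"
      using z by blast
    show ?thesis
    proof (rule W_intro[where b = b])
      fix c assume "R z a b c"
      then have "q z (pr a (pr b c))" by (simp add: q_def)
      then obtain v where v: "z \<in> cy v" "F v a b c"
        using M(2)[of z "pr a (pr b c)"] z unfolding F_def by auto
      obtain v' where v': "z \<in> cy v'" "ext v' u" "ext v' v"
        using cy_linear[OF u(1) v(1)] u(1) v(1) ext_refl by blast
      have "force ?w v' c" by (rule u(2)[OF v'(2) F_ext[OF v(2) v'(3)]])
      moreover have "z \<notin> B v' c" using contra_subsetD[OF Un_upper2 z(2)] by blast
      ultimately show "W (R z) c" using v'(1) by (simp add: B_def)
    qed
  qed
  show ?case unfolding force_def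
  proof (rule meager_subset[OF m], rule subsetI, rule ccontr)
    fix z assume "z \<in> {z \<in> cy s. \<not> ?w z a}" and b: "z \<notin> M \<union> ?A \<union> (\<Union>v. \<Union>c. B v c)"
    then show False using *[OF _ b] by simp
  qed
qed

text \<open>\<open>G\<close> says that no extension lies in \<open>Ws\<close>. For a generic
  \<open>z\<close>, each \<open>b\<close> admits a true premise \<open>c\<close> that satisfies
  \<open>G\<close> again at a condition met by \<open>z\<close>; so numbers satisfying
  \<open>G\<close> at a condition met by \<open>z\<close> are never derived.\<close>

lemma not_Ws_force:
  assumes "!!t. ext t s ==> \<not> Ws F t a" shows "force (\<lambda>z n. \<not> W (R z) n) s a"
proof -
  define G where "G s a \<longleftrightarrow> (\<forall>t. ext t s --> \<not> Ws F t a)" for s a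
  let ?P = "\<lambda>a b u. \<exists>c. F u a b c \<and> G u c"
  define A where "A s a b = {z \<in> cy s. G s a \<and> (\<forall>u. z \<in> cy u --> \<not> ?P a b u)}" for s a b
  obtain M where M: "meager M" "!!z n. z \<notin> M ==> q z n \<longleftrightarrow> (\<exists>s. z \<in> cy s \<and> force q s n)"
    using decisive_generic[OF dec] by blast
  have "meager (A s a b)" for s a b
  proof (cases "G s a")
    case True
    have "\<exists>u. ext u t \<and> ?P a b u" if "ext t s" for t
    proof -
      have "\<not> Ws F t a" using True that by (simp add: G_def)
      then obtain w where w: "ext w t" "!!u b. ext u w ==> \<exists>c v. ext v u \<and> F v a b c \<and> \<not> Ws F v c"
        using Ws.intros[of t F a] by metis
      then obtain c v where v: "ext v w" "F v a b c" "\<not> Ws F v c" using ext_refl by blast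
      then obtain u where "ext u v" "G u c" using not_Ws unfolding G_def by metis
      then show ?thesis using w(1) v F_ext ext_trans by meson
    qed
    then have "meager {z \<in> cy s. \<forall>u. z \<in> cy u --> \<not> ?P a b u}" by (rule meager_dense)
    then show ?thesis by (rule meager_subset) (auto simp: A_def)
  next
    case False then show ?thesis using meager_empty by (simp add: A_def)
  qed
  then have m: "meager (M \<union> (\<Union>s. \<Union>a. \<Union>b. A s a b))" by (intro meager_Un meager_UN M)
  have "\<forall>s. z \<in> cy s --> \<not> G s a" if z: "z \<notin> M \<union> (\<Union>s. \<Union>a. \<Union>b. A s a b)" "W (R z) a" for z a
    using z(2)
  proof induction
    case (W_intro a b)
    show ?case
    proof (intro allI impI notI)
      fix s assume "z \<in> cy s" "G s a"
      moreover have "z \<notin> A s a b" using z(1) by simp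
      ultimately obtain u c where u: "z \<in> cy u" "F u a b c" "G u c" by (auto simp: A_def)
      then have "R z a b c" using M(2)[of z "pr a (pr b c)"] z(1) unfolding F_def q_def by auto
      then show False using W_intro.IH u by blast
    qed
  qed
  then have "{z \<in> cy s. W (R z) a} \<subseteq> M \<union> (\<Union>s. \<Union>a. \<Union>b. A s a b)"
    using assms unfolding G_def by blast
  then show ?thesis unfolding force_def using meager_subset[OF m] by simp
qed

lemma force_W: "force (\<lambda>z n. W (R z) n) s a \<longleftrightarrow> Ws F s a"
proof
  assume f: "force (\<lambda>z n. W (R z) n) s a"
  show "Ws F s a"
  proof (rule ccontr)
    assume "\<not> Ws F s a"
    then obtain t where t: "ext t s" "!!u. ext u t ==> \<not> Ws F u a" using not_Ws by blast
    from not_Ws_force[OF t(2)] force_ext[OF f t(1)] show False using force_consistent by blast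
  qed
qed (rule Ws_force)

lemma decisive_W: "decisive (\<lambda>z n. W (R z) n)"
  unfolding decisive_def
proof (intro allI)
  fix s a
  show "\<exists>t. ext t s \<and> (force (\<lambda>z n. W (R z) n) t a \<or> force (\<lambda>z n. \<not> W (R z) n) t a)"
  proof (cases "Ws F s a")
    case True then show ?thesis using Ws_force ext_refl by blast
  next
    case False
    then obtain t where "ext t s" "!!u. ext u t ==> \<not> Ws F u a" using not_Ws by blast
    then show ?thesis using not_Ws_force by blast
  qed
qed

end

lemma C_ext: "Fn f ==> Fn g ==> C (\<lambda>z n. ext (f n) (g n))"
proof -
  have "C (\<lambda>z n. ext (p1 n) (p2 n))" unfolding ext_def by (intro Cc Fnc)
  then show "Fn f ==> Fn g ==> C (\<lambda>z n. ext (f n) (g n))" by (rule C_app2)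
qed

text \<open>Both claims go through one induction because the clauses for negation and for
  \<open>W\<close> presuppose that the predicate below is decisive.\<close>

theorem C_force:
  assumes "C p" shows "decisive p \<and> C (\<lambda>_ n. force p (p1 n) (p2 n))"
  using assms
proof induction
  case (C_orc f)
  have *: "force (\<lambda>z n. f n \<in> z) s n \<longleftrightarrow> f n < p1 s \<and> cmp (f n) (p2 s) \<noteq> 0" for s n
  proof
    assume a: "force (\<lambda>z n. f n \<in> z) s n"
    show "f n < p1 s \<and> cmp (f n) (p2 s) \<noteq> 0"
    proof (rule ccontr)
      assume b: "\<not> (f n < p1 s \<and> cmp (f n) (p2 s) \<noteq> 0)"
      \<comment> \<open>Padding with zeros beyond \<open>p1 s\<close>; together with
        \<open>b\<close> this excludes \<open>f n\<close> from every real of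
        \<open>cy t\<close>.\<close>
      define t where "t = pr (p1 s + Suc (f n))
        (enc (p1 s) (\<lambda>i. cmp i (p2 s)))"
      have t: "ext t s" by (auto simp: ext_def t_def)
      have "f n \<notin> z" if "z \<in> cy t" for z using that b by (auto simp: cy_def t_def)
      then have "{z \<in> cy t. f n \<notin> z} = cy t" by blast
      then show False using force_ext[OF a t] baire[of t] by (simp add: force_def)
    qed
  next
    assume "f n < p1 s \<and> cmp (f n) (p2 s) \<noteq> 0"
    then have "{z \<in> cy s. f n \<notin> z} = {}" by (auto simp: cy_def)
    then show "force (\<lambda>z n. f n \<in> z) s n" unfolding force_def using meager_empty by (simp only:)
  qed
  have "decisive (\<lambda>z n. f n \<in> z)"
    unfolding decisive_def
  proof (intro allI)
    fix s n
    define t where "t = pr (p1 s + Suc (f n)) (p2 s)"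
    have "ext t s" by (auto simp: ext_def t_def)
    moreover have "{z \<in> cy t. f n \<notin> z} = {} \<or> {z \<in> cy t. f n \<in> z} = {}"
      by (auto simp: cy_def t_def)
    then have "force (\<lambda>z n. f n \<in> z) t n \<or> force (\<lambda>z n. f n \<notin> z) t n"
      unfolding force_def by (elim disjE) (simp_all only: meager_empty not_not simp_thms)
    ultimately show "\<exists>t. ext t s \<and> (force (\<lambda>z n. f n \<in> z) t n \<or> force (\<lambda>z n. f n \<notin> z) t n)" by blast
  qed
  then show ?case unfolding * by (intro conjI Cc Fnc Fn_comp[OF C_orc])
next
  case (C_eq f g)
  have *: "force (\<lambda>z n. f n = g n) s n \<longleftrightarrow> f n = g n" for s n
    using baire[of s] meager_empty by (cases "f n = g n") (simp_all add: force_def)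
  have **: "force (\<lambda>z n. f n \<noteq> g n) s n \<longleftrightarrow> f n \<noteq> g n" for s n
    using baire[of s] meager_empty by (cases "f n = g n") (simp_all add: force_def)
  have "decisive (\<lambda>z n. f n = g n)" unfolding decisive_def * ** using ext_refl by blast
  then show ?case unfolding * by (intro conjI Cc Fnc Fn_comp[OF C_eq(1)] Fn_comp[OF C_eq(2)])
next
  case (C_neg p)
  then have d: "decisive p" and c: "C (\<lambda>_ n. force p (p1 n) (p2 n))" by auto
  show ?case unfolding force_neg[OF d] by (intro conjI decisive_neg d Cc C_ext C_app2[OF c] Fnc)
next
  case (C_conj p q)
  then show ?case unfolding force_conj by (intro conjI decisive_conj Cc) auto
next
  case (C_sub p f)
  have *: "force (\<lambda>z n. r z (f n)) s n = force r s (f n)" for r s n by (simp add: force_def)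
  have c: "C (\<lambda>_ n. force p (p1 n) (p2 n))" using C_sub by blast
  have "decisive (\<lambda>z n. p z (f n))" using C_sub.IH unfolding decisive_def
    by (simp add: * *[of "\<lambda>z n. \<not> p z n"])
  then show ?case unfolding * by (intro conjI C_app2[OF c] Fnc Fn_comp[OF C_sub(2)])
next
  case (C_W R)
  then have d: "decisive (\<lambda>z n. R z (p1 n) (p1 (p2 n)) (p2 (p2 n)))"
    and c: "C (\<lambda>_ n. force (\<lambda>z n. R z (p1 n) (p1 (p2 n)) (p2 (p2 n))) (p1 n) (p2 n))" by auto
  show ?case unfolding force_W[OF d] Ws_W
    by (intro conjI decisive_W[OF d] C_W' Cc C_ext C_app2[OF c] Fnc)
qed

section \<open>A long well-order as time axis\<close>

abbreviation omr :: "nat set set rel" where "omr \<equiv> cardSuc (card_of (UNIV :: nat set set))"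

text \<open>Every well-order on the reals embeds as a proper initial segment, and every proper
initial segment injects into the reals.\<close>
typedef om = "Field omr"
  using Field_cardSuc_not_empty[OF card_of_Card_order] by blast

instantiation om :: wellorder
begin
definition "x \<le> y \<longleftrightarrow> (Rep_om x, Rep_om y) \<in> omr"
definition "x < y \<longleftrightarrow> x \<le> y \<and> x \<noteq> (y :: om)"
instance
proof
  have W: "Well_order omr" using cardSuc_Card_order[OF card_of_Card_order] by (rule card_order_on_well_order_on)
  note d = less_eq_om_def less_om_def Rep_om_inject[symmetric]
  note W' = W[unfolded order_on_defs]
  fix x y z :: om
  show "x \<le> x" using W' Rep_om by (auto simp: d refl_on_def)
  show anti: "x \<le> y ==> y \<le> x ==> x = y" for x y :: om using W' unfolding d antisym_def by metis
  show "x < y \<longleftrightarrow> x \<le> y \<and> \<not> y \<le> x"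
    using anti[of x y] \<open>x \<le> x\<close> by (auto simp: less_om_def)
  show "x \<le> y ==> y \<le> z ==> x \<le> z" using W' unfolding d trans_def by blast
  show "x \<le> y \<or> y \<le> x" using W' Rep_om[of x] Rep_om[of y] unfolding d total_on_def refl_on_def by metis
next
  fix P :: "om => bool" and a
  assume h: "!!x. (!!y. y < x ==> P y) ==> P x"
  have W: "Well_order omr" using cardSuc_Card_order[OF card_of_Card_order] by (rule card_order_on_well_order_on)
  have "wf (inv_image (omr - Id) Rep_om)" using W by (auto simp: well_order_on_def)
  then show "P a"
    by (induction a rule: wf_induct_rule) (rule h, auto simp: less_om_def less_eq_om_def Rep_om_inject)
qed
end

section \<open>Cardinality of initial segments and regularity of the axis\<close>

abbreviation small :: "'a set => bool" where "small A \<equiv> ordLeq3 (card_of A) (card_of (UNIV :: nat set set))"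

lemma infinite_nat_set: "infinite (UNIV :: nat set set)"
  by (simp add: Finite_Set.finite_set)

lemma small_below: "small {x :: om. x < t}"
proof -
  have c: "Card_order omr" by (rule cardSuc_Card_order[OF card_of_Card_order])
  have "Rep_om ` {x. x < t} \<subseteq> underS omr (Rep_om t)"
    by (auto simp: underS_def less_om_def less_eq_om_def Rep_om_inject)
  then have "ordLeq3 (card_of {x. x < t}) (card_of (underS omr (Rep_om t)))"
    by (intro card_of_ordLeq[THEN iffD1] exI[of _ Rep_om]) (auto simp: inj_on_def Rep_om_inject)
  moreover have "ordLess2 (card_of (underS omr (Rep_om t))) omr" using card_of_underS[OF c Rep_om] .
  ultimately have "ordLess2 (card_of {x. x < t}) omr" by (rule ordLeq_ordLess_trans)
  then show ?thesis using cardSuc_ordLeq_ordLess[OF card_of_Card_order card_of_Card_order] by blast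
qed

text \<open>Regularity of a successor cardinal: if \<open>h\<close> were unbounded, at most
  continuum many initial segments, each of at most that size, would cover the axis.\<close>

lemma small_bound:
  fixes h :: "'a => om"
  assumes "small I" shows "\<exists>b. \<forall>i\<in>I. h i < b"
proof (rule ccontr)
  assume "\<not> ?thesis"
  then have a: "!!b. \<exists>i\<in>I. b \<le> h i" by (simp add: not_less)
  let ?A = "\<lambda>i. insert (h i) {x. x < h i}"
  have "small (?A i)" for i
  proof -
    have "small {h i}" by (rule card_of_singl_ordLeq) simp
    have "small ({h i} \<union> {x. x < h i})"
      by (rule card_of_Un_ordLeq_infinite_Field[OF _ \<open>small {h i}\<close> small_below card_of_Card_order])
         (simp add: infinite_nat_set Field_card_of)
    then show ?thesis by simp
  qed
  then have "small (\<Union>i\<in>I. ?A i)"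
    by (intro card_of_UNION_ordLeq_infinite[OF infinite_nat_set assms] ballI)
  moreover have "(\<Union>i\<in>I. ?A i) = UNIV" using a by (auto simp: order_le_less)
  ultimately have "small (UNIV :: om set)" by simp
  moreover have "ordLeq3 (card_of (Field omr)) (card_of (UNIV :: om set))"
    by (intro card_of_ordLeq[THEN iffD1] exI[of _ Abs_om]) (auto simp: inj_on_def Abs_om_inject)
  moreover have "ordIso2 (card_of (Field omr)) omr"
    by (rule card_of_Field_ordIso[OF cardSuc_Card_order[OF card_of_Card_order]])
  ultimately have "ordLeq3 omr (card_of (UNIV :: nat set set))"
    by (meson ordIso_ordLeq_trans ordIso_symmetric ordLeq_transitive)
  then show False using cardSuc_greater[OF card_of_Card_order] not_ordLess_ordLeq by blast
qed

lemma seq_bound: "\<exists>b. \<forall>n :: nat. (h n :: om) < b"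
proof -
  have "small (UNIV :: nat set)"
    by (intro card_of_ordLeq[THEN iffD1] exI[of _ "\<lambda>n. {n}"]) (auto simp: inj_on_def)
  from small_bound[OF this, of h] show ?thesis by simp
qed

lemma below_bound: "\<exists>b. \<forall>s < t. (h (s :: om) :: om) < b"
  using small_bound[OF small_below, of t h] by simp

lemma om_unbounded: "\<exists>u. (t :: om) < u" using seq_bound[of "\<lambda>_. t"] by blast

lemma om_inject: "\<exists>g :: om => nat set. inj_on g {s. s \<le> t}"
proof -
  obtain u where u: "t < u" using om_unbounded by blast
  obtain g :: "om => nat set" where "inj_on g {x. x < u}"
    using small_below[of u] card_of_ordLeq[of "{x. x < u}" "UNIV :: nat set set"] by blast
  then have "inj_on g {s. s \<le> t}" by (rule inj_on_subset) (use u in auto)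
  then show ?thesis by blast
qed

lemma om_embed:
  fixes V :: "nat set rel"
  assumes V: "Well_order V"
  obtains e :: "nat set => om" where
    "!!s t. s \<in> Field V ==> t \<in> Field V ==> (s, t) \<in> V \<longleftrightarrow> e s \<le> e t"
    "!!t u. t \<in> Field V ==> u \<le> e t ==> \<exists>s \<in> Field V. e s = u"
proof -
  have c: "Card_order omr" by (rule cardSuc_Card_order[OF card_of_Card_order])
  then have w: "Well_order omr" by (rule card_order_on_well_order_on)
  have "\<not> ordLeq3 omr V"
  proof
    assume "ordLeq3 omr V"
    then have "ordLeq3 (card_of (Field omr)) (card_of (Field V))" by (rule card_of_mono2)
    moreover have "small (Field V)" by (rule card_of_mono1) simp
    moreover have "ordIso2 (card_of (Field omr)) omr" by (rule card_of_Field_ordIso[OF c])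
    ultimately have "ordLeq3 omr (card_of (UNIV :: nat set set))"
      by (meson ordIso_ordLeq_trans ordIso_symmetric ordLeq_transitive)
    then show False using cardSuc_greater[OF card_of_Card_order] not_ordLess_ordLeq by blast
  qed
  then have "ordLeq3 V omr" using ordLeq_total[OF V w] by blast
  then obtain f where f: "embed V omr f" unfolding ordLeq_def by blast
  have fF: "f a \<in> Field omr" if "a \<in> Field V" for a using embed_Field[OF f] that by blast
  have inj: "inj_on f (Field V)" using embed_inj_on[OF V f] .
  have comp: "(a, b) \<in> V ==> (f a, f b) \<in> omr" for a b
    using embed_compat[OF f] unfolding compat_def by blast
  define e where "e s = Abs_om (f s)" for s
  have Re: "Rep_om (e s) = f s" if "s \<in> Field V" for s using Abs_om_inverse[OF fF[OF that]] by (simp add: e_def)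
  show ?thesis
  proof (rule that[of e])
    fix s t assume st: "s \<in> Field V" "t \<in> Field V"
    show "(s, t) \<in> V \<longleftrightarrow> e s \<le> e t"
    proof
      show "(s, t) \<in> V ==> e s \<le> e t" using comp Re st by (simp add: less_eq_om_def)
    next
      assume le: "e s \<le> e t"
      show "(s, t) \<in> V"
      proof (rule ccontr)
        assume n: "(s, t) \<notin> V"
        then have "(t, s) \<in> V" using V st unfolding order_on_defs total_on_def refl_on_def by metis
        then have "e t \<le> e s" using comp Re st by (simp add: less_eq_om_def)
        then have "e s = e t" using le by simp
        then have "f s = f t" using Re st by metis
        then have "s = t" using inj st by (simp add: inj_on_def)
        then show False using n V st unfolding order_on_defs refl_on_def by blast
      qed
    qed
  next
    fix t u assume t: "t \<in> Field V" and u: "u \<le> e t"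
    have "bij_betw f (under V t) (under omr (f t))" using f t unfolding embed_def by blast
    moreover have "Rep_om u \<in> under omr (f t)" using u Re[OF t] by (simp add: less_eq_om_def under_def)
    ultimately obtain s where s: "s \<in> under V t" "f s = Rep_om u" unfolding bij_betw_def by (metis imageE)
    then have "s \<in> Field V" by (auto simp: under_def Field_def)
    moreover have "e s = u" using s(2) by (simp add: e_def Rep_om_inverse)
    ultimately show "\<exists>s \<in> Field V. e s = u" by blast
  qed
qed

definition osuc :: "om => om" where "osuc t = (LEAST u. t < u)"
definition ozero :: om where "ozero = (LEAST u. True)"
definition lim :: "om => bool" where "lim t \<longleftrightarrow> t \<noteq> ozero \<and> (\<forall>s < t. osuc s < t)"

lemma osuc_gt [simp]: "t < osuc t" using LeastI_ex[OF om_unbounded] by (simp add: osuc_def)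
lemma osuc_le: "t < u ==> osuc t \<le> u" by (simp add: osuc_def Least_le)
lemma less_osuc [simp]: "s < osuc t \<longleftrightarrow> s \<le> t"
  using osuc_gt[of t] osuc_le[of t s] by (metis leD le_less_linear order_le_less_trans)
lemma osuc_le_iff: "osuc t \<le> u \<longleftrightarrow> t < u" using osuc_le less_osuc leD not_less by metis
lemma ozero_le [simp]: "ozero \<le> t" by (simp add: ozero_def Least_le)
lemma lim_not_osuc [simp]: "\<not> lim (osuc t)" unfolding lim_def by (meson osuc_gt order_less_irrefl)
lemma lim_osuc: "lim t ==> s < t ==> osuc s < t" by (simp add: lim_def)
lemma lim_pos: "lim t ==> ozero < t" by (metis lim_def ozero_le order_le_less)
lemma lim_not_zero [simp]: "\<not> lim ozero" by (simp add: lim_def)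
lemma osuc_inj [simp]: "osuc s = osuc t \<longleftrightarrow> s = t"
  by (metis less_osuc order_antisym order_refl)
lemma osuc_not_zero [simp]: "osuc s \<noteq> ozero" by (metis osuc_gt ozero_le leD)

lemma om_cases [case_names zero osuc lim]:
  "(t = ozero ==> P) ==> (!!s. t = osuc s ==> P) ==> (lim t ==> P) ==> P"
  unfolding lim_def by (metis antisym_conv1 osuc_le)

lemma om_induct [case_names zero osuc lim]:
  assumes "P ozero" "!!s. P s ==> P (osuc s)" "!!t. lim t ==> (!!s. s < t ==> P s) ==> P t"
  shows "P t"
proof (induction t rule: less_induct)
  case (less t)
  then show ?case by (cases t rule: om_cases) (auto intro: assms)
qed

lemma seq_sup:
  fixes h :: "nat => om"
  assumes "!!n. h n < h (Suc n)"
  obtains t where "lim t" "!!n. h n < t" "!!s. s < t ==> \<exists>n. s < h n"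
proof -
  define t where "t = (LEAST b. \<forall>n. h n < b)"
  have t: "h n < t" for n using LeastI_ex[OF seq_bound[of h]] unfolding t_def by blast
  have l: "\<exists>n. s < h n" if "s < t" for s
  proof -
    have "\<not> (\<forall>n. h n < s)" using not_less_Least[of s "\<lambda>b. \<forall>n. h n < b"] that unfolding t_def by blast
    then obtain n where "s \<le> h n" by (auto simp: not_less)
    then show ?thesis using assms[of n] order_le_less_trans by blast
  qed
  have "lim t"
    unfolding lim_def
  proof (intro conjI allI impI)
    show "t \<noteq> ozero" using t[of 0] ozero_le[of "h 0"] by (metis leD)
    fix s assume "s < t"
    then obtain n where "s < h n" using l by blast
    then show "osuc s < t" using t[of n] osuc_le order_le_less_trans by blast
  qed
  with t l that show ?thesis by blast
qed

lemma om_rec: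
  fixes G :: "(om => 'a) => om => 'a"
  assumes "!!f g t. (!!s. s < t ==> f s = g s) ==> G f t = G g t"
  shows "\<exists>f. \<forall>t. f t = G f t"
proof -
  define f where "f = wfrec {(x, y). x < y} G"
  have "f t = G f t" for t
  proof -
    have "f t = G (cut f {(x, y). x < y} t) t" unfolding f_def by (rule wfrec[OF wf])
    also have "\<dots> = G f t" by (rule assms) (simp add: cut_apply)
    finally show ?thesis .
  qed
  then show ?thesis by blast
qed

lemma om_iterate:
  fixes L :: "om => (om => 'a) => 'a"
  assumes "!!U V t. (!!s. s < t ==> U s = V s) ==> L t U = L t V"
  shows "\<exists>U. U ozero = c \<and> (\<forall>t. U (osuc t) = f (U t)) \<and> (\<forall>t. lim t --> U t = L t U)"
proof -
  let ?G = "\<lambda>U t. if t = ozero then c else if \<exists>s. t = osuc s then f (U (THE s. t = osuc s)) else L t U"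
  have "\<exists>U. \<forall>t. U t = ?G U t"
  proof (rule om_rec)
    fix U V :: "om => 'a" and t assume a: "!!s. s < t ==> U s = V s"
    then show "?G U t = ?G V t" using assms[OF a] by auto
  qed
  then obtain U where U: "!!t. U t = ?G U t" by blast
  show ?thesis
  proof (intro exI[of _ U] conjI allI impI)
    show "U ozero = c" by (subst U) simp
    show "U (osuc t) = f (U t)" for t by (subst U) simp
    show "U t = L t U" if "lim t" for t
    proof -
      have "t \<noteq> ozero" "\<not> (\<exists>s. t = osuc s)" using that by auto
      then show ?thesis by (subst U) simp
    qed
  qed
qed

subsection \<open>Inferior limits with overflow\<close>

text \<open>\<open>ovf t g\<close>: the inferior limit is infinite, so that \<open>linf t g\<close> is 0 by convention.\<close>
definition linf :: "om => (om => nat) => nat" where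
  "linf t g = (let m = (\<lambda>s. Inf (g ` {s..<t})) in if finite (m ` {..<t}) then Max (m ` {..<t}) else 0)"

definition ovf :: "om => (om => nat) => bool" where
  "ovf t g \<longleftrightarrow> (\<forall>B. \<exists>s < t. \<forall>u \<in> {s..<t}. B \<le> g u)"

lemma linf_cong: "(!!s. s < t ==> g s = g' s) ==> linf t g = linf t g'"
proof -
  assume a: "!!s. s < t ==> g s = g' s"
  have "(\<lambda>s. Inf (g ` {s..<t})) = (\<lambda>s. Inf (g' ` {s..<t}))" using a by (intro ext arg_cong[where f = Inf] image_cong) auto
  then show ?thesis unfolding linf_def by simp
qed

lemma linf_eqI:
  assumes "s0 < t" "!!u. s0 \<le> u ==> u < t ==> v \<le> g u"
    "!!s. s < t ==> \<exists>u \<ge> s. u < t \<and> g u = v"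
  shows "linf t g = v" "\<not> ovf t g"
proof -
  define m where "m s = Inf (g ` {s..<t})" for s
  have le: "m s \<le> v" if "s < t" for s
  proof -
    obtain u where "s \<le> u" "u < t" "g u = v" using assms(3)[OF \<open>s < t\<close>] by blast
    then show ?thesis unfolding m_def by (intro wellorder_Inf_le1) auto
  qed
  have "m s0 \<ge> v" unfolding m_def using assms(1,2) by (intro cInf_greatest) auto
  then have "m s0 = v" using le[OF assms(1)] by simp
  then have "finite (m ` {..<t})" "Max (m ` {..<t}) = v"
    using le assms(1) by (auto intro!: finite_subset[of _ "{..v}"] Max_eqI)
  then show "linf t g = v" unfolding linf_def m_def Let_def by simp
  show "\<not> ovf t g" unfolding ovf_def
  proof
    assume "\<forall>B. \<exists>s<t. \<forall>u\<in>{s..<t}. B \<le> g u"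
    then obtain s where "s < t" "!!u. s \<le> u ==> u < t ==> Suc v \<le> g u" by (metis atLeastLessThan_iff)
    with assms(3)[of s] show False by force
  qed
qed

lemma linf_ovf: assumes "ovf t g" shows "linf t g = 0"
proof -
  define m where "m s = Inf (g ` {s..<t})" for s
  have "infinite (m ` {..<t})"
  proof
    assume "finite (m ` {..<t})"
    then obtain B where B: "!!s. s < t ==> m s \<le> B" by (metis Max_ge imageI lessThan_iff)
    obtain s where s: "s < t" "\<forall>u\<in>{s..<t}. Suc B \<le> g u" using assms unfolding ovf_def by blast
    then have "Suc B \<le> m s" unfolding m_def by (intro cInf_greatest) auto
    then show False using B[OF s(1)] by simp
  qed
  then show ?thesis unfolding linf_def m_def Let_def by simp
qed

lemma linf_finite:
  assumes "lim t" "\<not> ovf t g"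
  obtains s0 where "s0 < t" "!!u. s0 \<le> u ==> u < t ==> linf t g \<le> g u"
    "!!s. s < t ==> \<exists>u \<ge> s. u < t \<and> g u = linf t g"
proof -
  let ?Q = "\<lambda>v. \<exists>s < t. \<forall>u \<in> {s..<t}. v \<le> g u"
  obtain B where B: "\<not> ?Q B" using assms(2) unfolding ovf_def by blast
  have "v \<le> B" if "?Q v" for v using that B order.trans nat_le_linear by meson
  moreover have "?Q 0" using lim_pos[OF assms(1)] by blast
  ultimately obtain v where v: "?Q v" "!!w. ?Q w ==> w \<le> v"
    using GreatestI_nat[of ?Q 0 B] Greatest_le_nat[of ?Q _ B] by blast
  then obtain s0 where s0: "s0 < t" "!!u. s0 \<le> u ==> u < t ==> v \<le> g u" by auto
  have c: "\<exists>u \<ge> s. u < t \<and> g u = v" if "s < t" for s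
  proof -
    have "\<not> ?Q (Suc v)" using v(2)[of "Suc v"] by auto
    moreover have "max s s0 < t" using that s0(1) by simp
    ultimately obtain u where "max s s0 \<le> u" "u < t" "\<not> Suc v \<le> g u" by (metis atLeastLessThan_iff)
    then show ?thesis using s0(2)[of u] by (intro exI[of _ u]) auto
  qed
  have "linf t g = v" by (rule linf_eqI[OF s0 c])
  with s0 c that show ?thesis by blast
qed

subsection \<open>Well-orders as initial segments of the time axis\<close>

locale time_embed =
  fixes V :: "nat set rel" and e :: "nat set => om"
  assumes e_iff: "s \<in> Field V ==> t \<in> Field V ==> (s, t) \<in> V \<longleftrightarrow> e s \<le> e t"
    and e_initial: "t \<in> Field V ==> u \<le> e t ==> \<exists>s \<in> Field V. e s = u"
    and e_inj: "inj_on e (Field V)"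
begin

lemma preds_iff: "t \<in> Field V ==> s \<in> preds V t \<longleftrightarrow> s \<in> Field V \<and> e s < e t"
proof
  assume t: "t \<in> Field V" and s: "s \<in> preds V t"
  then have "s \<in> Field V" by (auto simp: preds_def Field_def)
  then show "s \<in> Field V \<and> e s < e t" using s e_iff[of s t] inj_onD[OF e_inj, of s t] t
    by (auto simp: preds_def order_le_less)
next
  assume "t \<in> Field V" "s \<in> Field V \<and> e s < e t"
  then show "s \<in> preds V t" using e_iff[of s t] by (auto simp: preds_def)
qed

lemma lim_inf_eq:
  assumes t: "t \<in> Field V" and g: "!!s. s \<in> preds V t ==> g s = g' (e s)"
  shows "lim_inf V t g = linf (e t) g'"
proof -
  have "(\<lambda>s. Inf (g ` {u \<in> preds V t. (s, u) \<in> V})) ` preds V t = (\<lambda>s. Inf (g' ` {s..<e t})) ` {..<e t}"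
  proof -
    have "g ` {u \<in> preds V t. (s, u) \<in> V} = g' ` {e s..<e t}" if s: "s \<in> preds V t" for s
    proof -
      have "g ` {u \<in> preds V t. (s, u) \<in> V} = (\<lambda>u. g' (e u)) ` {u \<in> preds V t. (s, u) \<in> V}"
        using g by (intro image_cong) auto
      also have "\<dots> = g' ` (e ` {u \<in> preds V t. (s, u) \<in> V})" by (simp add: image_image)
      also have "e ` {u \<in> preds V t. (s, u) \<in> V} = {e s..<e t}"
      proof (intro equalityI subsetI)
        fix x assume "x \<in> e ` {u \<in> preds V t. (s, u) \<in> V}"
        then show "x \<in> {e s..<e t}" using s e_iff unfolding preds_iff[OF t] by auto
      next
        fix x assume x: "x \<in> {e s..<e t}"
        then obtain u where "u \<in> Field V" "e u = x" using e_initial[OF t, of x] by (auto simp: less_imp_le)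
        then show "x \<in> e ` {u \<in> preds V t. (s, u) \<in> V}" using x s e_iff[of s u] unfolding preds_iff[OF t] by auto
      qed
      finally show ?thesis .
    qed
    then have "(\<lambda>s. Inf (g ` {u \<in> preds V t. (s, u) \<in> V})) ` preds V t = (\<lambda>s. Inf (g' ` {e s..<e t})) ` preds V t"
      by (intro image_cong) auto
    also have "\<dots> = (\<lambda>s. Inf (g' ` {s..<e t})) ` (e ` preds V t)" by (simp add: image_image)
    also have "e ` preds V t = {..<e t}"
    proof (intro equalityI subsetI)
      fix x assume "x \<in> {..<e t}"
      then obtain s where "s \<in> Field V" "e s = x" using e_initial[OF t, of x] by (auto simp: less_imp_le)
      then show "x \<in> e ` preds V t" using \<open>x \<in> {..<e t}\<close> preds_iff[OF t, of s] by blast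
    qed (auto simp: preds_iff[OF t])
    finally show ?thesis .
  qed
  then show ?thesis unfolding lim_inf_def linf_def Let_def by simp
qed

lemma is_least_iff: assumes "t \<in> Field V" shows "is_least V t \<longleftrightarrow> e t = ozero"
proof
  assume a: "is_least V t"
  obtain s where "s \<in> Field V" "e s = ozero" using e_initial[OF assms, of ozero] by auto
  then have "e t \<le> ozero" using a e_iff[OF assms] by (auto simp: is_least_def)
  then show "e t = ozero" by (simp add: order_antisym)
qed (use assms e_iff in \<open>simp add: is_least_def\<close>)

lemma imm_pred_iff: assumes t: "t \<in> Field V" shows "imm_pred V s t \<longleftrightarrow> s \<in> Field V \<and> e t = osuc (e s)"
proof
  assume a: "imm_pred V s t"
  then have s: "s \<in> Field V" "e s < e t" using preds_iff[OF t] by (auto simp: imm_pred_def)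
  have "\<not> osuc (e s) < e t"
  proof
    assume o: "osuc (e s) < e t"
    then obtain u where u: "u \<in> Field V" "e u = osuc (e s)" using e_initial[OF t, of "osuc (e s)"] by (auto simp: less_imp_le)
    then have "u \<in> preds V t" "s \<in> preds V u" using o s preds_iff[OF t] preds_iff[OF u(1)] by auto
    then show False using a unfolding imm_pred_def by blast
  qed
  then show "s \<in> Field V \<and> e t = osuc (e s)" using s osuc_le[OF s(2)] by auto
next
  assume a: "s \<in> Field V \<and> e t = osuc (e s)"
  have "\<not> (u \<in> preds V t \<and> s \<in> preds V u)" for u
  proof
    assume u: "u \<in> preds V t \<and> s \<in> preds V u"
    then have "u \<in> Field V" "e u \<le> e s" using preds_iff[OF t] a by auto
    then show False using u preds_iff[of u s] by auto
  qed
  then show "imm_pred V s t" using a preds_iff[OF t] by (auto simp: imm_pred_def)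
qed

end

section \<open>Runs between overflows\<close>

text \<open>A macro step leads from a state \<open>a\<close> to \<open>f a\<close>; \<open>m a\<close> is the componentwise minimum of the
states passed on the way. \<open>Fh a e j d\<close> says that, starting in \<open>a\<close>, the floors stay above \<open>e\<close> up
to the first macro step whose floor hits \<open>e\<close> in component \<open>j\<close>, and that \<open>d\<close> is the state after
that step. Hitting all components of \<open>e\<close> over and over again, with floors above \<open>e\<close>, forces the
limit to be \<open>e\<close>; this makes the limit clause of the inductive definition arithmetical.\<close>

definition le :: "nat => nat => bool" where "le e c \<longleftrightarrow> (\<forall>j. cmp j e \<le> cmp j c)"

inductive Fh It for f m :: "nat => nat" where
  Fh_hit: "le e (m a) ==> cmp j (m a) = cmp j e ==> Fh f m a e j (f a)"
| Fh_step: "le e (m a) ==> cmp j e < cmp j (m a) ==> Fh f m (f a) e j d ==> Fh f m a e j d"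
| Fh_lim: "le e e' ==> cmp j e < cmp j e' ==> (!!n. \<exists>w. It f m a e' n w) ==> Fh f m e' e j d ==> Fh f m a e j d"
| It_0: "It f m a e 0 a"
| It_Suc: "It f m a e n w ==> Fh f m w e (p1 n) w' ==> It f m a e (Suc n) w'"

inductive Vis for f m a where
  Vis_refl: "Vis f m a a"
| Vis_step: "Vis f m a w ==> Vis f m a (f w)"
| Vis_lim: "Vis f m a w ==> (!!n. \<exists>u. It f m w e n u) ==> Vis f m a e"

text \<open>Only meant for downward closed \<open>Q\<close> with \<open>Q 0\<close>.\<close>
definition sl :: "(nat => bool) => nat" where
  "sl Q = (if \<forall>k. Q k then 0 else (LEAST k. \<not> Q (Suc k)))"

text \<open>The states before the overflow form a set without times, so "from some time on" is
  expressed as "at all states visible from some \<open>w\<close>". Thus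
  \<open>sl (bd f m c j)\<close> is the inferior limit of the floors in component \<open>j\<close>,
  with 0 for infinity.\<close>

definition bd :: "(nat => nat) => (nat => nat) => nat => nat => nat => bool" where
  "bd f m c j k \<longleftrightarrow> (\<exists>w. Vis f m c w \<and> (\<forall>w'. Vis f m w w' --> k \<le> cmp j (m w')))"

text \<open>\<open>fs N f m c\<close> is the state at the first overflow of the run from \<open>c\<close>, because \<open>Vis f m c\<close> consists of
the states before it; \<open>ms N f m c\<close> is the floor of this passage.\<close>
definition fs :: "nat => (nat => nat) => (nat => nat) => nat => nat" where
  "fs N f m c = enc N (\<lambda>j. sl (bd f m c j))"
definition ms :: "nat => (nat => nat) => (nat => nat) => nat => nat" where
  "ms N f m c = enc N (\<lambda>j. LEAST k. \<exists>w. Vis f m c w \<and> cmp j (m w) = k)"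

text \<open>A macro run jumps over states, so its limits are formed from the floors
  \<open>m\<close>, which remember the minima skipped, and not from the states \<open>U\<close>
  themselves.\<close>

locale mrun =
  fixes N :: nat and f m :: "nat => nat" and U :: "om => nat"
  assumes U_osuc: "U (osuc t) = f (U t)"
    and U_lim: "lim t ==> cmp j (U t) = linf t (\<lambda>s. cmp j (m (U s)))"
    and supp: "N \<le> j ==> cmp j (m (U t)) = 0"
begin

abbreviation g where "g j s \<equiv> cmp j (m (U s))"

definition noov where "noov t s \<longleftrightarrow> (\<forall>u. t < u --> u \<le> s --> lim u --> (\<forall>j. \<not> ovf u (g j)))"
definition hit where "hit t s e j \<longleftrightarrow> t \<le> s \<and> (\<forall>u. t \<le> u --> u \<le> s --> le e (m (U u))) \<and> g j s = cmp j e \<and>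
  (\<forall>u. t \<le> u --> u < s --> cmp j e < g j u) \<and> noov t s"

fun hp where
  "hp t e 0 = t"
| "hp t e (Suc n) = osuc (LEAST s. hp t e n \<le> s \<and> g (p1 n) s = cmp (p1 n) e)"

abbreviation hs where "hs t e n \<equiv> LEAST s. hp t e n \<le> s \<and> g (p1 n) s = cmp (p1 n) e"

lemma hit_hs: "hit (hp t e n) s e (p1 n) ==> hs t e n = s"
  unfolding hit_def by (intro Least_equality) (auto simp: not_less[symmetric])

lemma noov_refl [simp]: "noov t t"
  unfolding noov_def by (meson leD)

lemma noov_trans: "noov t s ==> noov s u ==> noov t u"
  unfolding noov_def by (metis not_less order_le_less)

lemma noov_osuc: "noov t s ==> noov t (osuc s)"
  unfolding noov_def by (metis less_osuc lim_not_osuc order_le_less)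

lemma noov_mono: "noov t s ==> t \<le> t' ==> s' \<le> s ==> noov t' s'"
  unfolding noov_def by (meson order_le_less_trans order_trans)

text \<open>All components of \<open>e\<close> are hit cofinally below the supremum of the hitting times.\<close>
lemma hits_lim:
  assumes h: "!!n. hit (hp t e n) (hs t e n) e (p1 n)"
  obtains l where "lim l" "t < l" "U l = e" "noov t l" "!!u. t \<le> u ==> u < l ==> le e (m (U u))"
proof -
  have lt: "hp t e n < hp t e (Suc n)" for n using h[of n] by (simp add: hit_def)
  then obtain l where l: "lim l" "!!n. hp t e n < l" "!!s. s < l ==> \<exists>n. s < hp t e n"
    using seq_sup[of "hp t e"] by blast
  have mono: "hp t e n \<le> hp t e (n + k)" for n k
    using lift_Suc_mono_le[of "hp t e" n "n + k"] lt by (simp add: order_less_imp_le)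
  have seg: "\<exists>n. hp t e n \<le> u \<and> u \<le> hs t e n" if tu: "t \<le> u" "u < l" for u
  proof -
    define k where "k = (LEAST n. u < hp t e n)"
    have k: "u < hp t e k" unfolding k_def using l(3)[OF tu(2)] by (rule LeastI_ex)
    then obtain n where n: "k = Suc n" using leD[OF tu(1)] by (cases k) auto
    then have "hp t e n \<le> u" using not_less_Least[of n "\<lambda>n. u < hp t e n"] unfolding k_def by (metis lessI not_less)
    then show ?thesis using k n by auto
  qed
  have floor: "le e (m (U u))" if "t \<le> u" "u < l" for u
    using seg[OF that] h unfolding hit_def by blast
  have cof: "\<exists>u \<ge> s. u < l \<and> g j u = cmp j e" if "s < l" for s j
  proof -
    obtain k where k: "s < hp t e k" using l(3)[OF \<open>s < l\<close>] by blast
    \<comment> \<open>Since \<open>p1 (pr j k) = j\<close> and \<open>pr j k\<close> is at least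
      \<open>k\<close>, component \<open>j\<close> is the target of a search that starts after
      \<open>s\<close>.\<close>
    let ?n = "pr j k"
    have "k \<le> ?n" by (rule le_prod_encode_2)
    then have "hp t e k \<le> hp t e ?n" using mono[of k "?n - k"] by simp
    then have "s \<le> hs t e ?n" using k h[of ?n] unfolding hit_def by (meson order.strict_implies_order order_trans)
    moreover have "hs t e ?n < l" using l(2)[of "Suc ?n"] by (simp del: p1_pr) (meson less_osuc order_le_less_trans order_refl order_less_trans osuc_gt)
    moreover have "g j (hs t e ?n) = cmp j e" using h[of ?n] by (simp add: hit_def)
    ultimately show ?thesis by blast
  qed
  have tl: "t < l" using l(2)[of 0] by simp
  have fl: "cmp j e \<le> g j u" if "t \<le> u" "u < l" for u j using floor[OF that] by (simp add: le_def)
  have lv: "linf l (g j) = cmp j e" and no: "\<not> ovf l (g j)" for j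
    by (rule linf_eqI[OF tl fl cof]; assumption)+
  have "U l = e" by (rule cmp_inj) (simp add: U_lim[OF l(1)] lv)
  moreover have "noov t l"
    unfolding noov_def
  proof (intro allI impI)
    fix u j assume u: "t < u" "u \<le> l" "lim u"
    show "\<not> ovf u (g j)"
    proof (cases "u = l")
      case True then show ?thesis using no by simp
    next
      case False
      then have "t < u" and ul: "u < l" using u by auto
      then obtain s where s: "hp t e s \<le> u" "u \<le> hs t e s" using seg[of u] less_imp_le[OF u(1)] by blast
      have i: "noov t (hp t e k)" for k
      proof (induction k)
        case 0 show ?case by simp
      next
        case (Suc k)
        have "noov (hp t e k) (hs t e k)" using h[of k] by (simp add: hit_def)
        from noov_osuc[OF noov_trans[OF Suc this]] show ?case by simp
      qed
      have "u \<le> hp t e (Suc s)" using s(2) by (simp add: less_imp_le)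
      then have "noov t u" by (rule noov_mono[OF i order_refl])
      then show ?thesis using u(1,3) by (auto simp: noov_def)
    qed
  qed
  ultimately show ?thesis using that l(1) tl floor by blast
qed

lemma It_hits:
  assumes "!!n. \<exists>w. U (hp t e n) = w \<and> (\<forall>i<n. hit (hp t e i) (hs t e i) e (p1 i))"
  shows "hit (hp t e n) (hs t e n) e (p1 n)"
  using assms[of "Suc n"] by auto

text \<open>Derivations mention states only. As the run after a time depends only on the state
  there, the claim is made for all times \<open>t\<close> showing that state, which the induction
  needs.\<close>

lemma Fh_It_sound:
  shows "Fh f m a e j d ==> \<forall>t. U t = a --> (\<exists>s. hit t s e j \<and> U (osuc s) = d)"
    and "It f m a e n w ==> \<forall>t. U t = a --> U (hp t e n) = w \<and> (\<forall>i<n. hit (hp t e i) (hs t e i) e (p1 i))"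
proof (induction rule: Fh_It.inducts)
  case (Fh_hit e a j)
  show ?case
  proof (intro allI impI)
    fix t assume "U t = a"
    then have "hit t t e j" using Fh_hit noov_refl by (auto simp: hit_def)
    then show "\<exists>s. hit t s e j \<and> U (osuc s) = f a" using U_osuc \<open>U t = a\<close> by blast
  qed
next
  case (Fh_step e a j d)
  show ?case
  proof (intro allI impI)
    fix t assume t: "U t = a"
    then have "U (osuc t) = f a" by (simp add: U_osuc)
    then obtain s where s: "hit (osuc t) s e j" "U (osuc s) = d" using Fh_step(4) by blast
    have o: "osuc t \<le> u \<longleftrightarrow> t \<le> u \<and> u \<noteq> t" for u by (auto simp: osuc_le_iff)
    have "noov t (osuc t)" by (rule noov_osuc) simp
    then have "hit t s e j" using s(1) Fh_step(1,2) t noov_trans[of t "osuc t" s] unfolding hit_def o by metis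
    with s(2) show "\<exists>s. hit t s e j \<and> U (osuc s) = d" by blast
  qed
next
  case (Fh_lim e e' j a d)
  show ?case
  proof (intro allI impI)
    fix t assume t: "U t = a"
    have "hit (hp t e' n) (hs t e' n) e' (p1 n)" for n
      by (rule It_hits) (use Fh_lim(3) t in blast)
    then obtain l where l: "lim l" "t < l" "U l = e'" "noov t l" "!!u. t \<le> u ==> u < l ==> le e' (m (U u))"
      using hits_lim by blast
    then obtain s where s: "hit l s e j" "U (osuc s) = d" using Fh_lim(5) by blast
    have "le e (m (U u))" "cmp j e < g j u" if "t \<le> u" "u < l" for u
      using l(5)[OF that] Fh_lim(1,2) by (auto simp: le_def intro: order_trans less_le_trans)
    moreover have "noov t s" using noov_trans[OF l(4)] s(1) by (simp add: hit_def)
    ultimately have "hit t s e j" using s(1) l(2) unfolding hit_def by (metis not_less order_le_less order_less_le_trans)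
    with s(2) show "\<exists>s. hit t s e j \<and> U (osuc s) = d" by blast
  qed
next
  case (It_0 a e)
  then show ?case by simp
next
  case (It_Suc a e n w w')
  show ?case
  proof (intro allI impI)
    fix t assume t: "U t = a"
    then have "U (hp t e n) = w" using It_Suc(2,4) by blast
    then obtain s where s: "hit (hp t e n) s e (p1 n)" "U (osuc s) = w'" using It_Suc(2,4) by blast
    moreover have "hs t e n = s" using hit_hs[OF s(1)] .
    ultimately show "U (hp t e (Suc n)) = w' \<and> (\<forall>i<Suc n. hit (hp t e i) (hs t e i) e (p1 i))"
      using It_Suc(2,4) t by (auto simp: less_Suc_eq)
  qed
qed

lemma Lim_sound:
  assumes "!!n. \<exists>w. It f m (U t) e n w"
  obtains l where "lim l" "t < l" "U l = e" "noov t l"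
proof -
  have "hit (hp t e n) (hs t e n) e (p1 n)" for n
    by (rule It_hits) (use assms Fh_It_sound(2) in blast)
  then show ?thesis using hits_lim that by blast
qed

text \<open>Finite support yields a single \<open>t0\<close> for all components: it exceeds the
  thresholds of the components below \<open>N\<close>, and the others are 0 in
  \<open>U l\<close>.\<close>

lemma floor_below:
  assumes l: "lim l" and no: "!!j. \<not> ovf l (g j)" and t: "t < l"
  obtains t0 where "t \<le> t0" "t0 < l" "!!u. t0 \<le> u ==> u < l ==> le (U l) (m (U u))"
proof -
  have "\<exists>s<l. \<forall>u. s \<le> u --> u < l --> cmp j (U l) \<le> g j u" for j
    using linf_finite[OF l no[of j]] U_lim[OF l, of j] by metis
  then obtain s where s: "!!j. s j < l" "!!j u. s j \<le> u ==> u < l ==> cmp j (U l) \<le> g j u" by metis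
  define t0 where "t0 = Max (insert t (s ` {..<N}))"
  have "t \<le> t0" "t0 < l" "!!j. j < N ==> s j \<le> t0" unfolding t0_def using t s(1) by auto
  moreover have "cmp j (U l) = 0" if "N \<le> j" for j
  proof -
    obtain u where "g j u = linf l (g j)" using linf_finite[OF l no[of j]] t by metis
    then show ?thesis using supp[OF that] U_lim[OF l] by simp
  qed
  ultimately show ?thesis using s(2) that[of t0] unfolding le_def by (metis not_le_imp_less order_trans zero_le)
qed

text \<open>The assumption on earlier hits is met by the induction hypothesis inside
  \<open>Fh_complete\<close>, and by \<open>Fh_complete\<close> itself in
  \<open>Vis_iff\<close>.\<close>

lemma It_complete:
  assumes l: "lim l" and no: "noov t l" and t0: "t \<le> t0" "t0 < l"
    and fl: "!!u. t0 \<le> u ==> u < l ==> le (U l) (m (U u))"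
    and F: "!!t s j. s < l ==> hit t s (U l) j ==> Fh f m (U t) (U l) j (U (osuc s))"
  shows "It f m (U t0) (U l) n (U (hp t0 (U l) n)) \<and> t0 \<le> hp t0 (U l) n \<and> hp t0 (U l) n < l"
proof (induction n)
  case 0 then show ?case using t0 by (auto intro: It_0)
next
  case (Suc n)
  let ?e = "U l" let ?h = "hp t0 ?e n" let ?s = "hs t0 ?e n"
  have nov: "\<not> ovf l (g j)" for j using no l t0 unfolding noov_def by (meson order_le_less_trans order_refl)
  obtain u where u: "u \<ge> ?h" "u < l" "g (p1 n) u = cmp (p1 n) ?e"
    using linf_finite[OF l nov[of "p1 n"]] Suc U_lim[OF l] by metis
  have s: "?h \<le> ?s" "g (p1 n) ?s = cmp (p1 n) ?e" "?s \<le> u"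
    using LeastI[of "\<lambda>s. ?h \<le> s \<and> g (p1 n) s = cmp (p1 n) ?e" u] Least_le[of "\<lambda>s. ?h \<le> s \<and> g (p1 n) s = cmp (p1 n) ?e" u] u
    by auto
  have sl: "?s < l" using s(3) u(2) by simp
  have "hit ?h ?s ?e (p1 n)"
    unfolding hit_def
  proof (intro conjI allI impI s(1,2))
    fix v assume v: "?h \<le> v"
    { assume "v \<le> ?s" then show "le ?e (m (U v))" using fl[of v] v Suc sl by (meson order_le_less_trans order_trans) }
    { assume vs: "v < ?s"
      then have "g (p1 n) v \<noteq> cmp (p1 n) ?e" using not_less_Least[OF vs] v by blast
      moreover have "le ?e (m (U v))" using fl[of v] v Suc sl vs by (meson order_less_trans order_trans)
      ultimately show "cmp (p1 n) ?e < g (p1 n) v" by (simp add: le_def order_le_neq_trans) }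
  next
    show "noov ?h ?s" using noov_mono[OF no, of ?h ?s] t0(1) Suc sl by (meson less_imp_le order_trans)
  qed
  then have "Fh f m (U ?h) ?e (p1 n) (U (osuc ?s))" using F[OF sl] by blast
  then have "It f m (U t0) ?e (Suc n) (U (hp t0 ?e (Suc n)))" using It_Suc Suc by fastforce
  moreover have "t0 \<le> hp t0 ?e (Suc n)" using Suc s(1) by (simp) (meson less_imp_le order_trans osuc_gt)
  moreover have "hp t0 ?e (Suc n) < l" using lim_osuc[OF l sl] by simp
  ultimately show ?case by blast
qed

lemma Fh_complete: "hit t s e j ==> Fh f m (U t) e j (U (osuc s))"
proof (induction s arbitrary: t e j rule: less_induct)
  case (less s)
  note h = less.prems[unfolded hit_def]
  \<comment> \<open>A derivation at a later state \<open>U u\<close> is carried backwards to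
    \<open>U t\<close>. At a limit \<open>u\<close> the floors are above \<open>U u\<close> from
    some \<open>t0\<close> on, and the hits before \<open>u\<close> are earlier than
    \<open>s\<close>, so the outer induction hypothesis provides the premises of
    \<open>Fh_lim\<close>.\<close>
  have *: "t \<le> u ==> u \<le> s ==> Fh f m (U u) e j d ==> Fh f m (U t) e j d" for u d
  proof (induction u rule: om_induct)
    case zero then show ?case using ozero_le[of t] by (metis order_antisym)
  next
    case (osuc u)
    show ?case
    proof (cases "t \<le> u")
      case True
      have us: "u < s" using osuc.prems osuc_le_iff by blast
      have "Fh f m (U u) e j d"
        by (rule Fh_step) (use h True us osuc.prems(3) in \<open>auto simp: U_osuc\<close>)
      then show ?thesis using osuc.IH True us by simp
    next
      case False
      then have "t = osuc u" using osuc.prems(1) osuc_le_iff by (metis less_osuc not_le order_antisym_conv order_le_less)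
      then show ?thesis using osuc.prems by simp
    qed
  next
    case (lim u)
    show ?case
    proof (cases "t = u")
      case True then show ?thesis using lim.prems by simp
    next
      case False
      then have tu: "t < u" using lim.prems by simp
      have no: "noov t u" using h lim.prems noov_mono by blast
      then have nov: "\<not> ovf u (g j)" for j using lim.hyps tu unfolding noov_def by blast
      obtain t0 where t0: "t \<le> t0" "t0 < u" "!!v. t0 \<le> v ==> v < u ==> le (U u) (m (U v))"
        using floor_below[OF lim.hyps nov tu] by blast
      have It: "\<exists>w. It f m (U t0) (U u) n w" for n
        using It_complete[OF lim.hyps no t0] less.IH lim.prems(2) by (meson order_less_le_trans)
      have val: "\<exists>v. t \<le> v \<and> v < u \<and> g i v = cmp i (U u)" for i
        using linf_finite[OF lim.hyps nov[of i]] tu U_lim[OF lim.hyps] by metis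
      have "le e (U u)" unfolding le_def
      proof
        fix i obtain v where "t \<le> v" "v < u" "g i v = cmp i (U u)" using val by blast
        then show "cmp i e \<le> cmp i (U u)" using h lim.prems(2) unfolding le_def by (metis less_imp_le order_trans)
      qed
      moreover have "cmp j e < cmp j (U u)"
        using val[of j] h lim.prems(2) by (metis order_less_le_trans)
      ultimately have "Fh f m (U t0) e j d" using Fh_lim It lim.prems(3) by blast
      then show ?thesis using lim.IH[OF t0(2,1)] t0(2) lim.prems(2) by (meson less_imp_le order_trans)
    qed
  qed
  have "Fh f m (U s) e j (f (U s))" using h by (intro Fh_hit) auto
  then show ?case using *[of s] h by (simp add: U_osuc)
qed

lemma Vis_iff: "Vis f m (U t) w \<longleftrightarrow> (\<exists>s \<ge> t. noov t s \<and> U s = w)"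
proof
  assume "Vis f m (U t) w"
  then show "\<exists>s \<ge> t. noov t s \<and> U s = w"
  proof induction
    case Vis_refl show ?case by (rule exI[of _ t]) simp
  next
    case (Vis_step w)
    then obtain s where "t \<le> s" "noov t s" "U s = w" by blast
    then show ?case by (intro exI[of _ "osuc s"]) (auto simp: U_osuc noov_osuc intro: order_trans less_imp_le)
  next
    case (Vis_lim w e)
    then obtain s where s: "t \<le> s" "noov t s" "U s = w" by blast
    then obtain l where "s < l" "U l = e" "noov s l" using Lim_sound[of s e] Vis_lim.hyps(2) by metis
    then show ?case using s by (intro exI[of _ l]) (auto intro: noov_trans)
  qed
next
  have "t \<le> s ==> noov t s ==> Vis f m (U t) (U s)" for s
  proof (induction s rule: om_induct)
    case zero then show ?case using ozero_le[of t] by (metis order_antisym Vis_refl)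
  next
    case (osuc s)
    show ?case
    proof (cases "t = osuc s")
      case True then show ?thesis using Vis_refl by simp
    next
      case False
      then have "t \<le> s" using osuc.prems(1) by (simp add: order_le_less)
      then show ?thesis using osuc.IH noov_mono[OF osuc.prems(2), of t s] Vis_step U_osuc by (simp add: less_imp_le)
    qed
  next
    case (lim u)
    show ?case
    proof (cases "t = u")
      case True then show ?thesis using Vis_refl by simp
    next
      case False
      then have tu: "t < u" using lim.prems by simp
      have no: "noov t u" by fact
      then have nov: "\<not> ovf u (g j)" for j using lim.hyps tu unfolding noov_def by blast
      obtain t0 where t0: "t \<le> t0" "t0 < u" "!!v. t0 \<le> v ==> v < u ==> le (U u) (m (U v))"
        using floor_below[OF lim.hyps nov tu] by blast
      have "\<exists>w. It f m (U t0) (U u) n w" for n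
        using It_complete[OF lim.hyps no t0] Fh_complete by blast
      moreover have "Vis f m (U t) (U t0)" using lim.IH[OF t0(2,1)] noov_mono[OF no, of t t0] t0 by simp
      ultimately show ?thesis using Vis_lim by blast
    qed
  qed
  then show "\<exists>s \<ge> t. noov t s \<and> U s = w ==> Vis f m (U t) w" by blast
qed

end

lemma sl_eq: "(!!k. k \<le> v ==> Q k) ==> \<not> Q (Suc v) ==> sl Q = v"
proof -
  assume Q: "!!k. k \<le> v ==> Q k" "\<not> Q (Suc v)"
  have "(LEAST k. \<not> Q (Suc k)) = v"
    by (rule Least_equality) (use Q not_less_eq_eq in blast)+
  then show ?thesis using Q(2) unfolding sl_def by auto
qed

lemma linf_zero: assumes "lim t" "!!s. s < t ==> g s = 0" shows "linf t g = 0"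
  using assms(2) lim_pos[OF assms(1)] by (intro linf_eqI[of ozero]) auto

context mrun begin

lemma U_supp: "lim t ==> N \<le> j ==> cmp j (U t) = 0"
  using linf_zero supp by (simp add: U_lim)

text \<open>The overflow at \<open>l\<close> ends visibility: the states visible from a time
  \<open>s\<close> in between are those at times from \<open>s\<close> up to but excluding
  \<open>l\<close>. Hence \<open>bd\<close> describes the inferior limits at
  \<open>l\<close>.\<close>

lemma fs_ovf:
  assumes l: "lim l" "t < l" "ovf l (g j0)" and no: "!!u. u < l ==> noov t u"
  shows "fs N f m (U t) = U l"
    and "cmp j (ms N f m (U t)) = Inf (g j ` {t..<l})"
proof -
  have V: "Vis f m (U s) w \<longleftrightarrow> (\<exists>u. s \<le> u \<and> u < l \<and> U u = w)" if s: "t \<le> s" "s < l" for s w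
  proof -
    have "noov s u \<longleftrightarrow> u < l" if "s \<le> u" for u
    proof
      show "noov s u ==> u < l" using l s unfolding noov_def by (meson leI)
      show "u < l ==> noov s u" using no[of u] s noov_mono by blast
    qed
    then show ?thesis unfolding Vis_iff by blast
  qed
  have b: "bd f m (U t) j k \<longleftrightarrow> (\<exists>s. t \<le> s \<and> s < l \<and> (\<forall>u. s \<le> u --> u < l --> k \<le> g j u))" for j k
    unfolding bd_def using V l(2) by (smt (verit, best) order_refl)
  have "sl (bd f m (U t) j) = linf l (g j)" for j
  proof (cases "ovf l (g j)")
    case True
    have "bd f m (U t) j k" for k
    proof -
      obtain s where "s < l" "\<forall>u\<in>{s..<l}. k \<le> g j u" using True unfolding ovf_def by blast
      then show ?thesis unfolding b using l(2) by (intro exI[of _ "max s t"]) auto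
    qed
    then show ?thesis using linf_ovf[OF True] by (simp add: sl_def)
  next
    case False
    obtain s0 where s0: "s0 < l" "!!u. s0 \<le> u ==> u < l ==> linf l (g j) \<le> g j u"
      "!!s. s < l ==> \<exists>u \<ge> s. u < l \<and> g j u = linf l (g j)" using linf_finite[OF l(1) False] by blast
    show ?thesis
    proof (rule sl_eq)
      fix k assume "k \<le> linf l (g j)"
      then show "bd f m (U t) j k" unfolding b using l(2) s0(1,2)
        by (intro exI[of _ "max s0 t"]) (auto intro: order_trans)
    next
      show "\<not> bd f m (U t) j (Suc (linf l (g j)))" unfolding b using s0(3) by (metis Suc_n_not_le_n)
    qed
  qed
  note sll = this
  show "fs N f m (U t) = U l"
  proof (rule cmp_inj)
    fix j show "cmp j (fs N f m (U t)) = cmp j (U l)"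
      using U_lim[OF l(1), of j] U_supp[OF l(1), of j] by (simp add: fs_def sll)
  qed
  have "(LEAST k. \<exists>w. Vis f m (U t) w \<and> cmp j (m w) = k) = Inf (g j ` {t..<l})"
    unfolding Inf_nat_def using V[OF order_refl l(2)] by (intro arg_cong[where f = Least] ext) (auto; blast)
  moreover have "Inf (g j ` {t..<l}) = 0" if "N \<le> j"
    using supp[OF that] l(2) wellorder_Inf_le1[of "g j t" "g j ` {t..<l}"] by auto
  ultimately show "cmp j (ms N f m (U t)) = Inf (g j ` {t..<l})" by (simp add: ms_def not_less)
qed

text \<open>The case of a run that overflows no more: all later states are visible, and since the
  floors end up constant, their inferior limit over the whole axis is the halting state
  \<open>h\<close>.\<close>

lemma fs_no_ovf:
  assumes no: "!!u. noov t u" and h: "!!s. th \<le> s ==> m (U s) = h" "!!j. N \<le> j ==> cmp j h = 0"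
  shows "fs N f m (U t) = h"
    and "N \<le> j \<or> cmp j (ms N f m (U t)) = Inf (g j ` {t..})" and "N \<le> j ==> cmp j (ms N f m (U t)) = 0"
proof -
  have V: "Vis f m (U s) w \<longleftrightarrow> (\<exists>u. s \<le> u \<and> U u = w)" if s: "t \<le> s" for s w
    unfolding Vis_iff using noov_mono[OF no s order_refl] by blast
  have b: "bd f m (U t) j k \<longleftrightarrow> (\<exists>s \<ge> t. \<forall>u \<ge> s. k \<le> g j u)" for j k
    unfolding bd_def using V by (smt (verit, best) order_refl)
  have "sl (bd f m (U t) j) = cmp j h" for j
  proof (rule sl_eq)
    fix k assume "k \<le> cmp j h"
    then show "bd f m (U t) j k" unfolding b using h(1) by (intro exI[of _ "max th t"]) auto
  next
    have "\<exists>u \<ge> s. g j u = cmp j h" for s using h(1) by (intro exI[of _ "max th s"]) auto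
    then show "\<not> bd f m (U t) j (Suc (cmp j h))" unfolding b by (metis Suc_n_not_le_n)
  qed
  note slh = this
  show "fs N f m (U t) = h"
  proof (rule cmp_inj)
    fix j show "cmp j (fs N f m (U t)) = cmp j h" using h(2)[of j] by (simp add: fs_def slh)
  qed
  have "(LEAST k. \<exists>w. Vis f m (U t) w \<and> cmp j (m w) = k) = Inf (g j ` {t..})"
    unfolding Inf_nat_def using V[OF order_refl] by (intro arg_cong[where f = Least] ext) (auto; blast)
  then show "N \<le> j \<or> cmp j (ms N f m (U t)) = Inf (g j ` {t..})" by (simp add: ms_def not_less)
  show "N \<le> j ==> cmp j (ms N f m (U t)) = 0" by (simp add: ms_def)
qed

end

section \<open>Iterating the passage to the next overflow\<close>

text \<open>At level 0 a step passes only the state it starts from, so its floor is that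
  state.\<close>

primrec lev :: "nat => (nat => nat) => nat => (nat => nat) \<times> (nat => nat)" where
  "lev N f0 0 = (f0, \<lambda>c. c)"
| "lev N f0 (Suc k) = (fs N (fst (lev N f0 k)) (snd (lev N f0 k)), ms N (fst (lev N f0 k)) (snd (lev N f0 k)))"

locale halting_run =
  fixes N :: nat and f0 :: "nat => nat" and U :: "om => nat" and th h
  assumes U0_osuc: "U (osuc t) = f0 (U t)"
    and U0_lim: "lim t ==> cmp j (U t) = linf t (\<lambda>s. cmp j (U s))"
    and supp0: "N \<le> j ==> cmp j (U t) = 0"
    and halt: "th \<le> t ==> U t = h"
begin

abbreviation g0 where "g0 j s \<equiv> cmp j (U s)"

text \<open>A level-\<open>k\<close> step that does not reach the end of the run passes overflows of at least
\<open>k\<close> different components.\<close>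
definition good :: "nat => (nat => nat) => (nat => nat) => bool" where
  "good k f m \<longleftrightarrow> (\<forall>t. \<exists>D > t. f (U t) = U D \<and> (\<forall>j. cmp j (m (U t)) = Inf (g0 j ` {t..<D})) \<and>
     (th \<le> D \<or> k \<le> card {j. \<exists>u. t < u \<and> u \<le> D \<and> lim u \<and> ovf u (g0 j)}))"

lemma ovf_bound: "lim u ==> ovf u (g0 j) ==> j < N"
  unfolding ovf_def using supp0 by (metis Suc_n_not_le_n atLeastLessThan_iff not_less order_refl)

lemma good_0: "good 0 f0 (\<lambda>c. c)"
  unfolding good_def
proof
  fix t
  have "{t..<osuc t} = {t}" by auto
  then show "\<exists>D > t. f0 (U t) = U D \<and> (\<forall>j. g0 j t = Inf (g0 j ` {t..<D})) \<and>
     (th \<le> D \<or> 0 \<le> card {j. \<exists>u. t < u \<and> u \<le> D \<and> lim u \<and> ovf u (g0 j)})"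
    by (intro exI[of _ "osuc t"]) (simp add: U0_osuc)
qed

text \<open>A level \<open>Suc k\<close> step joins level \<open>k\<close> steps until some
  component \<open>j0\<close> overflows. Shortly before that, \<open>j0\<close> stays positive and
  so cannot overflow, since an overflow would leave it 0; thus a late level \<open>k\<close> step
  short of the halting time passes overflows of \<open>k\<close> components other than
  \<open>j0\<close>.\<close>

lemma good_Suc:
  assumes "good k f m" shows "good (Suc k) (fs N f m) (ms N f m)"
  unfolding good_def
proof
  fix t
  obtain D where D: "!!t. t < D t" "!!t. f (U t) = U (D t)"
    "!!t j. cmp j (m (U t)) = Inf (g0 j ` {t..<D t})"
    "!!t. th \<le> D t \<or> k \<le> card {j. \<exists>u. t < u \<and> u \<le> D t \<and> lim u \<and> ovf u (g0 j)}"
    using choice[OF assms[unfolded good_def]] by (elim exE) blast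
  \<comment> \<open>\<open>T\<close> lists, transfinitely, the starting times of the level
    \<open>k\<close> steps made from time \<open>t\<close>; at a limit it is the supremum of the
    earlier ends.\<close>
  have "\<exists>T :: om => om. \<forall>x. T x = (LEAST u. t \<le> u \<and> (\<forall>y<x. D (T y) \<le> u))"
    using om_rec[of "\<lambda>T x. LEAST u. t \<le> u \<and> (\<forall>y<x. D (T y) \<le> u)"] by simp
  then obtain T :: "om => om" where T: "!!x. T x = (LEAST u. t \<le> u \<and> (\<forall>y<x. D (T y) \<le> u))" by blast
  have Tex: "\<exists>u. t \<le> u \<and> (\<forall>y<x. D (T y) \<le> u)" for x
  proof -
    obtain b where "!!y. y < x ==> D (T y) < b" using below_bound[of x "\<lambda>y. D (T y)"] by blast
    then show ?thesis by (intro exI[of _ "max t b"]) (auto simp: le_max_iff_disj less_imp_le)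
  qed
  have Tge: "t \<le> T x" and DT: "y < x ==> D (T y) \<le> T x" for x y
    using LeastI_ex[OF Tex[of x]] unfolding T[of x, symmetric] by auto
  have Tle: "T x \<le> u" if "t \<le> u" "!!y. y < x ==> D (T y) \<le> u" for x u
    unfolding T[of x] using that by (intro Least_le) auto
  have Tmono: "y < x ==> T y < T x" for x y using D(1)[of "T y"] DT[of y x] by simp
  have Tmono': "y \<le> x ==> T y \<le> T x" for x y using Tmono[of y x] by (auto simp: order_le_less)
  have T0: "T ozero = t" using Tle[of t ozero] Tge[of ozero] by (metis leD order_antisym order_refl ozero_le)
  have TS: "T (osuc x) = D (T x)" for x
  proof (rule order_antisym)
    show "T (osuc x) \<le> D (T x)"
    proof (rule Tle)
      show "t \<le> D (T x)" using Tge[of x] D(1)[of "T x"] by simp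
      fix y assume "y < osuc x"
      then show "D (T y) \<le> D (T x)" using DT[of y x] D(1)[of "T x"] by (auto simp: order_le_less)
    qed
  qed (simp add: DT)
  have Tself: "x \<le> T x" for x
  proof (induction x rule: less_induct)
    case (less x) then show ?case using Tmono by (meson leI order_le_less_trans order_less_irrefl)
  qed
  have Tlim: "lim (T l)" and Tcof: "!!s. s < T l ==> \<exists>x<l. s < T x" if l: "lim l" for l
  proof -
    show c: "\<exists>x<l. s < T x" if s: "s < T l" for s
    proof (rule ccontr)
      assume n: "\<not> ?thesis"
      have "T l \<le> s"
      proof (rule Tle)
        show "t \<le> s" using n lim_pos[OF l] T0 by (metis linorder_not_le)
        fix y assume "y < l"
        then have "\<not> s < T (osuc y)" using n lim_osuc[OF l] by blast
        then show "D (T y) \<le> s" by (simp add: TS)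
      qed
      then show False using s by simp
    qed
    show "lim (T l)" unfolding lim_def
    proof (intro conjI allI impI)
      show "T l \<noteq> ozero" using Tmono[OF lim_pos[OF l]] by (metis leD ozero_le)
      fix s assume "s < T l"
      then obtain x where "x < l" "s < T x" using c by blast
      then show "osuc s < T l" using Tmono osuc_le by (meson order_le_less_trans)
    qed
  qed
  have Tseg: "\<exists>x<l. T x \<le> s \<and> s < T (osuc x)" if s: "t \<le> s" "s < T l" for s l
  proof -
    define k where "k = (LEAST x. s < T x)"
    have k: "s < T k" "!!x. x < k ==> T x \<le> s" unfolding k_def
      using LeastI[of "\<lambda>x. s < T x", OF s(2)] not_less_Least[of _ "\<lambda>x. s < T x"] by (auto simp: not_less)
    have "k \<le> l" unfolding k_def using s(2) by (rule Least_le)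
    show ?thesis
    proof (cases k rule: om_cases)
      case zero then show ?thesis using k(1) s(1) T0 by (simp add: leD)
    next
      case (osuc x) then show ?thesis using k \<open>k \<le> l\<close> osuc_le_iff by (intro exI[of _ x]) auto
    next
      case lim
      then show ?thesis using Tcof[OF lim k(1)] k(2) by (metis leD)
    qed
  qed
  let ?g = "\<lambda>j s. cmp j (m (U (T s)))"
  have gle: "?g j x \<le> g0 j s" if "T x \<le> s" "s < T (osuc x)" for j x s
    unfolding D(3) using that by (intro wellorder_Inf_le1) (auto simp: TS)
  have gat: "\<exists>s. T x \<le> s \<and> s < T (osuc x) \<and> g0 j s = ?g j x" for j x
  proof -
    have "Inf (g0 j ` {T x..<D (T x)}) \<in> g0 j ` {T x..<D (T x)}"
      by (rule Inf_nat_def1) (use D(1)[of "T x"] in auto)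
    then show ?thesis unfolding D(3)[symmetric] by (auto simp: TS)
  qed
  \<comment> \<open>Each floor is the minimum over its step and attained there, so lower bounds for
    the floors from \<open>x\<close> on are lower bounds for the fine states from \<open>T x\<close>
    on. Overflow and inferior limit at \<open>l\<close> and at \<open>T l\<close> then
    agree.\<close>
  have ge: "(\<forall>u. x \<le> u --> u < l --> B \<le> ?g j u) \<longleftrightarrow> (\<forall>s. T x \<le> s --> s < T l --> B \<le> g0 j s)"
    if l: "lim l" "x < l" for x l B j
  proof safe
    fix s assume a: "\<forall>u. x \<le> u --> u < l --> B \<le> ?g j u" and s: "T x \<le> s" "s < T l"
    obtain u where u: "u < l" "T u \<le> s" "s < T (osuc u)" using Tseg[of s l] s Tge[of x] order_trans by blast
    then have "T x < T (osuc u)" using s(1) by simp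
    then have "x \<le> u" using Tmono'[of "osuc u" x] by (metis leD less_osuc not_le)
    then show "B \<le> g0 j s" using a u gle order_trans by blast
  next
    fix u assume a: "\<forall>s. T x \<le> s --> s < T l --> B \<le> g0 j s" and u: "x \<le> u" "u < l"
    obtain s where "T u \<le> s" "s < T (osuc u)" "g0 j s = ?g j u" using gat by blast
    moreover have "T (osuc u) \<le> T l" using Tmono' l u by (simp add: osuc_le_iff)
    ultimately show "B \<le> ?g j u" using a Tmono'[OF u(1)] by (metis order_less_le_trans order_trans)
  qed
  have ov: "ovf l (?g j) \<longleftrightarrow> ovf (T l) (g0 j)" if l: "lim l" for l j
  proof -
    have "(\<exists>x<l. \<forall>u. x \<le> u --> u < l --> B \<le> ?g j u) \<longleftrightarrow> (\<exists>s<T l. \<forall>u. s \<le> u --> u < T l --> B \<le> g0 j u)" for B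
    proof
      assume "\<exists>x<l. \<forall>u. x \<le> u --> u < l --> B \<le> ?g j u"
      then show "\<exists>s<T l. \<forall>u. s \<le> u --> u < T l --> B \<le> g0 j u" using ge[OF l] Tmono by blast
    next
      assume "\<exists>s<T l. \<forall>u. s \<le> u --> u < T l --> B \<le> g0 j u"
      then obtain s where s: "s < T l" "!!u. s \<le> u ==> u < T l ==> B \<le> g0 j u" by blast
      then obtain x where x: "x < l" "s < T x" using Tcof[OF l] by blast
      then have "\<forall>u. T x \<le> u --> u < T l --> B \<le> g0 j u" using s(2) by (meson less_imp_le order_trans)
      then show "\<exists>x<l. \<forall>u. x \<le> u --> u < l --> B \<le> ?g j u" using ge[OF l x(1)] x(1) by blast
    qed
    then show ?thesis unfolding ovf_def by (simp add: Ball_def imp_conjL)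
  qed
  have lf: "linf l (?g j) = linf (T l) (g0 j)" if l: "lim l" for l j
  proof (cases "ovf (T l) (g0 j)")
    case True then show ?thesis using linf_ovf ov[OF l] by simp
  next
    case False
    let ?v = "linf (T l) (g0 j)"
    obtain s0 where s0: "s0 < T l" "!!u. s0 \<le> u ==> u < T l ==> ?v \<le> g0 j u"
      "!!s. s < T l ==> \<exists>u \<ge> s. u < T l \<and> g0 j u = ?v" using linf_finite[OF Tlim[OF l] False] by blast
    obtain x0 where x0: "x0 < l" "s0 < T x0" using Tcof[OF l s0(1)] by blast
    have lo: "\<forall>u. x0 \<le> u --> u < l --> ?v \<le> ?g j u"
      unfolding ge[OF l x0(1)] using s0(2) x0(2) by (meson less_imp_le order_trans)
    show ?thesis
    proof (rule linf_eqI[OF x0(1)])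
      show "x0 \<le> u ==> u < l ==> ?v \<le> ?g j u" for u using lo by blast
      fix x assume "x < l"
      define y where "y = max x x0"
      have y: "y < l" using \<open>x < l\<close> x0 by (simp add: y_def)
      then have "\<not> (\<forall>s. T y \<le> s --> s < T l --> Suc ?v \<le> g0 j s)" using s0(3)[OF Tmono[OF y]] by (metis Suc_n_not_le_n)
      then obtain u where u: "y \<le> u" "u < l" "\<not> Suc ?v \<le> ?g j u" using ge[OF l y] by blast
      moreover have "?v \<le> ?g j u" using lo u by (simp add: y_def)
      ultimately show "\<exists>u \<ge> x. u < l \<and> ?g j u = ?v" by (intro exI[of _ u]) (auto simp: y_def)
    qed
  qed
  interpret V: mrun N f m "\<lambda>x. U (T x)"
  proof
    show "U (T (osuc x)) = f (U (T x))" for x by (simp add: TS D(2))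
    show "lim l ==> cmp j (U (T l)) = linf l (?g j)" for l j using lf U0_lim[OF Tlim] by simp
    show "N \<le> j ==> ?g j x = 0" for j x using gat[of x j] supp0 by metis
  qed
  let ?O = "\<lambda>l. lim l \<and> (\<exists>j. ovf l (?g j))"
  show "\<exists>D' > t. fs N f m (U t) = U D' \<and> (\<forall>j. cmp j (ms N f m (U t)) = Inf (g0 j ` {t..<D'})) \<and>
     (th \<le> D' \<or> Suc k \<le> card {j. \<exists>u. t < u \<and> u \<le> D' \<and> lim u \<and> ovf u (g0 j)})"
  proof (cases "\<exists>l. ?O l")
    case True
    define l where "l = (LEAST l. ?O l)"
    have l: "lim l" "\<exists>j. ovf l (?g j)" unfolding l_def using LeastI_ex[OF True] by auto
    then obtain j0 where j0: "ovf l (?g j0)" by blast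
    have no: "V.noov ozero u" if "u < l" for u
      unfolding V.noov_def using that not_less_Least[of _ ?O] unfolding l_def[symmetric] by (meson order_le_less_trans)
    have f': "fs N f m (U t) = U (T l)" and m': "!!j. cmp j (ms N f m (U t)) = Inf (?g j ` {ozero..<l})"
      using V.fs_ovf[OF l(1) lim_pos[OF l(1)] j0 no] by (simp_all add: T0)
    have tl: "t < T l" using Tmono[OF lim_pos[OF l(1)]] T0 by simp
    have m'': "Inf (?g j ` {ozero..<l}) = Inf (g0 j ` {t..<T l})" for j
    proof (rule order_antisym)
      have ne: "?g j ` {ozero..<l} \<noteq> {}" "g0 j ` {t..<T l} \<noteq> {}" using lim_pos[OF l(1)] tl by auto
      show "Inf (?g j ` {ozero..<l}) \<le> Inf (g0 j ` {t..<T l})"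
      proof (rule cInf_greatest[OF ne(2)], clarsimp)
        fix s assume "t \<le> s" "s < T l"
        then obtain x where "x < l" "T x \<le> s" "s < T (osuc x)" using Tseg by blast
        then show "Inf (?g j ` {ozero..<l}) \<le> g0 j s"
          using gle[of x s j] wellorder_Inf_le1[of "?g j x" "?g j ` {ozero..<l}"] by force
      qed
      show "Inf (g0 j ` {t..<T l}) \<le> Inf (?g j ` {ozero..<l})"
      proof (rule cInf_greatest[OF ne(1)], clarsimp)
        fix x assume x: "x < l"
        obtain s where s: "T x \<le> s" "s < T (osuc x)" "g0 j s = ?g j x" using gat by blast
        have "T (osuc x) \<le> T l" using Tmono' x by (simp add: osuc_le_iff)
        then have "s \<in> {t..<T l}" using s Tge[of x] by auto
        then show "Inf (g0 j ` {t..<T l}) \<le> ?g j x" unfolding s(3)[symmetric] by (intro wellorder_Inf_le1) auto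
      qed
    qed
    have "th \<le> T l \<or> Suc k \<le> card {j. \<exists>u. t < u \<and> u \<le> T l \<and> lim u \<and> ovf u (g0 j)}"
    proof -
      have o: "ovf (T l) (g0 j0)" using ov[OF l(1)] j0 by blast
      then obtain s where s: "s < T l" "\<forall>u\<in>{s..<T l}. 1 \<le> g0 j0 u" unfolding ovf_def by blast
      obtain x where x: "x < l" "s < T x" using Tcof[OF l(1) s(1)] by blast
      have Dx: "D (T x) < T l" using Tmono[OF lim_osuc[OF l(1) x(1)]] by (simp add: TS)
      let ?S = "\<lambda>a b. {j. \<exists>u. a < u \<and> u \<le> b \<and> lim u \<and> ovf u (g0 j)}"
      have fin: "finite (?S a b)" for a b by (rule finite_subset[of _ "{..<N}"]) (auto dest: ovf_bound)
      from D(4)[of "T x"] show ?thesis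
      proof
        assume "th \<le> D (T x)" then have "th \<le> T l" using Dx by simp
        then show ?thesis ..
      next
        assume c: "k \<le> card (?S (T x) (D (T x)))"
        have "j0 \<notin> ?S (T x) (D (T x))"
        proof
          assume "j0 \<in> ?S (T x) (D (T x))"
          then obtain u where u: "T x < u" "u \<le> D (T x)" "lim u" "ovf u (g0 j0)" by blast
          then have "g0 j0 u = 0" using U0_lim linf_ovf by simp
          moreover have "u \<in> {s..<T l}" using u x Dx by auto
          ultimately show False using s(2) by force
        qed
        then have "Suc k \<le> card (insert j0 (?S (T x) (D (T x))))" using c fin by simp
        also have "\<dots> \<le> card (?S t (T l))"
        proof (rule card_mono[OF fin])
          have "T l \<in> {u. t < u \<and> u \<le> T l \<and> lim u \<and> ovf u (g0 j0)}" using tl o Tlim[OF l(1)] by simp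
          moreover have "?S (T x) (D (T x)) \<subseteq> ?S t (T l)" using Tge[of x] Dx
            by (auto intro: order_le_less_trans order_less_imp_le order.trans)
          ultimately show "insert j0 (?S (T x) (D (T x))) \<subseteq> ?S t (T l)" by blast
        qed
        finally show ?thesis by blast
      qed
    qed
    then show ?thesis using tl f' m' m'' by (intro exI[of _ "T l"]) auto
  next
    case False
    have no: "V.noov ozero u" for u unfolding V.noov_def using False by blast
    have hs: "m (U (T s)) = h" if "th \<le> s" for s
    proof (rule cmp_inj)
      fix j
      have "th \<le> T s" using Tself[of s] that by simp
      then have "g0 j u = cmp j h" if "T s \<le> u" for u using halt[of u] that by simp
      then show "cmp j (m (U (T s))) = cmp j h" using gat[of s j] by metis
    qed
    have hN: "N \<le> j ==> cmp j h = 0" for j using supp0[of j th] halt[of th] by simp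
    have F1: "fs N f m (U t) = h" using V.fs_no_ovf(1)[OF no hs hN, of th] T0 by simp
    have F2: "N \<le> j \<or> cmp j (ms N f m (U t)) = Inf (?g j ` {ozero..})" for j
      using V.fs_no_ovf(2)[OF no hs hN, of th j] T0 by simp
    have F3: "N \<le> j ==> cmp j (ms N f m (U t)) = 0" for j
      using V.fs_no_ovf(3)[OF no hs hN, of th j] T0 by simp
    \<comment> \<open>No overflow ends this step. As the run is constant from \<open>th\<close> on,
      any time beyond \<open>t\<close> and \<open>th\<close> can serve as its end, and the minima
      are attained before it.\<close>
    define D' where "D' = osuc (max t th)"
    have "th \<le> D'" "t < D'" by (auto simp: D'_def less_imp_le)
    moreover have "cmp j (ms N f m (U t)) = Inf (g0 j ` {t..<D'})" for j
    proof (cases "N \<le> j")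
      case True
      have "Inf (g0 j ` {t..<D'}) = 0" using True supp0 wellorder_Inf_le1[of "g0 j t" "g0 j ` {t..<D'}"] \<open>t < D'\<close> by auto
      then show ?thesis using F3[OF True] by simp
    next
      case j: False
      have "cmp j (ms N f m (U t)) = Inf (?g j ` {ozero..})" using F2[of j] j by simp
      also have "\<dots> = Inf (g0 j ` {t..<D'})"
      proof (rule order_antisym)
        have ne: "?g j ` {ozero..} \<noteq> {}" "g0 j ` {t..<D'} \<noteq> {}" using \<open>t < D'\<close> by auto
        show "Inf (?g j ` {ozero..}) \<le> Inf (g0 j ` {t..<D'})"
        proof (rule cInf_greatest[OF ne(2)], clarsimp)
          fix s assume "t \<le> s" "s < D'"
          moreover have "s < T (osuc s)" using Tself[of "osuc s"] by (meson osuc_gt order_less_le_trans)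
          ultimately obtain x where "T x \<le> s" "s < T (osuc x)" using Tseg by blast
          then show "Inf (?g j ` {ozero..}) \<le> g0 j s"
            using gle[of x s j] wellorder_Inf_le1[of "?g j x" "?g j ` {ozero..}"] by force
        qed
        show "Inf (g0 j ` {t..<D'}) \<le> Inf (?g j ` {ozero..})"
        proof (rule cInf_greatest[OF ne(1)], clarsimp)
          fix x
          obtain s where s: "T x \<le> s" "g0 j s = ?g j x" using gat by blast
          have "\<exists>s' \<in> {t..<D'}. g0 j s' = g0 j s"
          proof (cases "s < D'")
            case True then show ?thesis using s Tge[of x] by (intro bexI[of _ s]) auto
          next
            case False
            then have "th \<le> s" using \<open>th \<le> D'\<close> by simp
            then show ?thesis using halt by (intro bexI[of _ "max t th"]) (auto simp: D'_def)
          qed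
          then show "Inf (g0 j ` {t..<D'}) \<le> ?g j x" unfolding s(2)[symmetric] by (metis wellorder_Inf_le1 imageI)
        qed
      qed
      finally show ?thesis .
    qed
    moreover have "fs N f m (U t) = U D'" using F1 halt[OF \<open>th \<le> D'\<close>] by simp
    ultimately show ?thesis by (intro exI[of _ D']) auto
  qed
qed

lemma good_lev: "good k (fst (lev N f0 k)) (snd (lev N f0 k))"
  by (induction k) (simp_all add: good_0 good_Suc)

text \<open>Only components below \<open>N\<close> can overflow, so the alternative in
  \<open>good\<close> with \<open>Suc N\<close> of them is excluded.\<close>

lemma lev_halt: "fst (lev N f0 (Suc N)) (U t) = h"
proof -
  obtain D where D: "t < D" "fst (lev N f0 (Suc N)) (U t) = U D"
    "th \<le> D \<or> Suc N \<le> card {j. \<exists>u. t < u \<and> u \<le> D \<and> lim u \<and> ovf u (g0 j)}"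
    using good_lev[of "Suc N", unfolded good_def, THEN spec, of t] by (elim exE conjE) blast
  have "card {j. \<exists>u. t < u \<and> u \<le> D \<and> lim u \<and> ovf u (g0 j)} \<le> card {..<N}"
    by (rule card_mono) (auto dest: ovf_bound)
  then show ?thesis using D halt by simp
qed

end

section \<open>Definability of the overflow jump\<close>

abbreviation qd :: "nat => nat => nat => nat => nat => nat" where
  "qd k a e x y \<equiv> pr k (pr a (pr e (pr x y)))"
abbreviation "q1 A \<equiv> p1 A"
abbreviation "q2 A \<equiv> p1 (p2 A)"
abbreviation "q3 A \<equiv> p1 (p2 (p2 A))"
abbreviation "q4 A \<equiv> p1 (p2 (p2 (p2 A)))"
abbreviation "q5 A \<equiv> p2 (p2 (p2 (p2 A)))"

text \<open>\<open>Fh\<close>, \<open>It\<close> and \<open>\<exists>w. It f m a e n w\<close> as the well-founded part of a single relation;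
the tags 0, 1, 2 tell the three kinds of facts apart. If the side conditions of a rule fail, every
number counts as a premise, among them the conclusion itself, which makes the rule useless.\<close>

definition side :: "(nat => nat) => (nat => nat) => nat => nat => bool" where
  "side f m A B \<longleftrightarrow>
     (q1 A = 0 -->
        (p1 B = 0 \<and> (\<exists>v. m (q2 A) = v \<and> le (q3 A) v \<and> cmp (q4 A) v = cmp (q4 A) (q3 A)) \<and> f (q2 A) = q5 A) \<or>
        (p1 B = 1 \<and> (\<exists>v. m (q2 A) = v \<and> le (q3 A) v \<and> cmp (q4 A) (q3 A) < cmp (q4 A) v)) \<or>
        (p1 B = 2 \<and> le (q3 A) (p2 B) \<and> cmp (q4 A) (q3 A) < cmp (q4 A) (p2 B))) \<and>
     (q1 A = 1 --> q4 A = 0 --> q5 A = q2 A)"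

definition prem :: "(nat => nat) => nat => nat => nat => bool" where
  "prem f A B D \<longleftrightarrow>
     (q1 A = 0 \<and> p1 B = 1 \<and> (\<exists>v. f (q2 A) = v \<and> D = qd 0 v (q3 A) (q4 A) (q5 A))) \<or>
     (q1 A = 0 \<and> p1 B = 2 \<and> ((\<exists>n. D = qd 2 (q2 A) (p2 B) n 0) \<or> D = qd 0 (p2 B) (q3 A) (q4 A) (q5 A))) \<or>
     (q1 A = 1 \<and> (\<exists>n. q4 A = Suc n \<and> (D = qd 1 (q2 A) (q3 A) n B \<or> D = qd 0 B (q3 A) (p1 n) (q5 A)))) \<or>
     (q1 A = 2 \<and> D = qd 1 (q2 A) (q3 A) (q4 A) B)"

definition RF :: "(nat => nat) => (nat => nat) => nat => nat => nat => bool" where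
  "RF f m A B D \<longleftrightarrow> (side f m A B --> prem f A B D)"

lemma W_RF_I: "side f m A B ==> (!!D. prem f A B D ==> W (RF f m) D) ==> W (RF f m) A"
  by (rule W_intro[where b = B]) (simp add: RF_def)

text \<open>The index \<open>B\<close> carries what a rule quantifies existentially: for tag 0 the
  number of the rule and, in the limit rule, the limit \<open>e'\<close>; for tags 1 and 2 the state
  \<open>w\<close>. Tag 2 exists because \<open>Fh_lim\<close> asks for a separate \<open>w\<close>
  at each \<open>n\<close>, more than one index can hold.\<close>

lemma Fh_W: "Fh f m a e j d ==> W (RF f m) (qd 0 a e j d)"
  and It_W: "It f m a e n w ==> W (RF f m) (qd 1 a e n w)"
proof (induction rule: Fh_It.inducts)
  case (Fh_hit e a j)
  then show ?case by - (rule W_RF_I[where B = "pr 0 0"], simp_all add: side_def prem_def)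
next
  case (Fh_step e a j d)
  then show ?case by - (rule W_RF_I[where B = "pr 1 0"], auto simp: side_def prem_def)
next
  case (Fh_lim e e' j a d)
  have "W (RF f m) (qd 2 a e' n 0)" for n
  proof -
    obtain w where "W (RF f m) (qd 1 a e' n w)" using Fh_lim(3) by blast
    then show ?thesis by - (rule W_RF_I[where B = w], auto simp: side_def prem_def)
  qed
  then show ?case using Fh_lim by - (rule W_RF_I[where B = "pr 2 e'"], auto simp: side_def prem_def)
next
  case (It_0 a e)
  then show ?case by - (rule W_RF_I[where B = 0], simp_all add: side_def prem_def)
next
  case (It_Suc a e n w w')
  then show ?case by - (rule W_RF_I[where B = w], auto simp: side_def prem_def)
qed

lemma W_Fh:
  assumes "W (RF f m) A"
  shows "(q1 A = 0 --> Fh f m (q2 A) (q3 A) (q4 A) (q5 A)) \<and> (q1 A = 1 --> It f m (q2 A) (q3 A) (q4 A) (q5 A)) \<and>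
    (q1 A = 2 --> (\<exists>w. It f m (q2 A) (q3 A) (q4 A) w))" (is "?P A")
  using assms
proof induction
  case (W_intro A B)
  show ?case
  proof (cases "side f m A B")
    case False
    then have "RF f m A B A" by (simp add: RF_def)
    then show ?thesis by (rule W_intro.IH)
  next
    case s: True
    then have IH: "?P D" if "prem f A B D" for D using W_intro.IH that by (simp add: RF_def)
    have 0: "Fh f m (q2 A) (q3 A) (q4 A) (q5 A)" if k: "q1 A = 0"
    proof -
      consider "p1 B = 0" "le (q3 A) (m (q2 A))" "cmp (q4 A) (m (q2 A)) = cmp (q4 A) (q3 A)" "f (q2 A) = q5 A"
        | "p1 B = 1" "le (q3 A) (m (q2 A))" "cmp (q4 A) (q3 A) < cmp (q4 A) (m (q2 A))"
        | "p1 B = 2" "le (q3 A) (p2 B)" "cmp (q4 A) (q3 A) < cmp (q4 A) (p2 B)"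
        using s k unfolding side_def by auto
      then show ?thesis
      proof cases
        case 1 then show ?thesis using Fh_hit[of "q3 A" m "q2 A" "q4 A" f] by simp
      next
        case 2
        have "prem f A B (qd 0 (f (q2 A)) (q3 A) (q4 A) (q5 A))" using k 2 by (simp add: prem_def)
        from IH[OF this] show ?thesis using 2 by - (rule Fh_step, simp_all)
      next
        case 3
        have I: "\<exists>w. It f m (q2 A) (p2 B) n w" for n
        proof -
          have "prem f A B (qd 2 (q2 A) (p2 B) n 0)" using k 3 by (auto simp: prem_def)
          from IH[OF this] show ?thesis by simp
        qed
        have "prem f A B (qd 0 (p2 B) (q3 A) (q4 A) (q5 A))" using k 3 by (auto simp: prem_def)
        from IH[OF this] have "Fh f m (p2 B) (q3 A) (q4 A) (q5 A)" by simp
        then show ?thesis by (rule Fh_lim[OF 3(2,3) I])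
      qed
    qed
    have 1: "It f m (q2 A) (q3 A) (q4 A) (q5 A)" if k: "q1 A = 1"
    proof (cases "q4 A")
      case 0 then show ?thesis using s k It_0 by (simp add: side_def)
    next
      case (Suc n)
      then have "prem f A B (qd 1 (q2 A) (q3 A) n B)" "prem f A B (qd 0 B (q3 A) (p1 n) (q5 A))"
        using k by (auto simp: prem_def)
      from this[THEN IH] have "It f m (q2 A) (q3 A) n B" "Fh f m B (q3 A) (p1 n) (q5 A)" by simp_all
      then show ?thesis unfolding Suc by (rule It_Suc)
    qed
    have "\<exists>w. It f m (q2 A) (q3 A) (q4 A) w" if k: "q1 A = 2"
    proof -
      have "prem f A B (qd 1 (q2 A) (q3 A) (q4 A) B)" using k by (simp add: prem_def)
      from IH[OF this] show ?thesis by auto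
    qed
    with 0 1 show ?thesis by blast
  qed
qed

lemma It_iff: "It f m a e n w \<longleftrightarrow> W (RF f m) (qd 1 a e n w)"
  using It_W W_Fh[of f m "qd 1 a e n w"] by auto

text \<open>Same device as in \<open>RF\<close>. The starting state is a parameter, carried along in
  \<open>p1 A\<close>; \<open>It\<close> occurs in a side condition, being definable already, so
  this is a well-founded part over another one.\<close>

definition RV :: "(nat => nat) => (nat => nat) => nat => nat => nat => bool" where
  "RV f m A B D \<longleftrightarrow>
     ((p1 B = 0 \<and> p2 A = p1 A) \<or> (p1 B = 1 \<and> f (p2 B) = p2 A) \<or>
      (p1 B = 2 \<and> (\<forall>n. \<exists>u. It f m (p2 B) (p2 A) n u))
      --> p1 B \<noteq> 0 \<and> D = pr (p1 A) (p2 B))"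

lemma Vis_W: "Vis f m a w \<longleftrightarrow> W (RV f m) (pr a w)"
proof
  assume "Vis f m a w" then show "W (RV f m) (pr a w)"
  proof induction
    case Vis_refl show ?case by (rule W_intro[where b = "pr 0 0"]) (simp add: RV_def)
  next
    case (Vis_step w) then show ?case by - (rule W_intro[where b = "pr 1 w"], simp add: RV_def)
  next
    case (Vis_lim w e) then show ?case by - (rule W_intro[where b = "pr 2 w" and a = "pr a e"], simp add: RV_def)
  qed
next
  have "Vis f m (p1 A) (p2 A)" if "W (RV f m) A" for A using that
  proof induction
    case (W_intro A B)
    let ?s = "(p1 B = 0 \<and> p2 A = p1 A) \<or> (p1 B = 1 \<and> f (p2 B) = p2 A) \<or>
      (p1 B = 2 \<and> (\<forall>n. \<exists>u. It f m (p2 B) (p2 A) n u))"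
    show ?case
    proof (cases ?s)
      case False
      then have "RV f m A B A" unfolding RV_def by - (rule impI, erule notE, assumption)
      then show ?thesis by (rule W_intro.IH)
    next
      case True
      have "Vis f m (p1 A) (p2 B)" if "p1 B \<noteq> 0" using W_intro.IH[of "pr (p1 A) (p2 B)"] that by (simp add: RV_def)
      then show ?thesis using True by (elim disjE conjE) (auto intro: Vis_refl Vis_step Vis_lim dest: Vis_step)
    qed
  qed
  from this[of "pr a w"] show "W (RV f m) (pr a w) ==> Vis f m a w" by simp
qed

lemma bd_mono: "bd f m c j k ==> k' \<le> k ==> bd f m c j k'"
  unfolding bd_def by (meson order_trans)
lemma bd_0: "bd f m c j 0" unfolding bd_def using Vis_refl by blast

lemma sl_iff:
  assumes "Q 0" "!!k k'. Q k ==> k' \<le> k ==> Q k'"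
  shows "sl Q = v \<longleftrightarrow> ((\<forall>k. Q k) \<and> v = 0) \<or> (Q v \<and> \<not> Q (Suc v))"
proof (cases "\<forall>k. Q k")
  case True then show ?thesis by (auto simp: sl_def)
next
  case False
  then obtain k where k: "\<not> Q k" by blast
  then obtain k' where "k = Suc k'" using assms(1) by (cases k) auto
  then have ex: "\<exists>k. \<not> Q (Suc k)" using k by blast
  have n: "\<not> Q (Suc (sl Q))" using LeastI_ex[OF ex] False by (simp add: sl_def)
  have y: "Q (sl Q)"
  proof (cases "sl Q")
    case (Suc u)
    then have "u < (LEAST k. \<not> Q (Suc k))" using False by (simp add: sl_def)
    from not_less_Least[OF this] Suc show ?thesis by simp
  qed (simp add: assms(1))
  have "v = sl Q" if "Q v" "\<not> Q (Suc v)"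
    using that n y assms(2) by (metis not_less_eq_eq order_antisym)
  then show ?thesis using False n y by auto
qed

lemma fs_iff:
  "fs N f m c = d \<longleftrightarrow> (\<forall>j. (j < N --> ((\<forall>k. bd f m c j k) \<and> cmp j d = 0) \<or> (bd f m c j (cmp j d) \<and> \<not> bd f m c j (Suc (cmp j d)))) \<and>
     (N \<le> j --> cmp j d = 0))"
proof -
  have "fs N f m c = d \<longleftrightarrow> (\<forall>j. cmp j (fs N f m c) = cmp j d)" using cmp_inj by blast
  also have "\<dots> \<longleftrightarrow> (\<forall>j. (j < N --> sl (bd f m c j) = cmp j d) \<and> (N \<le> j --> cmp j d = 0))"
    by (intro all_cong1) (auto simp: fs_def)
  also have "\<dots> \<longleftrightarrow> (\<forall>j. (j < N --> ((\<forall>k. bd f m c j k) \<and> cmp j d = 0) \<or> (bd f m c j (cmp j d) \<and> \<not> bd f m c j (Suc (cmp j d)))) \<and>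
     (N \<le> j --> cmp j d = 0))"
    by (subst sl_iff[where Q = "bd f m c _"]) (auto intro: bd_0 bd_mono)
  finally show ?thesis .
qed

lemma ms_iff:
  "ms N f m c = d \<longleftrightarrow> (\<forall>j. (j < N --> (\<exists>w. Vis f m c w \<and> (\<exists>y. m w = y \<and> cmp j y = cmp j d)) \<and>
      (\<forall>w. Vis f m c w --> (\<forall>y. m w = y --> cmp j d \<le> cmp j y))) \<and>
     (N \<le> j --> cmp j d = 0))"
proof -
  let ?P = "\<lambda>j k. \<exists>w. Vis f m c w \<and> cmp j (m w) = k"
  have ex: "?P j (cmp j (m c))" for j using Vis_refl by blast
  have L: "(LEAST k. ?P j k) = v \<longleftrightarrow> ?P j v \<and> (\<forall>k. ?P j k --> v \<le> k)" for j v
  proof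
    assume "(LEAST k. ?P j k) = v"
    then show "?P j v \<and> (\<forall>k. ?P j k --> v \<le> k)" using LeastI[of "?P j", OF ex] Least_le[of "?P j"] by blast
  next
    assume "?P j v \<and> (\<forall>k. ?P j k --> v \<le> k)"
    then show "(LEAST k. ?P j k) = v" by (intro Least_equality) blast+
  qed
  have "ms N f m c = d \<longleftrightarrow> (\<forall>j. cmp j (ms N f m c) = cmp j d)" using cmp_inj by blast
  also have "\<dots> \<longleftrightarrow> (\<forall>j. (j < N --> (LEAST k. ?P j k) = cmp j d) \<and> (N \<le> j --> cmp j d = 0))"
    by (intro all_cong1) (auto simp: ms_def)
  finally show ?thesis unfolding L by auto
qed

text \<open>\<open>C\<close> contains predicates only, so a function enters by its graph. For this
  reason \<open>side\<close>, \<open>prem\<close> and \<open>ms_iff\<close> mention \<open>f\<close>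
  and \<open>m\<close> only in equations for a single value.\<close>

definition Cf :: "(nat set => nat => nat) => bool" where
  "Cf f \<longleftrightarrow> C (\<lambda>z n. f z (p1 n) = p2 n)"

lemma Cf_app: "Cf f ==> Fn g ==> Fn h ==> C (\<lambda>z n. f z (g n) = h n)"
  unfolding Cf_def by (rule C_app2)

lemma C_lec: "Fn f ==> Fn g ==> C (\<lambda>z n. le (f n) (g n))"
proof -
  have "C (\<lambda>z n. le (p1 n) (p2 n))" unfolding le_def by (intro Cc Fnc)
  then show "Fn f ==> Fn g ==> C (\<lambda>z n. le (f n) (g n))" by (rule C_app2)
qed

lemma C_It:
  assumes "Cf f" "Cf m" "Fn a" "Fn e" "Fn k" "Fn w"
  shows "C (\<lambda>z n. It (f z) (m z) (a n) (e n) (k n) (w n))"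
  unfolding It_iff
  by (rule C_W') (unfold RF_def side_def prem_def, (intro Cc C_lec Cf_app[OF assms(1)] Cf_app[OF assms(2)] Fnc assms(3-6))+)

lemma C_Vis:
  assumes "Cf f" "Cf m" "Fn a" "Fn w"
  shows "C (\<lambda>z n. Vis (f z) (m z) (a n) (w n))"
  unfolding Vis_W
  by (rule C_W') (unfold RV_def, (intro Cc C_It assms(1,2) Cf_app[OF assms(1)] Cf_app[OF assms(2)] Fnc assms(3-4))+)

lemma C_bd:
  assumes "Cf f" "Cf m" "Fn a" "Fn j" "Fn k"
  shows "C (\<lambda>z n. bd (f z) (m z) (a n) (j n) (k n))"
proof -
  have bd': "bd f m c j k \<longleftrightarrow> (\<exists>w. Vis f m c w \<and> (\<forall>w'. Vis f m w w' --> (\<forall>y. m w' = y --> k \<le> cmp j y)))" for f m c j k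
    by (simp add: bd_def)
  have "C (\<lambda>z n. bd (f z) (m z) (p1 n) (p1 (p2 n)) (p2 (p2 n)))"
    unfolding bd' by (intro Cc C_Vis assms(1,2) Cf_app[OF assms(2)] Fnc)
  then show ?thesis by (rule C_app3) (fact assms)+
qed

lemma Cf_fs: assumes "Cf f" "Cf m" shows "Cf (\<lambda>z. fs N (f z) (m z))"
  unfolding Cf_def fs_iff by (intro Cc C_bd assms Fnc)

lemma Cf_ms: assumes "Cf f" "Cf m" shows "Cf (\<lambda>z. ms N (f z) (m z))"
  unfolding Cf_def ms_iff by (intro Cc C_Vis Cf_app[OF assms(2)] assms Fnc)

section \<open>Halting is definable\<close>

fun rmax :: "instr => nat" where
  "rmax (Zero r) = r"
| "rmax (Incr r) = r"
| "rmax (Copy a b) = max a b"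
| "rmax (JumpEq a b q) = max a b"
| "rmax (Oracle r q) = r"

text \<open>A crude strict bound on the components in use; the summand 2 covers the line number and
  register 0, which holds the input even if no instruction mentions it.\<close>

definition width :: "program => nat" where "width P = 2 + sum_list (map rmax P)"

lemma width_gt: "l < length P ==> Suc (rmax (P ! l)) < width P"
  using member_le_sum_list[of "rmax (P ! l)" "map rmax P"] by (simp add: width_def)

text \<open>A configuration is coded with the active line as component 0 and register \<open>r\<close> as
component \<open>Suc r\<close>.\<close>
fun iv :: "instr => nat set => nat => nat => nat" where
  "iv (Zero r) z c j = (if j = 0 then Suc (cmp 0 c) else if j = Suc r then 0 else cmp j c)"
| "iv (Incr r) z c j = (if j = 0 then Suc (cmp 0 c) else if j = Suc r then Suc (cmp j c) else cmp j c)"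
| "iv (Copy a b) z c j = (if j = 0 then Suc (cmp 0 c) else if j = Suc b then cmp (Suc a) c else cmp j c)"
| "iv (JumpEq a b q) z c j =
    (if j = 0 then (if cmp (Suc a) c = cmp (Suc b) c then q else Suc (cmp 0 c)) else cmp j c)"
| "iv (Oracle r q) z c j = (if j = 0 then (if cmp (Suc r) c \<in> z then q else Suc (cmp 0 c)) else cmp j c)"

text \<open>A halted configuration is kept fixed, so the run extends over the whole axis as
  \<open>halting_run\<close> requires.\<close>

definition nxt :: "program => nat set => nat => nat" where
  "nxt P z c = (if cmp 0 c < length P then enc (width P) (iv (P ! cmp 0 c) z c) else c)"

lemma C_iv:
  assumes "Fn g" "Fn h" "Fn k" shows "C (\<lambda>z n. iv i z (g n) (h n) = k n)"
proof -
  have *: "((if b then x else y) = k) = (if b then x = k else y = k)" for b and x y k :: nat by simp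
  show ?thesis
    by (cases i) (simp_all only: iv.simps *, (intro Cc C_orc Fnc assms)+)
qed

lemma C_all_less: "(!!l. l < k ==> C (p l)) ==> C (\<lambda>z n. \<forall>l < (k :: nat). p l z n)"
proof (induction k)
  case 0 then show ?case by (simp add: C_const)
next
  case (Suc k)
  then have "C (\<lambda>z n. p k z n \<and> (\<forall>l < k. p l z n))" by (intro C_conj) simp_all
  then show ?case by (simp add: All_less_Suc conj_commute)
qed

lemma nxt_iff:
  "nxt P z c = d \<longleftrightarrow> (\<forall>l < length P. cmp 0 c = l -->
     (\<forall>j. (j < width P --> iv (P ! l) z c j = cmp j d) \<and> (width P \<le> j --> cmp j d = 0))) \<and>
   (length P \<le> cmp 0 c --> c = d)"
proof (cases "cmp 0 c < length P")
  case True
  have "nxt P z c = d \<longleftrightarrow> (\<forall>j. cmp j (nxt P z c) = cmp j d)" using cmp_inj by blast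
  also have "\<dots> \<longleftrightarrow> (\<forall>j. (j < width P --> iv (P ! cmp 0 c) z c j = cmp j d) \<and> (width P \<le> j --> cmp j d = 0))"
    using True by (intro all_cong1) (auto simp: nxt_def)
  finally show ?thesis using True by auto
qed (simp add: nxt_def)

lemma Cf_nxt: "Cf (nxt P)"
  unfolding Cf_def nxt_iff by (intro C_all_less Cc C_iv Fnc)

lemma Cf_lev: "Cf (\<lambda>z. fst (lev N (nxt P z) k)) \<and> Cf (\<lambda>z. snd (lev N (nxt P z) k))"
proof (induction k)
  case 0
  have "Cf (\<lambda>z c. c)" unfolding Cf_def by (intro Cc Fnc)
  then show ?case using Cf_nxt by simp
qed (simp add: Cf_fs Cf_ms)

text \<open>Tails come first in the pair: component 0, the line, is 0, and component 1, which is
  register 0, is \<open>i\<close>.\<close>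

abbreviation start :: "nat => nat" where "start i \<equiv> pr (pr 0 i) 0"

text \<open>The level depends on the program alone, so this is a member of \<open>C\<close> with a
  truth value at every oracle; \<open>halts_Hp\<close> gives its meaning at those where the program
  halts.\<close>

definition Hp :: "program => nat set => nat => nat => bool" where
  "Hp P z i v \<longleftrightarrow> (\<exists>d. fst (lev (width P) (nxt P z) (Suc (width P))) (start i) = d \<and>
     length P \<le> cmp 0 d \<and> cmp 1 d = v)"

lemma Hp_unique: "Hp P z i v ==> Hp P z i w ==> v = w"
  unfolding Hp_def by blast

lemma C_Hp: "Fn f ==> Fn g ==> C (\<lambda>z n. Hp P z (f n) (g n))"
proof -
  have "C (\<lambda>z n. Hp P z (p1 n) (p2 n))"
    unfolding Hp_def by (intro Cc Cf_app[OF conjunct1[OF Cf_lev]] Fnc)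
  then show "Fn f ==> Fn g ==> C (\<lambda>z n. Hp P z (f n) (g n))" by (rule C_app2)
qed

definition codes :: "config => nat => bool" where
  "codes c d \<longleftrightarrow> fst c = cmp 0 d \<and> (\<forall>r. snd c r = cmp (Suc r) d)"

lemma codes_step:
  assumes c: "codes c d" and l: "fst c < length P" and s: "!!j. width P \<le> j ==> cmp j d = 0"
  shows "codes (step P z c) (nxt P z d)"
proof -
  obtain k R where kR: "c = (k, R)" by (cases c)
  have k: "k = cmp 0 d" and R: "R = (\<lambda>r. cmp (Suc r) d)" using c by (auto simp: codes_def kR)
  have kl: "cmp 0 d < length P" using l k kR by simp
  have w: "Suc (rmax (P ! cmp 0 d)) < width P" using width_gt[OF kl] .
  have "0 < width P" by (simp add: width_def)
  then show ?thesis using kl w s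
    by (cases "P ! cmp 0 d") (auto simp: codes_def step_def nxt_def kR k R not_less simp del: cmp_0 cmp_Suc)
qed

text \<open>The run is transported along an embedding of its time domain and prolonged by its
  halting state; \<open>lev_halt\<close> then yields that state from the start.\<close>

lemma halts_Hp:
  assumes "halts_with P z i v" shows "Hp P z i v"
proof -
  obtain V :: "(nat set \<times> nat set) set" and c t where run: "is_run P z i V c"
    and t: "is_greatest V t" "length P \<le> fst (c t)" "snd (c t) 0 = v"
    using assms unfolding halts_with_def by blast
  have wo: "Well_order V" using run by (simp add: is_run_def)
  obtain e :: "nat set => om" where
    e: "!!s t. s \<in> Field V ==> t \<in> Field V ==> (s, t) \<in> V \<longleftrightarrow> e s \<le> e t"
    "!!t u. t \<in> Field V ==> u \<le> e t ==> \<exists>s \<in> Field V. e s = u"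
    using om_embed[OF wo] by blast
  have anti: "antisym V" using wo by (simp add: order_on_defs)
  have "inj_on e (Field V)"
  proof (rule inj_onI)
    fix s t assume "s \<in> Field V" "t \<in> Field V" "e s = e t"
    then show "s = t" using e(1)[of s t] e(1)[of t s] anti by (auto simp: antisym_def)
  qed
  then interpret time_embed V e using e by unfold_locales auto
  let ?N = "width P"
  have "\<exists>U. U ozero = start i \<and> (\<forall>t. U (osuc t) = nxt P z (U t)) \<and>
      (\<forall>t. lim t --> U t = enc ?N (\<lambda>j. linf t (\<lambda>s. cmp j (U s))))"
    by (rule om_iterate) (intro arg_cong[where f = "enc _"] ext linf_cong, simp)
  then obtain U where U: "U ozero = start i" "!!t. U (osuc t) = nxt P z (U t)"
    "!!t. lim t ==> U t = enc ?N (\<lambda>j. linf t (\<lambda>s. cmp j (U s)))"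
    by blast
  have supp: "?N \<le> j ==> cmp j (U t) = 0" for j t
  proof (induction t rule: om_induct)
    case zero
    have z: "cmp k 0 = 0" for k by (induction k) auto
    obtain k where "j = Suc (Suc k)" using zero by (metis width_def add_2_eq_Suc le_add1 le_Suc_ex add_Suc)
    then show ?case by (simp add: U(1) z)
  next
    case (osuc s) then show ?case by (simp add: U(2) nxt_def)
  qed (simp add: U(3))
  have Ulim: "cmp j (U t) = linf t (\<lambda>s. cmp j (U s))" if "lim t" for t j
    using linf_zero[OF that, of "\<lambda>s. cmp j (U s)"] supp[of j] by (cases "j < ?N") (simp_all add: U(3)[OF that])
  have rl: "is_least V t ==> c t = (0, (\<lambda>r. 0)(0 := i))"
    "imm_pred V s t ==> c t = step P z (c s)"
    "\<not> is_least V t ==> \<not> (\<exists>s. imm_pred V s t) ==>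
       c t = (lim_inf V t (\<lambda>u. fst (c u)), (\<lambda>r. lim_inf V t (\<lambda>u. snd (c u) r)))"
    "s \<in> preds V t ==> fst (c s) < length P" if "t \<in> Field V" for s t
    using run that unfolding is_run_def by blast+
  have cod: "\<forall>t \<in> Field V. e t = x --> codes (c t) (U x)" for x
  proof (induction x rule: less_induct)
    case (less x)
    show ?case
    proof (intro ballI impI)
      fix t assume t: "t \<in> Field V" "e t = x"
      show "codes (c t) (U x)"
      proof (cases x rule: om_cases)
        case zero
        have z: "cmp k 0 = 0" for k by (induction k) auto
        have "cmp r (pr 0 i) = (if r = 0 then i else 0)" for r by (cases r) (simp_all add: z)
        then show ?thesis using rl(1)[OF t(1)] is_least_iff[OF t(1)] t(2) zero U(1) by (simp add: codes_def)
      next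
        case (osuc y)
        then obtain s where s: "s \<in> Field V" "e s = y" using e(2)[OF t(1), of y] t(2) by (auto simp: less_imp_le)
        have sp: "s \<in> preds V t" using s t osuc by (simp add: preds_iff)
        have "imm_pred V s t" unfolding imm_pred_iff[OF t(1)] using s t osuc by simp
        then have "c t = step P z (c s)" using rl(2)[OF t(1)] by blast
        moreover have "codes (c s) (U y)" using less.IH[of y] s osuc by simp
        ultimately show ?thesis using codes_step[OF _ rl(4)[OF t(1) sp] supp] osuc U(2) by simp
      next
        case lim
        have "\<not> is_least V t" "\<not> (\<exists>s. imm_pred V s t)"
          unfolding is_least_iff[OF t(1)] imm_pred_iff[OF t(1)] using lim t(2) by auto
        then have ct: "c t = (lim_inf V t (\<lambda>u. fst (c u)), (\<lambda>r. lim_inf V t (\<lambda>u. snd (c u) r)))"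
          by (rule rl(3)[OF t(1)])
        have cs: "codes (c s) (U (e s))" if "s \<in> preds V t" for s using less.IH that preds_iff[OF t(1)] t by blast
        have "lim_inf V t (\<lambda>u. fst (c u)) = linf x (\<lambda>s. cmp 0 (U s))"
          unfolding t(2)[symmetric] by (rule lim_inf_eq[OF t(1)]) (use cs in \<open>simp add: codes_def\<close>)
        moreover have "lim_inf V t (\<lambda>u. snd (c u) r) = linf x (\<lambda>s. cmp (Suc r) (U s))" for r
          unfolding t(2)[symmetric] by (rule lim_inf_eq[OF t(1)]) (use cs in \<open>simp add: codes_def\<close>)
        ultimately show ?thesis unfolding codes_def ct using Ulim[OF lim] by (simp del: cmp_0 cmp_Suc)
      qed
    qed
  qed
  have tF: "t \<in> Field V" using t(1) by (simp add: is_greatest_def)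
  define h where "h = U (e t)"
  have ch: "codes (c t) h" using cod tF by (simp add: h_def)
  have fix_h: "nxt P z h = h" using ch t(2) by (simp add: nxt_def codes_def)
  have const: "e t \<le> s ==> U s = h" for s
  proof (induction s rule: om_induct)
    case zero then show ?case using ozero_le[of "e t"] by (metis h_def order_antisym)
  next
    case (osuc s)
    then show ?case using fix_h U(2)[of s] h_def by (cases "e t = osuc s") (auto simp: order_le_less)
  next
    case (lim u)
    show ?case
    proof (cases "e t = u")
      case True then show ?thesis by (simp add: h_def)
    next
      case False
      then have u: "e t < u" using lim.prems by simp
      have "linf u (\<lambda>s. cmp j (U s)) = cmp j h" for j
      proof (rule linf_eqI[OF u])
        show "e t \<le> s ==> s < u ==> cmp j h \<le> cmp j (U s)" for s using lim.IH by simp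
        fix s assume "s < u"
        then show "\<exists>u' \<ge> s. u' < u \<and> cmp j (U u') = cmp j h"
          using u lim.IH[of "max s (e t)"] by (intro exI[of _ "max s (e t)"]) auto
      qed
      then show ?thesis using Ulim[OF lim.hyps] by (intro cmp_inj[of "U u" h]) simp
    qed
  qed
  interpret halting_run ?N "nxt P z" U "e t" h
    by standard (use U(2) Ulim supp const in auto)
  have "fst (lev ?N (nxt P z) (Suc ?N)) (start i) = h" using lev_halt[of ozero] U(1) by simp
  then show ?thesis unfolding Hp_def using ch t by (auto simp: codes_def simp del: cmp_0 cmp_Suc lev.simps)
qed

section \<open>Machine runs as concatenated segments\<close>

text \<open>An inferior limit along concatenated segments depends only on the sets
  \<open>V n\<close> of configurations met in each; the second alternative is the overflow, with
  value 0.\<close>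

definition islim :: "(nat => config set) => (config => nat) => nat => bool" where
  "islim V g v \<longleftrightarrow> ((\<exists>k. \<forall>n \<ge> k. \<forall>u \<in> V n. v \<le> g u) \<and> (\<forall>k. \<exists>n \<ge> k. \<exists>u \<in> V n. g u = v)) \<or>
     ((\<forall>B. \<exists>k. \<forall>n \<ge> k. \<forall>u \<in> V n. B \<le> g u) \<and> v = 0)"

lemma islim_ex: assumes "!!n. V n \<noteq> {}" shows "\<exists>v. islim V g v"
proof -
  let ?Q = "\<lambda>v. \<exists>k. \<forall>n \<ge> k. \<forall>u \<in> V n. v \<le> g u"
  show ?thesis
  proof (cases "\<forall>B. ?Q B")
    case True then show ?thesis unfolding islim_def by blast
  next
    case False
    then obtain B where B: "\<not> ?Q B" by blast
    have "v \<le> B" if "?Q v" for v using that B order.trans nat_le_linear by meson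
    then obtain v where v: "?Q v" "!!w. ?Q w ==> w \<le> v"
      using GreatestI_nat[of ?Q 0 B] Greatest_le_nat[of ?Q _ B] by blast
    obtain k0 where k0: "!!n u. k0 \<le> n ==> u \<in> V n ==> v \<le> g u" using v(1) by blast
    have "\<exists>n \<ge> k. \<exists>u \<in> V n. g u = v" for k
    proof -
      have "\<not> ?Q (Suc v)" using v(2)[of "Suc v"] by auto
      then obtain n u where "max k k0 \<le> n" "u \<in> V n" "\<not> Suc v \<le> g u" by blast
      then show ?thesis using k0[of n u] by (intro exI[of _ n] conjI bexI[of _ u]) auto
    qed
    then show ?thesis using v(1) unfolding islim_def by blast
  qed
qed

text \<open>\<open>V\<close> collects the configurations before \<open>d\<close>.\<close>
inductive seg :: "program => nat set => config => config set => config => bool" for P z where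
  seg_refl: "seg P z c {} c"
| seg_step: "fst c < length P ==> seg P z c {c} (step P z c)"
| seg_trans: "seg P z c V d ==> seg P z d V' e ==> seg P z c (V \<union> V') e"
| seg_lim: "(!!n. seg P z (c n) (V n) (c (Suc n))) ==> (!!n. V n \<noteq> {}) ==>
    islim V fst (fst d) ==> (!!r. islim V (\<lambda>u. snd u r) (snd d r)) ==> seg P z (c 0) (\<Union>n. V n) d"

lemma seg_lines: "seg P z c V d ==> u \<in> V ==> fst u < length P"
  by (induction rule: seg.induct) auto

locale long_run =
  fixes P z and K :: "om => config"
  assumes K_osuc: "K (osuc t) = step P z (K t)"
    and K_lim: "lim t ==> K t = (linf t (\<lambda>s. fst (K s)), \<lambda>r. linf t (\<lambda>s. snd (K s) r))"
begin

lemma seg_times: "seg P z c V d ==> \<forall>t. K t = c --> (\<exists>t' \<ge> t. K t' = d \<and> K ` {t..<t'} = V)"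
proof (induction rule: seg.induct)
  case (seg_refl c)
  show ?case by (intro allI impI) (rule exI, auto)
next
  case (seg_step c)
  show ?case
  proof (intro allI impI)
    fix t assume t: "K t = c"
    have "{t..<osuc t} = {t}" by auto
    then show "\<exists>t' \<ge> t. K t' = step P z c \<and> K ` {t..<t'} = {c}"
      using t seg_step K_osuc[of t] by (intro exI[of _ "osuc t"]) (auto simp: less_imp_le)
  qed
next
  case (seg_trans c V d V' e)
  show ?case
  proof (intro allI impI)
    fix t assume "K t = c"
    then obtain t1 where 1: "t \<le> t1" "K t1 = d" "K ` {t..<t1} = V" using seg_trans.IH(1) by blast
    then obtain t2 where 2: "t1 \<le> t2" "K t2 = e" "K ` {t1..<t2} = V'" using seg_trans.IH(2) by blast
    have "{t..<t2} = {t..<t1} \<union> {t1..<t2}" using 1(1) 2(1) by (simp add: ivl_disj_un)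
    then show "\<exists>t' \<ge> t. K t' = e \<and> K ` {t..<t'} = V \<union> V'"
      using 1 2 by (intro exI[of _ t2]) (auto simp: image_Un)
  qed
next
  case (seg_lim c V d)
  show ?case
  proof (intro allI impI)
    fix t assume t: "K t = c 0"
    have "\<forall>n s. \<exists>s'. K s = c n --> s \<le> s' \<and> K s' = c (Suc n) \<and> K ` {s..<s'} = V n"
      using seg_lim.IH by blast
    then obtain h where h: "!!n s. K s = c n ==> s \<le> h n s \<and> K (h n s) = c (Suc n) \<and> K ` {s..<h n s} = V n"
      by metis
    define T where "T = rec_nat t h"
    have T: "T 0 = t" "T (Suc n) = h n (T n)" for n by (simp_all add: T_def)
    have KT: "K (T n) = c n" for n by (induction n) (use t h in \<open>auto simp: T\<close>)
    have KV: "K ` {T n..<T (Suc n)} = V n" for n using h[OF KT] by (simp add: T)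
    have TS: "T n < T (Suc n)" for n using KV[of n] seg_lim.hyps(2)[of n] by (metis atLeastLessThan_empty image_empty not_less)
    then obtain l where l: "lim l" "!!n. T n < l" "!!s. s < l ==> \<exists>n. s < T n" using seq_sup[of T] by blast
    have mono: "m \<le> n ==> T m \<le> T n" for m n using lift_Suc_mono_le[of T m n] TS by (simp add: less_imp_le)
    have find: "\<exists>n \<ge> k. T n \<le> s \<and> s < T (Suc n)" if "T k \<le> s" "s < l" for k s
    proof -
      define n where "n = (LEAST n. s < T n)"
      have n: "s < T n" unfolding n_def using l(3)[OF that(2)] by (rule LeastI_ex)
      have "k < n" using n mono[of n k] that(1) by (meson leD leI order_trans)
      then obtain n' where n': "n = Suc n'" by (cases n) auto
      have "T n' \<le> s" using not_less_Least[of n' "\<lambda>n. s < T n"] unfolding n_def[symmetric] n' by simp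
      then show ?thesis using n n' \<open>k < n\<close> by (intro exI[of _ n']) auto
    qed
    have L: "linf l (\<lambda>s. g (K s)) = v" if g: "islim V g v" for g v
      using g unfolding islim_def
    proof (elim disjE conjE)
      assume a: "\<exists>k. \<forall>n \<ge> k. \<forall>u \<in> V n. v \<le> g u" and b: "\<forall>k. \<exists>n \<ge> k. \<exists>u \<in> V n. g u = v"
      from a obtain k where k: "!!n u. k \<le> n ==> u \<in> V n ==> v \<le> g u" by blast
      show ?thesis
      proof (rule linf_eqI(1)[OF l(2)])
        fix s assume "T k \<le> s" "s < l"
        then obtain n where n: "k \<le> n" "T n \<le> s" "s < T (Suc n)" using find by blast
        then have "K s \<in> V n" using KV[of n] by auto
        then show "v \<le> g (K s)" using k n(1) by blast
      next
        fix s assume "s < l"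
        then obtain k where k: "s < T k" using l(3) by blast
        then obtain n u where n: "k \<le> n" "u \<in> V n" "g u = v" using b by blast
        then obtain s' where "s' \<in> {T n..<T (Suc n)}" "K s' = u" using KV[of n] by (metis imageE)
        then show "\<exists>u \<ge> s. u < l \<and> g (K u) = v"
          using n k mono[OF n(1)] l(2)[of "Suc n"] by (intro exI[of _ s']) auto
      qed
    next
      assume a: "\<forall>B. \<exists>k. \<forall>n \<ge> k. \<forall>u \<in> V n. B \<le> g u" and v: "v = 0"
      have "ovf l (\<lambda>s. g (K s))" unfolding ovf_def
      proof
        fix B obtain k where k: "!!n u. k \<le> n ==> u \<in> V n ==> B \<le> g u" using a by blast
        have "B \<le> g (K s)" if s: "T k \<le> s" "s < l" for s
        proof -
          obtain n where n: "k \<le> n" "T n \<le> s" "s < T (Suc n)" using find[OF s] by blast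
          then have "K s \<in> V n" using KV[of n] by auto
          then show ?thesis using k n(1) by blast
        qed
        then show "\<exists>s<l. \<forall>u\<in>{s..<l}. B \<le> g (K u)" using l(2)[of k] by (intro exI[of _ "T k"]) auto
      qed
      then show ?thesis using linf_ovf v by simp
    qed
    have "K l = d" unfolding K_lim[OF l(1)]
      using L[OF seg_lim.hyps(3)] L[OF seg_lim.hyps(4)] by (intro prod_eqI ext) simp_all
    moreover have "K ` {t..<l} = (\<Union>n. V n)"
    proof (intro equalityI subsetI)
      fix u assume "u \<in> K ` {t..<l}"
      then obtain s where "t \<le> s" "s < l" "u = K s" by auto
      then show "u \<in> (\<Union>n. V n)" using find[of 0 s] KV T by fastforce
    next
      fix u assume "u \<in> (\<Union>n. V n)"
      then obtain n s where "T n \<le> s" "s < T (Suc n)" "u = K s" using KV by fastforce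
      then show "u \<in> K ` {t..<l}" using mono[of 0 n] l(2)[of "Suc n"] T(1) by (intro image_eqI[of _ _ s]) auto
    qed
    ultimately show "\<exists>t' \<ge> t. K t' = d \<and> K ` {t..<t'} = (\<Union>n. V n)"
      using l(2)[of 0] T(1) by (intro exI[of _ l]) auto
  qed
qed

end

text \<open>The run is first performed on the long axis. The times up to halting inject into the
  reals, which gives the time domain required by \<open>halts_with\<close>.\<close>

theorem seg_halts:
  assumes s: "seg P z (0, (\<lambda>r. 0)(0 := i)) V d" and d: "length P \<le> fst d" "snd d 0 = v"
  shows "halts_with P z i v"
proof -
  have "\<exists>K. K ozero = (0, (\<lambda>r. 0)(0 := i)) \<and> (\<forall>t. K (osuc t) = step P z (K t)) \<and>
      (\<forall>t. lim t --> K t = (linf t (\<lambda>s. fst (K s)), \<lambda>r. linf t (\<lambda>s. snd (K s) r)))"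
    by (rule om_iterate) (intro arg_cong2[where f = Pair] ext linf_cong, simp_all)
  then obtain K where K0: "K ozero = (0, (\<lambda>r. 0)(0 := i))" and KS: "!!t. K (osuc t) = step P z (K t)"
    and KL: "!!t. lim t ==> K t = (linf t (\<lambda>s. fst (K s)), \<lambda>r. linf t (\<lambda>s. snd (K s) r))" by blast
  interpret long_run P z K by unfold_locales (fact KS, fact KL)
  obtain th where th: "K th = d" "K ` {ozero..<th} = V" using seg_times[OF s] K0 by blast
  have lines: "fst (K s) < length P" if "s < th" for s
    using seg_lines[OF s, of "K s"] th(2) that by auto
  obtain g :: "om => nat set" where g: "inj_on g {s. s \<le> th}" using om_inject by blast
  define e where "e = inv_into {s. s \<le> th} g"
  have eg: "e (g s) = s" if "s \<le> th" for s using g that by (simp add: e_def inv_into_f_f)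
  define W where "W = {(g a, g b) | a b. a \<le> b \<and> b \<le> th}"
  have F: "Field W = g ` {s. s \<le> th}" unfolding W_def Field_def by (auto intro: order_trans)
  have W: "(x, y) \<in> W \<longleftrightarrow> x \<in> Field W \<and> y \<in> Field W \<and> e x \<le> e y" for x y
    unfolding F by (auto simp: W_def eg intro: order_trans) (auto simp: eg)
  have e_le: "x \<in> Field W ==> e x \<le> th" for x unfolding F by (auto simp: eg)
  interpret time_embed W e
  proof
    show "s \<in> Field W ==> t \<in> Field W ==> (s, t) \<in> W \<longleftrightarrow> e s \<le> e t" for s t using W by blast
    show "\<exists>s \<in> Field W. e s = u" if "t \<in> Field W" "u \<le> e t" for t u
    proof -
      have "u \<le> th" using that e_le order_trans by blast
      then show ?thesis using eg F by blast
    qed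
    show "inj_on e (Field W)" unfolding F by (auto simp: inj_on_def eg)
  qed
  have "Well_order W"
  proof -
    have "wf (inv_image {(x, y). x < y} e)" by (intro wf_inv_image wf)
    then have "wf (W - Id)"
    proof (rule wf_subset)
      show "W - Id \<subseteq> inv_image {(x, y). x < y} e"
      proof (rule subrelI)
        fix a b assume "(a, b) \<in> W - Id"
        then have "(a, b) \<in> W" "a \<noteq> b" by auto
        then have "e a \<le> e b" "e a \<noteq> e b" using W[of a b] inj_onD[OF e_inj, of a b] by auto
        then show "(a, b) \<in> inv_image {(x, y). x < y} e" by simp
      qed
    qed
    moreover have "antisym W"
    proof (rule antisymI)
      fix a b assume "(a, b) \<in> W" "(b, a) \<in> W"
      then show "a = b" using W[of a b] W[of b a] inj_onD[OF e_inj, of a b] by auto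
    qed
    moreover have "trans W" unfolding trans_def using W order_trans by meson
    moreover have "Total W" unfolding total_on_def
    proof (intro ballI impI)
      fix a b assume "a \<in> Field W" "b \<in> Field W"
      then show "(a, b) \<in> W \<or> (b, a) \<in> W" using W[of a b] W[of b a] linear[of "e a" "e b"] by simp
    qed
    moreover have "Refl W" using W by (auto simp: refl_on_def)
    moreover have "W \<subseteq> Field W \<times> Field W" using W by auto
    ultimately show ?thesis by (simp add: order_on_defs)
  qed
  moreover have "Field W \<noteq> {}" unfolding F by auto
  moreover have "(is_least W t --> K (e t) = (0, (\<lambda>r. 0)(0 := i))) \<and>
        (\<forall>s. imm_pred W s t --> K (e t) = step P z (K (e s))) \<and>
        ((\<not> is_least W t \<and> \<not> (\<exists>s. imm_pred W s t)) -->
            K (e t) = (lim_inf W t (\<lambda>u. fst (K (e u))), (\<lambda>r. lim_inf W t (\<lambda>u. snd (K (e u)) r)))) \<and>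
        (\<forall>s\<in>preds W t. fst (K (e s)) < length P)" if t: "t \<in> Field W" for t
  proof (intro conjI allI impI ballI)
    show "is_least W t ==> K (e t) = (0, (\<lambda>r. 0)(0 := i))" using is_least_iff[OF t] K0 by simp
    show "K (e t) = step P z (K (e s))" if "imm_pred W s t" for s
    proof -
      have "e t = osuc (e s)" using that imm_pred_iff[OF t] by blast
      then show ?thesis using K_osuc[of "e s"] by simp
    qed
    show "fst (K (e s)) < length P" if "s \<in> preds W t" for s
    proof (rule lines)
      have "e s < e t" using that preds_iff[OF t] by blast
      then show "e s < th" using e_le[OF t] by simp
    qed
    assume a: "\<not> is_least W t \<and> \<not> (\<exists>s. imm_pred W s t)"
    have l: "lim (e t)"
    proof (cases "e t" rule: om_cases)
      case zero then show ?thesis using a is_least_iff[OF t] by simp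
    next
      case (osuc s)
      then obtain s' where "s' \<in> Field W" "e s' = s" using e_initial[OF t, of s] by (auto simp: less_imp_le)
      then show ?thesis using a imm_pred_iff[OF t, of s'] osuc by auto
    qed
    show "K (e t) = (lim_inf W t (\<lambda>u. fst (K (e u))), (\<lambda>r. lim_inf W t (\<lambda>u. snd (K (e u)) r)))"
      using lim_inf_eq[OF t] by (subst K_lim[OF l]) simp
  qed
  ultimately have "is_run P z i W (K \<circ> e)" unfolding is_run_def by simp
  moreover have "is_greatest W (g th)" unfolding is_greatest_def using W e_le eg F by auto
  moreover have "(K \<circ> e) (g th) = d" using th eg by simp
  ultimately show ?thesis using d unfolding halts_with_def by metis
qed

section \<open>Structured programs\<close>

datatype com = Ze nat | In nat | Cp nat nat | Sq com com | IfE nat nat com com | IfO nat com com | Rp nat nat com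

fun csz :: "com => nat" where
  "csz (Ze r) = 1" | "csz (In r) = 1" | "csz (Cp a b) = 1"
| "csz (Sq c d) = csz c + csz d"
| "csz (IfE a b c d) = csz c + csz d + 2"
| "csz (IfO r c d) = csz c + csz d + 2"
| "csz (Rp a b c) = csz c + 2"

text \<open>Jump targets are absolute, so the code depends on the line \<open>k\<close> where it is
  placed. \<open>JumpEq 0 0\<close> jumps unconditionally, and \<open>Rp a b c\<close> repeats
  \<open>c\<close> until registers \<open>a\<close> and \<open>b\<close> agree.\<close>

fun code :: "com => nat => instr list" where
  "code (Ze r) k = [Zero r]"
| "code (In r) k = [Incr r]"
| "code (Cp a b) k = [Copy a b]"
| "code (Sq c d) k = code c k @ code d (k + csz c)"
| "code (IfE a b c d) k = JumpEq a b (k + csz d + 2) # code d (k + 1) @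
     JumpEq 0 0 (k + csz d + 2 + csz c) # code c (k + csz d + 2)"
| "code (IfO r c d) k = Oracle r (k + csz d + 2) # code d (k + 1) @
     JumpEq 0 0 (k + csz d + 2 + csz c) # code c (k + csz d + 2)"
| "code (Rp a b c) k = JumpEq a b (k + csz c + 2) # code c (k + 1) @ [JumpEq 0 0 k]"

lemma length_code [simp]: "length (code c k) = csz c"
  by (induction c arbitrary: k) auto

definition placed :: "program => nat => instr list => bool" where
  "placed P k cd \<longleftrightarrow> (\<forall>i < length cd. k + i < length P \<and> P ! (k + i) = cd ! i)"

lemma placed_Nil [simp]: "placed P k []" by (simp add: placed_def)

lemma placed_Cons [simp]: "placed P k (i # cd) \<longleftrightarrow> k < length P \<and> P ! k = i \<and> placed P (Suc k) cd"
  unfolding placed_def by (auto simp: less_Suc_eq_0_disj)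

lemma placed_append [simp]: "placed P k (xs @ ys) \<longleftrightarrow> placed P k xs \<and> placed P (k + length xs) ys"
  by (induction xs arbitrary: k) auto

type_synonym regs = "nat => nat"

text \<open>The bound \<open>k\<close> on lines controls limits: if a loop with head
  \<open>k\<close> is passed infinitely often, no line below \<open>k\<close> occurs and
  \<open>k\<close> recurs, so the inferior limit of the line is \<open>k\<close>. The condition
  \<open>c \<in> V\<close> makes the segment nonempty and records the head.\<close>

definition sg :: "program => nat set => nat => (regs => bool) => config => config => bool" where
  "sg P z k I c d \<longleftrightarrow> (\<exists>V. seg P z c V d \<and> c \<in> V \<and> (\<forall>u \<in> V. k \<le> fst u \<and> I (snd u)))"

lemma sg_step:
  "l < length P ==> k \<le> l ==> I R ==> exec (P ! l) z (l, R) = d ==> sg P z k I (l, R) d"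
  unfolding sg_def using seg_step[of "(l, R)" P z] by (intro exI[of _ "{(l, R)}"]) (auto simp: step_def)

lemma sg_trans: "sg P z k I c d ==> sg P z k I d e ==> sg P z k I c e"
  unfolding sg_def by (meson Un_iff seg_trans)

lemma sg_mono: "sg P z k I c d ==> k' \<le> k ==> (!!R. I R ==> I' R) ==> sg P z k' I' c d"
  unfolding sg_def by (meson order_trans)

text \<open>A Hoare triple for total correctness from the single state \<open>R\<close>. The
  invariant \<open>I\<close> has to hold at all intermediate states, since register contents at a
  limit of loop passes depend on them.\<close>

definition ht :: "nat set => (regs => bool) => com => regs => (regs => bool) => bool" where
  "ht z I c R Q \<longleftrightarrow> (\<forall>P k. placed P k (code c k) -->
     (\<exists>R'. sg P z k I (k, R) (k + csz c, R') \<and> I R' \<and> Q R'))"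

lemma ht_mono: "ht z I c R Q ==> (!!R. I R ==> I' R) ==> (!!R. I R ==> Q R ==> Q' R) ==> ht z I' c R Q'"
  unfolding ht_def by (meson order_refl sg_mono)

lemma ht_post: "ht z I c R Q ==> (!!R. I R ==> Q R ==> Q' R) ==> ht z I c R Q'"
  by (rule ht_mono)

lemma ht_Ze: "I R ==> I (R(r := 0)) ==> Q (R(r := 0)) ==> ht z I (Ze r) R Q"
  unfolding ht_def by (auto intro!: sg_step)
lemma ht_In: "I R ==> I (R(r := Suc (R r))) ==> Q (R(r := Suc (R r))) ==> ht z I (In r) R Q"
  unfolding ht_def by (auto intro!: sg_step)
lemma ht_Cp: "I R ==> I (R(b := R a)) ==> Q (R(b := R a)) ==> ht z I (Cp a b) R Q"
  unfolding ht_def by (auto intro!: sg_step)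

lemma ht_Sq: "ht z I c R (\<lambda>R'. ht z I d R' Q) ==> ht z I (Sq c d) R Q"
  unfolding ht_def
proof (intro allI impI)
  fix P k
  assume c: "\<forall>P k. placed P k (code c k) --> (\<exists>R'. sg P z k I (k, R) (k + csz c, R') \<and> I R' \<and>
     (\<forall>P k. placed P k (code d k) --> (\<exists>R''. sg P z k I (k, R') (k + csz d, R'') \<and> I R'' \<and> Q R'')))"
    and P: "placed P k (code (Sq c d) k)"
  then obtain R' where 1: "sg P z k I (k, R) (k + csz c, R')"
    and d: "\<forall>P k. placed P k (code d k) --> (\<exists>R''. sg P z k I (k, R') (k + csz d, R'') \<and> I R'' \<and> Q R'')"
    by (metis code.simps(4) placed_append)
  have "placed P (k + csz c) (code d (k + csz c))" using P by simp
  then obtain R'' where 2: "sg P z (k + csz c) I (k + csz c, R') (k + csz c + csz d, R'')" "I R''" "Q R''"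
    using d by blast
  have "sg P z k I (k, R) (k + csz c + csz d, R'')" by (rule sg_trans[OF 1 sg_mono[OF 2(1)]]) auto
  then show "\<exists>R'. sg P z k I (k, R) (k + csz (Sq c d), R') \<and> I R' \<and> Q R'"
    using 2 by (auto simp: add.assoc)
qed

lemma branch_seg:
  assumes I: "I R" and c: "b ==> ht z I c R Q" and d: "\<not> b ==> ht z I d R Q"
    and P: "k < length P" "placed P (Suc k) (code d (k + 1) @ JumpEq 0 0 (k + csz d + 2 + csz c) # code c (k + csz d + 2))"
    and e: "exec (P ! k) z (k, R) = (if b then k + csz d + 2 else Suc k, R)"
  shows "\<exists>R'. sg P z k I (k, R) (k + (csz c + csz d + 2), R') \<and> I R' \<and> Q R'"
proof (cases b)
  case True
  have "placed P (k + csz d + 2) (code c (k + csz d + 2))" using P(2) by (simp add: numeral_2_eq_2)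
  then obtain R' where R': "sg P z (k + csz d + 2) I (k + csz d + 2, R) (k + csz d + 2 + csz c, R')" "I R'" "Q R'"
    using c[OF True] unfolding ht_def by blast
  have "sg P z k I (k, R) (k + csz d + 2, R)" by (rule sg_step) (use P I e True in auto)
  from sg_trans[OF this sg_mono[OF R'(1)]] have "sg P z k I (k, R) (k + csz d + 2 + csz c, R')" by simp
  then show ?thesis using R' by (auto simp: ac_simps)
next
  case False
  have "placed P (Suc k) (code d (Suc k))" using P(2) by simp
  then obtain R' where R': "sg P z (Suc k) I (Suc k, R) (Suc k + csz d, R')" "I R'" "Q R'"
    using d[OF False] unfolding ht_def by blast
  have 1: "sg P z k I (k, R) (Suc k, R)" by (rule sg_step) (use P I e False in auto)
  have 2: "sg P z k I (k, R) (Suc k + csz d, R')" by (rule sg_trans[OF 1 sg_mono[OF R'(1)]]) auto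
  have "sg P z k I (Suc k + csz d, R') (k + csz d + 2 + csz c, R')"
    by (rule sg_step) (use P R' in auto)
  from sg_trans[OF 2 this] show ?thesis using R' by (auto simp: ac_simps)
qed

lemma ht_IfE:
  assumes "I R" "R a = R b ==> ht z I c R Q" "R a \<noteq> R b ==> ht z I d R Q"
  shows "ht z I (IfE a b c d) R Q"
  unfolding ht_def csz.simps using assms
  by (intro allI impI branch_seg[where b = "R a = R b"]) auto

lemma ht_IfO:
  assumes "I R" "R r \<in> z ==> ht z I c R Q" "R r \<notin> z ==> ht z I d R Q"
  shows "ht z I (IfO r c d) R Q"
  unfolding ht_def csz.simps using assms
  by (intro allI impI branch_seg[where b = "R r \<in> z"]) auto

lemma loop_once:
  assumes P: "placed P k (code (Rp a b c) k)" and I: "I R" and ab: "R a \<noteq> R b" and c: "ht z I c R Q"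
  shows "\<exists>R'. sg P z k I (k, R) (k, R') \<and> I R' \<and> Q R'"
proof -
  have "placed P (Suc k) (code c (Suc k))" using P by simp
  then obtain R' where R': "sg P z (Suc k) I (Suc k, R) (Suc k + csz c, R')" "I R'" "Q R'"
    using c unfolding ht_def by blast
  have 1: "sg P z k I (k, R) (Suc k, R)" by (rule sg_step) (use P I ab in auto)
  have 2: "sg P z k I (k, R) (Suc k + csz c, R')" by (rule sg_trans[OF 1 sg_mono[OF R'(1)]]) auto
  have "sg P z k I (Suc k + csz c, R') (k, R')" by (rule sg_step) (use P R' in auto)
  from sg_trans[OF 2 this] show ?thesis using R' by blast
qed

lemma loop_exit:
  assumes "placed P k (code (Rp a b c) k)" "I R" "R a = R b"
  shows "sg P z k I (k, R) (k + csz (Rp a b c), R)"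
  by (rule sg_step) (use assms in auto)

text \<open>Covers loops that end after finitely many passes, \<open>n\<close> counting those left.
  The search loop, which passes through limits, is treated separately.\<close>

lemma ht_Rp:
  assumes "Jn n R" "!!R. Jn 0 R ==> R a = R b \<and> Q R"
    "!!n R. Jn (Suc n) R ==> R a \<noteq> R b \<and> ht z I c R (Jn n)" "!!n R. Jn n R ==> I R"
  shows "ht z I (Rp a b c) R Q"
  unfolding ht_def
proof (intro allI impI)
  fix P k assume P: "placed P k (code (Rp a b c) k)"
  show "\<exists>R'. sg P z k I (k, R) (k + csz (Rp a b c), R') \<and> I R' \<and> Q R'"
    using assms(1)
  proof (induction n arbitrary: R)
    case 0
    then show ?case using loop_exit[OF P, of I R z] assms(2,4) by blast
  next
    case (Suc n)
    obtain R' where R': "sg P z k I (k, R) (k, R')" "Jn n R'"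
      using loop_once[OF P, of I R z "Jn n"] assms(3,4) Suc.prems by blast
    from Suc.IH[OF R'(2)] show ?case using sg_trans[OF R'(1)] by blast
  qed
qed

definition agree :: "nat => regs => regs => bool" where "agree r R S \<longleftrightarrow> (\<forall>i < r. S i = R i)"

lemma agree_refl [simp]: "agree r R R" by (simp add: agree_def)
lemma agree_upd [simp]: "r \<le> x ==> agree r R (S(x := v)) \<longleftrightarrow> agree r R S" by (auto simp: agree_def)
lemma agree_upd' [simp]: "r \<le> x ==> agree r (R(x := v)) S \<longleftrightarrow> agree r R S" by (auto simp: agree_def)
lemma agree_trans: "agree t R S ==> agree t' S S' ==> r \<le> t ==> r \<le> t' ==> agree r R S'" by (auto simp: agree_def)
lemma agree_mono: "agree t R S ==> r \<le> t ==> agree r R S" by (auto simp: agree_def)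

lemma ht_sub:
  assumes "ht z (agree t S) c S Q" "agree r R S" "r \<le> t" "!!S'. agree t S S' ==> Q S' ==> Q' S'"
  shows "ht z (agree r R) c S Q'"
  using assms(1) by (rule ht_mono) (use assms in \<open>auto intro: agree_trans\<close>)

section \<open>Programs for functions\<close>

lemmas ht_atoms = ht_Ze ht_In ht_Cp

text \<open>\<open>pr m k\<close> is \<open>triangle (m + k) + m\<close>: the program forms
  \<open>m + k\<close> and then adds 1, 2, ..., \<open>m + k\<close> to \<open>m\<close>.\<close>

definition enc_prog :: "nat => com" where
  "enc_prog r = Sq (Cp (r+1) (r+3)) (Sq (Ze (r+4)) (Sq (Rp (r+4) (r+2) (Sq (In (r+3)) (In (r+4))))
     (Sq (Cp (r+1) r) (Sq (Ze (r+4)) (Rp (r+4) (r+3)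
        (Sq (In (r+4)) (Sq (Ze (r+5)) (Rp (r+5) (r+4) (Sq (In r) (In (r+5)))))))))))"

lemma enc_prog: "ht z (agree r R0) (enc_prog r) R (\<lambda>R'. R' r = pr (R (r+1)) (R (r+2)))" if a: "agree r R0 R"
  unfolding enc_prog_def
proof (intro ht_Sq ht_atoms)
  let ?R = "R(r + 3 := R (r + 1), r + 4 := 0)"
  let ?m = "R (r+1)" let ?k = "R (r+2)"
  show "ht z (agree r R0) (Rp (r+4) (r+2) (Sq (In (r+3)) (In (r+4)))) ?R
    (\<lambda>R'. ht z (agree r R0) (Sq (Cp (r+1) r) (Sq (Ze (r+4)) (Rp (r+4) (r+3)
        (Sq (In (r+4)) (Sq (Ze (r+5)) (Rp (r+5) (r+4) (Sq (In r) (In (r+5))))))))) R' (\<lambda>R'. R' r = pr ?m ?k))"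
  proof (rule ht_Rp[where n = "?k" and Jn = "\<lambda>n S. agree r R0 S \<and> S (r+1) = ?m \<and> S (r+2) = ?k \<and>
       S (r+4) + n = ?k \<and> S (r+3) = ?m + S (r+4)"])
    fix S assume S: "agree r R0 S \<and> S (r+1) = ?m \<and> S (r+2) = ?k \<and> S (r+4) + 0 = ?k \<and> S (r+3) = ?m + S (r+4)"
    let ?S = "S(r := ?m, r + 4 := 0)"
    have "ht z (agree r R0) (Rp (r+4) (r+3) (Sq (In (r+4)) (Sq (Ze (r+5)) (Rp (r+5) (r+4) (Sq (In r) (In (r+5)))))))
       ?S (\<lambda>R'. R' r = pr ?m ?k)"
    proof (rule ht_Rp[where n = "?m + ?k" and Jn = "\<lambda>n T. agree r R0 T \<and> T (r+3) = ?m + ?k \<and>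
        T (r+4) + n = ?m + ?k \<and> T r = triangle (T (r+4)) + ?m"])
      fix n T assume T: "agree r R0 T \<and> T (r+3) = ?m + ?k \<and> T (r+4) + Suc n = ?m + ?k \<and> T r = triangle (T (r+4)) + ?m"
      let ?T = "T(r + 4 := Suc (T (r+4)), r + 5 := 0)"
      have "ht z (agree r R0) (Rp (r+5) (r+4) (Sq (In r) (In (r+5)))) ?T
         (\<lambda>T'. agree r R0 T' \<and> T' (r+3) = ?m + ?k \<and> T' (r+4) + n = ?m + ?k \<and> T' r = triangle (T' (r+4)) + ?m)"
        by (rule ht_Rp[where n = "Suc (T (r+4))" and Jn = "\<lambda>j S. agree r R0 S \<and> S (r+3) = ?m + ?k \<and>
             S (r+4) = Suc (T (r+4)) \<and> S (r+5) + j = Suc (T (r+4)) \<and> S r = triangle (T (r+4)) + ?m + S (r+5)"])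
           (use T in \<open>auto intro!: ht_Sq ht_atoms\<close>)
      then show "T (r+4) \<noteq> T (r+3) \<and> ht z (agree r R0) (Sq (In (r+4)) (Sq (Ze (r+5)) (Rp (r+5) (r+4) (Sq (In r) (In (r+5))))))
         T (\<lambda>T'. agree r R0 T' \<and> T' (r+3) = ?m + ?k \<and> T' (r+4) + n = ?m + ?k \<and> T' r = triangle (T' (r+4)) + ?m)"
        using T by (intro conjI ht_Sq ht_atoms) auto
    qed (use S in \<open>auto simp: prod_encode_def\<close>)
    then show "S (r+4) = S (r+2) \<and> ht z (agree r R0) (Sq (Cp (r+1) r) (Sq (Ze (r+4)) (Rp (r+4) (r+3)
        (Sq (In (r+4)) (Sq (Ze (r+5)) (Rp (r+5) (r+4) (Sq (In r) (In (r+5))))))))) S (\<lambda>R'. R' r = pr ?m ?k)"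
      using S by (intro conjI ht_Sq ht_atoms) auto
  qed (use a in \<open>auto intro!: ht_Sq ht_atoms\<close>)
qed (use a in auto)

text \<open>Counts up to the input along the diagonals of the pairing, with the position in
  \<open>r+1\<close> and the number of the diagonal in \<open>r+4\<close>; the second component is
  their difference.\<close>

definition dec_prog :: "nat => com" where
  "dec_prog r = Sq (Ze (r+1)) (Sq (Ze (r+3)) (Sq (Ze (r+4)) (Sq
     (Rp (r+3) r (Sq (In (r+3)) (IfE (r+1) (r+4) (Sq (Ze (r+1)) (In (r+4))) (In (r+1)))))
     (Sq (Ze (r+2)) (Sq (Cp (r+1) (r+5)) (Rp (r+5) (r+4) (Sq (In (r+5)) (In (r+2)))))))))"

lemma p_triangle: "m \<le> s ==> p1 (triangle s + m) = m \<and> p2 (triangle s + m) = s - m"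
  using p1_pr[of m "s - m"] p2_pr[of m "s - m"] by (simp add: prod_encode_def)

lemma dec_prog: "ht z (agree (Suc r) R0) (dec_prog r) R (\<lambda>R'. R' (r+1) = p1 (R r) \<and> R' (r+2) = p2 (R r))"
  if a: "agree (Suc r) R0 R"
  unfolding dec_prog_def
proof (intro ht_Sq ht_atoms)
  let ?R = "R(r+1 := 0, r+3 := 0, r+4 := 0)"
  let ?n = "R r" let ?I = "agree (Suc r) R0"
  show "ht z ?I (Rp (r+3) r (Sq (In (r+3)) (IfE (r+1) (r+4) (Sq (Ze (r+1)) (In (r+4))) (In (r+1))))) ?R
     (\<lambda>R'. ht z ?I (Sq (Ze (r+2)) (Sq (Cp (r+1) (r+5)) (Rp (r+5) (r+4) (Sq (In (r+5)) (In (r+2)))))) R'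
        (\<lambda>R'. R' (r+1) = p1 ?n \<and> R' (r+2) = p2 ?n))"
  proof (rule ht_Rp[where n = ?n and Jn = "\<lambda>n S. ?I S \<and> S r = ?n \<and> S (r+3) + n = ?n \<and> S (r+1) \<le> S (r+4) \<and>
      S (r+3) = triangle (S (r+4)) + S (r+1)"])
    fix S assume S: "?I S \<and> S r = ?n \<and> S (r+3) + 0 = ?n \<and> S (r+1) \<le> S (r+4) \<and> S (r+3) = triangle (S (r+4)) + S (r+1)"
    let ?S = "S(r+2 := 0, r+5 := S (r+1))"
    have n: "p1 ?n = S (r+1)" "p2 ?n = S (r+4) - S (r+1)" using S p_triangle[of "S (r+1)" "S (r+4)"] by auto
    have "ht z ?I (Rp (r+5) (r+4) (Sq (In (r+5)) (In (r+2)))) ?S (\<lambda>R'. R' (r+1) = p1 ?n \<and> R' (r+2) = p2 ?n)"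
      by (rule ht_Rp[where n = "S (r+4) - S (r+1)" and Jn = "\<lambda>n T. ?I T \<and> T (r+1) = S (r+1) \<and> T (r+4) = S (r+4) \<and>
          T (r+5) + n = S (r+4) \<and> T (r+5) = T (r+2) + S (r+1)"])
         (use S in \<open>auto simp: n intro!: ht_Sq ht_atoms\<close>)
    then show "S (r+3) = S r \<and> ht z ?I (Sq (Ze (r+2)) (Sq (Cp (r+1) (r+5)) (Rp (r+5) (r+4) (Sq (In (r+5)) (In (r+2)))))) S
        (\<lambda>R'. R' (r+1) = p1 ?n \<and> R' (r+2) = p2 ?n)"
      using S by (intro conjI ht_Sq ht_atoms) auto
  next
    fix n S assume "?I S \<and> S r = ?n \<and> S (r+3) + Suc n = ?n \<and> S (r+1) \<le> S (r+4) \<and> S (r+3) = triangle (S (r+4)) + S (r+1)"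
    then show "S (r+3) \<noteq> S r \<and> ht z ?I (Sq (In (r+3)) (IfE (r+1) (r+4) (Sq (Ze (r+1)) (In (r+4))) (In (r+1)))) S
       (\<lambda>S. ?I S \<and> S r = ?n \<and> S (r+3) + n = ?n \<and> S (r+1) \<le> S (r+4) \<and> S (r+3) = triangle (S (r+4)) + S (r+1))"
      by (intro conjI ht_Sq ht_atoms ht_IfE) auto
  qed (use a in auto)
qed (use a in auto)

definition fprog :: "(nat => nat) => nat => com => bool" where
  "fprog f r c \<longleftrightarrow> (\<forall>z R. ht z (agree r R) c R (\<lambda>R'. R' r = f (R r)))"

lemma fprog_ht:
  "fprog f t c ==> agree r R S ==> r \<le> t ==> (!!S'. agree t S S' ==> S' t = f (S t) ==> Q S') ==> ht z (agree r R) c S Q"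
  unfolding fprog_def by (rule ht_sub[of z t S c "\<lambda>R'. R' t = f (S t)"]) auto

lemma dec_ht:
  "agree r R S ==> r \<le> Suc t ==> (!!S'. agree (Suc t) S S' ==> S' (t+1) = p1 (S t) ==> S' (t+2) = p2 (S t) ==> Q S') ==>
    ht z (agree r R) (dec_prog t) S Q"
  by (rule ht_sub[OF dec_prog[OF agree_refl]]) auto

lemma enc_ht:
  "agree r R S ==> r \<le> t ==> (!!S'. agree t S S' ==> S' t = pr (S (t+1)) (S (t+2)) ==> Q S') ==>
    ht z (agree r R) (enc_prog t) S Q"
  by (rule ht_sub[OF enc_prog[OF agree_refl]]) auto

lemma Fn_prog: "Fn f ==> \<exists>c. fprog f r c"
proof (induction arbitrary: r rule: Fn.induct)
  case Fn_id
  show ?case unfolding fprog_def by (intro exI[of _ "Cp r r"] allI ht_Cp) auto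
next
  case Fn_0
  show ?case unfolding fprog_def by (intro exI[of _ "Ze r"] allI ht_Ze) auto
next
  case (Fn_Suc f)
  then obtain c where c: "fprog f r c" by blast
  show ?case unfolding fprog_def
    by (intro exI[of _ "Sq c (In r)"] allI ht_Sq fprog_ht[OF c] ht_In) (auto simp: agree_def)
next
  case (Fn_p1 f)
  then obtain c where c: "fprog f r c" by blast
  show ?case unfolding fprog_def
    by (intro exI[of _ "Sq c (Sq (dec_prog r) (Cp (r+1) r))"] allI ht_Sq fprog_ht[OF c] dec_ht ht_Cp)
       (auto simp: agree_def)
next
  case (Fn_p2 f)
  then obtain c where c: "fprog f r c" by blast
  show ?case unfolding fprog_def
    by (intro exI[of _ "Sq c (Sq (dec_prog r) (Cp (r+2) r))"] allI ht_Sq fprog_ht[OF c] dec_ht ht_Cp)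
       (auto simp: agree_def)
next
  case (Fn_pr f g)
  obtain c where c: "fprog f (r+1) c" using Fn_pr by blast
  obtain d where d: "fprog g (r+2) d" using Fn_pr by blast
  show ?case unfolding fprog_def
    by (intro exI[of _ "Sq (Cp r (r+1)) (Sq c (Sq (Cp r (r+2)) (Sq d (enc_prog r))))"] allI
          ht_Sq fprog_ht[OF c] fprog_ht[OF d] enc_ht ht_Cp)
       (auto simp: agree_def)
next
  case (Fn_comp f g)
  obtain c where c: "fprog f r c" using Fn_comp by blast
  obtain d where d: "fprog g r d" using Fn_comp by blast
  show ?case unfolding fprog_def
    by (intro exI[of _ "Sq d c"] allI ht_Sq fprog_ht[OF c] fprog_ht[OF d]) (auto simp: agree_def)
next
  case (Fn_iter f)
  obtain c where c: "fprog f (r+2) c" using Fn_iter by blast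
  let ?B = "Rp r (r+1) (Sq (In r) c)"
  have loop: "ht z (agree r R) ?B S (\<lambda>S'. S' (r+2) = (f ^^ S (r+1)) (S (r+2)))" if "agree r R S" "S r = 0" for z R S
    by (rule ht_Rp[where n = "S (r+1)" and Jn = "\<lambda>n T. agree r R T \<and> T (r+1) = S (r+1) \<and> T r + n = S (r+1) \<and>
          T (r+2) = (f ^^ T r) (S (r+2))"])
       (use that in \<open>auto intro!: ht_Sq ht_atoms fprog_ht[OF c] simp: agree_def\<close>)
  show ?case unfolding fprog_def
    by (intro exI[of _ "Sq (dec_prog r) (Sq (Ze r) (Sq ?B (Cp (r+2) r)))"] allI ht_Sq dec_ht ht_Ze
          ht_post[OF loop] ht_Cp) (auto simp: agree_def)
qed

section \<open>Depth-first search\<close>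

text \<open>Well-foundedness of the tree below the stack \<open>S\<close>. Requiring
  \<open>q \<ge> 1\<close> keeps every child different from 0, the value that signals an infinite
  branch.\<close>

inductive ok :: "(nat => bool) => nat => bool" for chk where
  ok_intro: "(!!q. q \<ge> 1 ==> chk (pr S q) ==> ok chk (pr S q)) ==> ok chk S"

text \<open>Register \<open>r+1\<close> holds the current stack \<open>S\<close>, register \<open>r+2\<close> the next child number. While the
children of \<open>S\<close> are explored, \<open>r+1\<close> never drops below \<open>S\<close> and returns to \<open>S\<close> before each child, so
at the limit it is \<open>S\<close> again; along an infinite branch it overflows to 0, which codes no stack.
The flag \<open>r+3\<close> is 0 at the loop head exactly at limit times.\<close>

lemma plus8: "r + 8 + 1 = r + (9 :: nat)" "r + 8 + 2 = r + (10 :: nat)" by simp_all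

locale dfs =
  fixes z :: "nat set" and r :: nat and chk :: "nat => bool" and pc :: com
  assumes pc: "!!R. ht z (agree (r+8) R) pc R (\<lambda>R'. R' (r+8) = (if chk (R (r+8)) then 1 else 0))"
begin

definition "SEL = IfE (r+8) (r+6) (In (r+2)) (Sq (Cp (r+7) (r+1)) (Sq (Ze (r+2)) (In (r+2))))"
definition "POP = IfE (r+9) (r+6) (Sq (Ze r) (Sq (In r) (In (r+4)))) (Sq (Cp (r+9) (r+1)) (Sq (Cp (r+10) (r+2)) (In (r+2))))"
definition "MB = Sq (In (r+3)) (Sq (Cp (r+1) (r+9)) (Sq (Cp (r+2) (r+10)) (Sq (enc_prog (r+8)) (Sq (Cp (r+8) (r+7))
   (Sq pc SEL)))))"
definition "LB = Sq (In (r+3)) (IfE (r+1) (r+6) (Sq (Ze r) (In (r+4))) (Sq (Cp (r+1) (r+8)) (Sq (dec_prog (r+8)) POP)))"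
definition "BODY = IfE (r+3) (r+6) LB (Sq (Ze (r+3)) MB)"
definition "LOOP = Rp (r+4) (r+5) BODY"

definition base :: "regs => regs => bool" where
  "base R0 S \<longleftrightarrow> agree r R0 S \<and> S (r+4) = 0 \<and> S (r+5) = 1 \<and> S (r+6) = 0"

lemma base_upd: "r \<le> i ==> i \<noteq> r+4 ==> i \<noteq> r+5 ==> i \<noteq> r+6 ==> base R0 (S(i := v)) \<longleftrightarrow> base R0 S"
  by (auto simp: base_def)

lemma base_agree: "agree (r+7) S S' ==> base R0 S ==> base R0 S'"
  by (auto simp: base_def agree_def)

abbreviation "fl v R0 S \<equiv> base R0 S \<and> v \<le> S (r+1)"

text \<open>\<open>lp\<close>: a piece of the run from loop head to loop head on which the flag is cleared at some time.\<close>
definition lp where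
  "lp P k R0 v R R' \<longleftrightarrow> (\<exists>V. seg P z (k, R) V (k, R') \<and> (k, R) \<in> V \<and> (\<forall>u \<in> V. k \<le> fst u \<and> fl v R0 (snd u)) \<and>
     (\<exists>u \<in> V. snd u (r+3) = 0))"

lemma lp_trans: "lp P k R0 v R R' ==> lp P k R0 v R' R'' ==> lp P k R0 v R R''"
  unfolding lp_def by (meson Un_iff seg_trans)

lemma lp_mono: "lp P k R0 v R R' ==> v' \<le> v ==> lp P k R0 v' R R'"
  unfolding lp_def by (meson order_trans)

lemma lp_sg: "lp P k R0 v R R' ==> sg P z k (agree r R0) (k, R) (k, R')"
  unfolding lp_def sg_def base_def by blast

lemma MB_ht:
  assumes b: "fl v R0 R" "R (r+3) = 0"
  shows "ht z (fl v R0) MB R (\<lambda>R'. R' (r+3) = 1 \<and> (if chk (pr (R (r+1)) (R (r+2)))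
     then R' (r+1) = pr (R (r+1)) (R (r+2)) \<and> R' (r+2) = 1 else R' (r+1) = R (r+1) \<and> R' (r+2) = Suc (R (r+2))))"
proof -
  let ?S = "R (r+1)" let ?q = "R (r+2)" let ?T = "pr ?S ?q"
  let ?Q = "\<lambda>R'. R' (r+3) = 1 \<and> (if chk ?T
     then R' (r+1) = ?T \<and> R' (r+2) = 1 else R' (r+1) = ?S \<and> R' (r+2) = Suc ?q)"
  let ?A = "\<lambda>S. fl v R0 S \<and> S (r+1) = ?S \<and> S (r+2) = ?q \<and> S (r+3) = 1"
  have vT: "v \<le> ?T" using b(1) le_prod_encode_1[of ?S ?q] by linarith
  have fl_agree: "agree (r+8) S S' ==> ?A S ==> ?A S'" for S S'
    using base_agree[OF agree_mono[of "r+8" S S' "r+7"]] by (auto simp: agree_def)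
  have 3: "ht z (fl v R0) SEL S ?Q"
    if "?A S" "S (r+7) = ?T" "S (r+8) = (if chk ?T then 1 else 0)" for S
    unfolding SEL_def using that vT by (intro ht_IfE ht_Sq ht_atoms) (auto simp: base_upd base_def[of R0 S])
  have 2: "ht z (fl v R0) (Sq (Cp (r+8) (r+7)) (Sq pc SEL)) S ?Q"
    if S: "?A S" "S (r+8) = ?T" for S
  proof (intro ht_Sq ht_Cp)
    let ?S' = "S(r+7 := S (r+8))"
    have A: "?A ?S'" using S by (auto simp: base_upd)
    show "ht z (fl v R0) pc ?S' (\<lambda>S. ht z (fl v R0)
       SEL S ?Q)"
    proof (rule ht_mono[OF pc])
      fix S1 assume a: "agree (r+8) ?S' S1"
      show "fl v R0 S1" using fl_agree[OF a A] by blast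
      assume "S1 (r+8) = (if chk (?S' (r+8)) then 1 else 0)"
      then show "ht z (fl v R0) SEL S1 ?Q"
        using fl_agree[OF a A] a S by (intro 3) (auto simp: agree_def)
    qed
  qed (use S in \<open>auto simp: base_upd\<close>)
  show ?thesis unfolding MB_def
  proof (intro ht_Sq ht_atoms)
    let ?R = "R(r+3 := Suc (R (r+3)), r+9 := R (r+1), r+10 := R (r+2))"
    have A: "?A ?R" using b by (auto simp: base_upd)
    show "ht z (fl v R0) (enc_prog (r+8)) (R(r+3 := Suc (R (r+3)), r+9 := (R(r+3 := Suc (R (r+3)))) (r+1),
        r+10 := (R(r+3 := Suc (R (r+3)), r+9 := (R(r+3 := Suc (R (r+3)))) (r+1))) (r+2)))
      (\<lambda>S. ht z (fl v R0) (Sq (Cp (r+8) (r+7)) (Sq pc SEL)) S ?Q)" (is "ht _ _ _ ?R' _")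
    proof (rule ht_mono[OF enc_prog[of "r+8", unfolded plus8, OF agree_refl]])
      have R': "?R' = ?R" by simp
      fix S1 assume a: "agree (r+8) ?R' S1"
      show "fl v R0 S1" using fl_agree[OF a[unfolded R'] A] by blast
      assume "S1 (r+8) = pr (?R' (r+9)) (?R' (r+10))"
      then have "S1 (r+8) = ?T" by simp
      then show "ht z (fl v R0) (Sq (Cp (r+8) (r+7)) (Sq pc SEL)) S1 ?Q"
        using fl_agree[OF a[unfolded R'] A] by (intro 2) auto
    qed
  qed (use b in \<open>auto simp: base_upd\<close>)
qed

lemma LB_back:
  assumes b: "fl v R0 R" "R (r+3) = 0" "v \<le> p1 (R (r+1))" "p1 (R (r+1)) \<noteq> 0"
  shows "ht z (fl v R0) LB R (\<lambda>R'. R' (r+3) = 1 \<and> R' (r+1) = p1 (R (r+1)) \<and> R' (r+2) = Suc (p2 (R (r+1))))"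
proof -
  let ?S = "R (r+1)"
  have S0: "?S \<noteq> 0" using b(4) by (metis p1_p2_0(1))
  let ?Q = "\<lambda>R'. R' (r+3) = 1 \<and> R' (r+1) = p1 ?S \<and> R' (r+2) = Suc (p2 ?S)"
  have 1: "ht z (fl v R0) POP S ?Q"
    if "fl v R0 S" "S (r+3) = 1" "S (r+1) = ?S" "S (r+9) = p1 ?S" "S (r+10) = p2 ?S" for S
    unfolding POP_def by (rule ht_IfE) (use that b in \<open>auto simp: base_upd base_def[of R0 S] intro!: ht_Sq ht_atoms\<close>)
  show ?thesis unfolding LB_def
  proof (intro ht_Sq ht_In ht_IfE ht_Cp)
    let ?R = "R(r+3 := Suc (R (r+3)), r+8 := (R(r+3 := Suc (R (r+3)))) (r+1))"
    have A: "fl v R0 ?R \<and> ?R (r+1) = ?S \<and> ?R (r+3) = 1" using b by (auto simp: base_upd)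
    show "ht z (fl v R0) (dec_prog (r+8)) ?R (\<lambda>S. ht z (fl v R0) POP S ?Q)"
    proof (rule ht_mono[OF dec_prog[of "r+8", unfolded plus8, OF agree_refl]])
      fix S1 assume a: "agree (Suc (r+8)) ?R S1"
      then have f: "fl v R0 S1" using base_agree[OF agree_mono[OF a, of "r+7"], of R0] A by (auto simp: agree_def)
      then show "fl v R0 S1" .
      assume "S1 (r+9) = p1 (?R (r+8)) \<and> S1 (r+10) = p2 (?R (r+8))"
      then show "ht z (fl v R0) POP S1 ?Q" using f a A by (intro 1) (auto simp: agree_def)
    qed
  qed (use b S0 in \<open>auto simp: base_upd base_def[of R0 R]\<close>)
qed

lemma LB_exit:
  assumes b: "base R0 R" "R (r+3) = 0" "p1 (R (r+1)) = 0"
  shows "ht z (agree r R0) LB R (\<lambda>R'. R' (r+4) = R' (r+5) \<and> R' r = (if R (r+1) = 0 then 0 else 1))"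
proof -
  let ?S = "R (r+1)"
  let ?Q = "\<lambda>R'. R' (r+4) = R' (r+5) \<and> R' r = (if R (r+1) = 0 then 0 else 1)"
  have 1: "ht z (agree r R0) POP S ?Q" if "base R0 S" "S (r+9) = 0" "?S \<noteq> 0" for S
    unfolding POP_def by (rule ht_IfE) (use that b in \<open>auto simp: base_def intro!: ht_Sq ht_atoms\<close>)
  show ?thesis unfolding LB_def
  proof (intro ht_Sq ht_In ht_IfE ht_Ze ht_Cp)
    let ?R = "R(r+3 := Suc (R (r+3)), r+8 := (R(r+3 := Suc (R (r+3)))) (r+1))"
    assume ne: "(R(r+3 := Suc (R (r+3)))) (r+1) \<noteq> (R(r+3 := Suc (R (r+3)))) (r+6)"
    have A: "base R0 ?R" using b by (auto simp: base_upd)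
    show "ht z (agree r R0) (dec_prog (r+8)) ?R (\<lambda>S. ht z (agree r R0) POP S ?Q)"
    proof (rule ht_mono[OF dec_prog[of "r+8", unfolded plus8, OF agree_refl]])
      fix S1 assume a: "agree (Suc (r+8)) ?R S1"
      then have f: "base R0 S1" using base_agree[OF agree_mono[OF a, of "r+7"], of R0] A by auto
      then show "agree r R0 S1" by (simp add: base_def)
      assume "S1 (r+9) = p1 (?R (r+8)) \<and> S1 (r+10) = p2 (?R (r+8))"
      then show "ht z (agree r R0) POP S1 ?Q" using f b ne by (intro 1) (auto simp: base_def)
    qed
  qed (use b in \<open>auto simp: base_def\<close>)
qed

section \<open>Transfinite runs of the search loop\<close>

definition st where "st R0 S q R \<longleftrightarrow> base R0 R \<and> R (r+1) = S \<and> R (r+2) = q \<and> R (r+3) = 1"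
definition don where "don R0 S R \<longleftrightarrow> base R0 R \<and> R (r+1) = S \<and> R (r+3) = 0"

context
  fixes P :: program and k :: nat and R0 :: regs
  assumes P: "placed P k (code LOOP k)"
begin

lemma lim_it:
  assumes b: "fl v R0 R" "R (r+3) = 0" "v \<le> p1 (R (r+1))" "p1 (R (r+1)) \<noteq> 0"
  shows "\<exists>R'. lp P k R0 v R R' \<and> fl v R0 R' \<and> R' (r+3) = 1 \<and> R' (r+1) = p1 (R (r+1)) \<and> R' (r+2) = Suc (p2 (R (r+1)))"
proof -
  have "ht z (fl v R0) BODY R (\<lambda>R'. R' (r+3) = 1 \<and> R' (r+1) = p1 (R (r+1)) \<and> R' (r+2) = Suc (p2 (R (r+1))))"
    unfolding BODY_def by (rule ht_IfE) (use b LB_back[OF b] in \<open>auto simp: base_def\<close>)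
  from loop_once[OF P[unfolded LOOP_def], of "fl v R0" R, OF b(1) _ this]
  obtain R' where R': "sg P z k (fl v R0) (k, R) (k, R')" "fl v R0 R'" "R' (r+3) = 1" "R' (r+1) = p1 (R (r+1))"
    "R' (r+2) = Suc (p2 (R (r+1)))" using b by (auto simp: base_def)
  have "lp P k R0 v R R'" using R'(1) b(2) unfolding lp_def sg_def by (metis snd_conv)
  then show ?thesis using R' by blast
qed

lemma exit_it:
  assumes b: "base R0 R" "R (r+3) = 0" "p1 (R (r+1)) = 0"
  shows "\<exists>R'. sg P z k (agree r R0) (k, R) (k + csz LOOP, R') \<and> agree r R0 R' \<and> R' r = (if R (r+1) = 0 then 0 else 1)"
proof -
  have "ht z (agree r R0) BODY R (\<lambda>R'. R' (r+4) = R' (r+5) \<and> R' r = (if R (r+1) = 0 then 0 else 1))"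
    unfolding BODY_def by (rule ht_IfE) (use b LB_exit[OF b] in \<open>auto simp: base_def\<close>)
  from loop_once[OF P[unfolded LOOP_def], of "agree r R0" R, OF _ _ this]
  obtain R' where R': "sg P z k (agree r R0) (k, R) (k, R')" "agree r R0 R'" "R' (r+4) = R' (r+5)"
    "R' r = (if R (r+1) = 0 then 0 else 1)" using b by (auto simp: base_def)
  have "sg P z k (agree r R0) (k, R') (k + csz LOOP, R')"
    unfolding LOOP_def by (rule loop_exit[where I = "agree r R0", OF P[unfolded LOOP_def] R'(2,3)])
  from sg_trans[OF R'(1) this] show ?thesis using R' by blast
qed

text \<open>The flag is cleared inside this pass, and \<open>lp\<close> needs that configuration as
  a witness, which a Hoare triple for \<open>BODY\<close> would hide. So the pass is assembled by
  hand: loop test at \<open>k\<close>, flag test at \<open>k+1\<close>, clearing at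
  \<open>k+2\<close>, \<open>MB\<close> from \<open>k+3\<close>.\<close>

lemma main_it:
  assumes b: "fl v R0 R" "R (r+3) = 1"
  shows "\<exists>R'. lp P k R0 v R R' \<and> fl v R0 R' \<and> R' (r+3) = 1 \<and> (if chk (pr (R (r+1)) (R (r+2)))
     then R' (r+1) = pr (R (r+1)) (R (r+2)) \<and> R' (r+2) = 1 else R' (r+1) = R (r+1) \<and> R' (r+2) = Suc (R (r+2)))"
proof -
  let ?R = "R(r+3 := 0)"
  have f: "fl v R0 ?R" using b by (simp add: base_upd)
  note pl = P[unfolded LOOP_def BODY_def, simplified]
  have "placed P (k+3) (code MB (k+3))" using pl by (simp add: numeral_3_eq_3)
  moreover have e: "?R (r+1) = R (r+1)" "?R (r+2) = R (r+2)" "?R (r+3) = 0" by simp_all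
  ultimately obtain R' where R': "sg P z (k+3) (fl v R0) (k+3, ?R) (k+3+csz MB, R')" "fl v R0 R'" "R' (r+3) = 1"
    "if chk (pr (R (r+1)) (R (r+2)))
     then R' (r+1) = pr (R (r+1)) (R (r+2)) \<and> R' (r+2) = 1 else R' (r+1) = R (r+1) \<and> R' (r+2) = Suc (R (r+2))"
    using MB_ht[OF f e(3), unfolded e ht_def] by blast
  have 1: "sg P z k (fl v R0) (k, R) (k+1, R)" by (rule sg_step) (use pl b in \<open>auto simp: base_def\<close>)
  have 2: "sg P z k (fl v R0) (k+1, R) (k+2, R)" by (rule sg_step) (use pl b in \<open>auto simp: base_def\<close>)
  have 3: "sg P z k (fl v R0) (k+2, R) (k+3, ?R)" by (rule sg_step) (use pl b in auto)
  have 4: "sg P z k (fl v R0) (k+3+csz MB, R') (k+1+csz BODY, R')"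
    by (rule sg_step) (use pl R'(2) in \<open>auto simp: BODY_def numeral_3_eq_3\<close>)
  have 5: "sg P z k (fl v R0) (k+1+csz BODY, R') (k, R')"
    by (rule sg_step) (use P R'(2) in \<open>auto simp: LOOP_def\<close>)
  obtain V1 where V1: "seg P z (k, R) V1 (k+3, ?R)" "(k, R) \<in> V1" "\<forall>u \<in> V1. k \<le> fst u \<and> fl v R0 (snd u)"
    using sg_trans[OF sg_trans[OF 1 2] 3] unfolding sg_def by blast
  obtain V2 where V2: "seg P z (k+3, ?R) V2 (k+3+csz MB, R')" "(k+3, ?R) \<in> V2" "\<forall>u \<in> V2. k+3 \<le> fst u \<and> fl v R0 (snd u)"
    using R'(1) unfolding sg_def by blast
  obtain V3 where V3: "seg P z (k+3+csz MB, R') V3 (k, R')" "\<forall>u \<in> V3. k \<le> fst u \<and> fl v R0 (snd u)"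
    using sg_trans[OF 4 5] unfolding sg_def by blast
  have "lp P k R0 v R R'" unfolding lp_def
  proof (intro exI conjI)
    show "seg P z (k, R) (V1 \<union> V2 \<union> V3) (k, R')" using seg_trans[OF seg_trans[OF V1(1) V2(1)] V3(1)] .
    show "\<forall>u \<in> V1 \<union> V2 \<union> V3. k \<le> fst u \<and> fl v R0 (snd u)" using V1(3) V2(3) V3(2) by fastforce
    show "\<exists>u \<in> V1 \<union> V2 \<union> V3. snd u (r+3) = 0" using V2(2) by (intro bexI[of _ "(k+3, ?R)"]) auto
  qed (use V1 in auto)
  then show ?thesis using R' by blast
qed

text \<open>Two uses: returning to the same stack \<open>w\<close> infinitely often leaves it in
  place, while floors that tend to infinity make the stack register overflow to 0. The flag is 0 in
  either case because each piece clears it.\<close>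

lemma lp_lim:
  assumes l: "!!n. lp P k R0 (v n) (Rs n) (Rs (Suc n))" and w: "!!n. w \<le> v n"
  shows "\<exists>R'. lp P k R0 w (Rs 0) R' \<and> base R0 R' \<and> R' (r+3) = 0 \<and>
     ((\<forall>n. v n = w \<and> Rs n (r+1) = w) --> R' (r+1) = w) \<and> ((\<forall>n. n \<le> v n) --> R' (r+1) = 0)"
proof -
  obtain V where V: "!!n. seg P z (k, Rs n) (V n) (k, Rs (Suc n))" "!!n. (k, Rs n) \<in> V n"
    "!!n u. u \<in> V n ==> k \<le> fst u \<and> fl (v n) R0 (snd u)" "!!n. \<exists>u \<in> V n. snd u (r+3) = 0"
    using l unfolding lp_def by metis
  have ne: "V n \<noteq> {}" for n using V(2) by blast
  define R' where "R' i = (SOME x. islim V (\<lambda>u. snd u i) x)" for i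
  have R': "islim V (\<lambda>u. snd u i) (R' i)" for i unfolding R'_def by (rule someI_ex[OF islim_ex[OF ne]])
  have line: "islim V fst k" unfolding islim_def
    using V(2,3) by (metis fst_conv order_refl)
  have const: "R' i = c" if "!!n u. u \<in> V n ==> snd u i = c" for i c
  proof -
    have "\<not> (\<forall>B. \<exists>k. \<forall>n \<ge> k. \<forall>u \<in> V n. B \<le> snd u i)" using that V(2) by (metis Suc_n_not_le_n order_refl)
    then show ?thesis using R'[of i] that unfolding islim_def by (metis order_refl)
  qed
  have low: "R' i = c" if "!!n u. u \<in> V n ==> c \<le> snd u i" "!!n. \<exists>u \<in> V n. snd u i = c" for i c
  proof -
    have "\<not> (\<forall>B. \<exists>k. \<forall>n \<ge> k. \<forall>u \<in> V n. B \<le> snd u i)" using that(2) by (metis Suc_n_not_le_n order_refl)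
    then obtain m where m: "!!n u. m \<le> n ==> u \<in> V n ==> R' i \<le> snd u i" and a: "\<exists>n. \<exists>u \<in> V n. snd u i = R' i"
      using R'[of i] unfolding islim_def by blast
    have "R' i \<le> c" using m[of m] that(2)[of m] by auto
    then show ?thesis using a that(1) by (metis order_antisym)
  qed
  have base: "base R0 R'" unfolding base_def agree_def
    using V(3) by (intro conjI allI impI const) (auto simp: base_def agree_def)
  have f0: "R' (r+3) = 0" by (rule low) (use V(4) in auto)
  have fin: "R' (r+1) = w" if a: "\<forall>n. v n = w \<and> Rs n (r+1) = w"
  proof (rule low)
    show "u \<in> V n ==> w \<le> snd u (r+1)" for n u using V(3)[of u n] a by simp
    show "\<exists>u \<in> V n. snd u (r+1) = w" for n using V(2)[of n] a by (metis snd_conv)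
  qed
  have inf: "R' (r+1) = 0" if a: "\<forall>n. n \<le> v n"
  proof -
    have "B \<le> snd u (r+1)" if "B \<le> n" "u \<in> V n" for B n u
      using V(3)[OF that(2)] a that(1) by (meson order_trans)
    then have big: "\<forall>B. \<exists>k. \<forall>n \<ge> k. \<forall>u \<in> V n. B \<le> snd u (r+1)" by blast
    have "\<not> (\<forall>k. \<exists>n \<ge> k. \<exists>u \<in> V n. snd u (r+1) = R' (r+1))"
      using big by (metis Suc_n_not_le_n)
    then show ?thesis using R'[of "r+1"] unfolding islim_def by blast
  qed
  have "seg P z (k, Rs 0) (\<Union>n. V n) (k, R')"
    using seg_lim[of P z "\<lambda>n. (k, Rs n)" V "(k, R')"] V(1) ne line R' by simp
  moreover have "\<forall>u \<in> (\<Union>n. V n). k \<le> fst u \<and> fl w R0 (snd u)" using V(3) w by (meson UN_E order_trans)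
  ultimately have "lp P k R0 w (Rs 0) R'" unfolding lp_def using V(2,4) by (metis UN_I UNIV_I)
  then show ?thesis using base f0 fin inf by blast
qed

lemma child_step:
  assumes S: "S \<noteq> 0" and R: "st R0 S q R"
    and c: "!!R. chk (pr S q) ==> st R0 (pr S q) 1 R ==> \<exists>R'. lp P k R0 (pr S q) R R' \<and> don R0 (pr S q) R'"
  shows "\<exists>R'. lp P k R0 S R R' \<and> st R0 S (Suc q) R'"
proof -
  have s: "base R0 R" "R (r+1) = S" "R (r+2) = q" "R (r+3) = 1" using R by (simp_all add: st_def)
  obtain R1 where R1: "lp P k R0 S R R1" "fl S R0 R1" "R1 (r+3) = 1" "if chk (pr S q)
     then R1 (r+1) = pr S q \<and> R1 (r+2) = 1 else R1 (r+1) = S \<and> R1 (r+2) = Suc q"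
    using main_it[of R S, unfolded s] s(1) order_refl by blast
  show ?thesis
  proof (cases "chk (pr S q)")
    case False then show ?thesis using R1 by (auto simp: st_def)
  next
    case True
    then have "st R0 (pr S q) 1 R1" using R1 by (simp add: st_def)
    then obtain R2 where R2: "lp P k R0 (pr S q) R1 R2" "don R0 (pr S q) R2" using c True by blast
    have le: "S \<le> pr S q" by (rule le_prod_encode_1)
    obtain R3 where R3: "lp P k R0 S R2 R3" "fl S R0 R3" "R3 (r+3) = 1" "R3 (r+1) = S" "R3 (r+2) = Suc q"
      using lim_it[of R2 S] R2(2) le S by (auto simp: don_def)
    have "lp P k R0 S R R3" using lp_trans[OF lp_trans[OF R1(1) lp_mono[OF R2(1) le]] R3(1)] .
    then show ?thesis using R3 by (auto simp: st_def)
  qed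
qed

text \<open>Every number \<open>q \<ge> 1\<close> is tried as a child, so even a leaf takes
  infinitely many passes and is left at a limit, where the flag tells that its subtree is
  done.\<close>

lemma explore_ok: "ok chk S ==> S \<noteq> 0 ==> st R0 S 1 R ==> \<exists>R'. lp P k R0 S R R' \<and> don R0 S R'"
proof (induction arbitrary: R rule: ok.induct)
  case (ok_intro S)
  have "\<exists>R'. st R0 S (Suc (Suc n)) R' \<and> lp P k R0 S R R'" if "st R0 S (Suc n) R" for n R
  proof -
    have "pr S (Suc n) \<noteq> 0" using le_prod_encode_2[of "Suc n" S] by linarith
    then show ?thesis using child_step[OF ok_intro.prems(1) that] ok_intro.IH[of "Suc n"] by auto
  qed
  then obtain Rs where Rs: "!!n. st R0 S (Suc n) (Rs n)" "Rs 0 = R" "!!n. lp P k R0 S (Rs n) (Rs (Suc n))"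
    using dependent_nat_choice[of "\<lambda>n R'. st R0 S (Suc n) R' \<and> (n = 0 --> R' = R)" "\<lambda>n R R'. lp P k R0 S R R'"]
      ok_intro.prems(2) by (metis One_nat_def nat.distinct(1))
  from lp_lim[of "\<lambda>_. S" Rs S, OF Rs(3) order_refl] show ?case using Rs(1,2) by (auto simp: st_def don_def)
qed

text \<open>The children before the least bad one fail the test or are explored completely, so the
  search does reach the bad child and descends into it.\<close>

lemma explore_bad:
  assumes bad: "\<not> ok chk S" and S: "S \<noteq> 0" and R: "st R0 S 1 R"
  shows "\<exists>q R'. \<not> ok chk (pr S q) \<and> S < pr S q \<and> lp P k R0 S R R' \<and> st R0 (pr S q) 1 R'"
proof -
  let ?B = "\<lambda>n. chk (pr S (Suc n)) \<and> \<not> ok chk (pr S (Suc n))"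
  have ex: "\<exists>n. ?B n" using ok_intro[of chk S] bad by (metis Suc_le_D One_nat_def)
  define m where "m = (LEAST n. ?B n)"
  have m: "?B m" "!!n. n < m ==> \<not> ?B n" unfolding m_def using LeastI_ex[OF ex] not_less_Least by blast+
  have ne: "pr S (Suc n) \<noteq> 0" for n using le_prod_encode_2[of "Suc n" S] by linarith
  have "n \<le> m ==> \<exists>R'. (R' = R \<or> lp P k R0 S R R') \<and> st R0 S (Suc n) R'" for n
  proof (induction n)
    case 0 then show ?case using R by auto
  next
    case (Suc n)
    then obtain R1 where R1: "R1 = R \<or> lp P k R0 S R R1" "st R0 S (Suc n) R1" by auto
    obtain R2 where R2: "lp P k R0 S R1 R2" "st R0 S (Suc (Suc n)) R2"
      using child_step[OF S R1(2)] explore_ok[OF _ ne] m(2)[of n] Suc.prems by (metis Suc_le_eq)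
    then show ?case using R1(1) lp_trans[of P k R0 S R R1 R2] by auto
  qed
  then obtain R1 where R1: "R1 = R \<or> lp P k R0 S R R1" "st R0 S (Suc m) R1" by blast
  obtain R2 where R2: "lp P k R0 S R1 R2" "fl S R0 R2" "R2 (r+3) = 1" "R2 (r+1) = pr S (Suc m)" "R2 (r+2) = 1"
    using main_it[of R1 S] R1(2) m(1) by (auto simp: st_def)
  have "S < pr S (Suc m)" using p1_less[of "pr S (Suc m)"] ne[of m] by simp
  then show ?thesis using R1(1) R2 m(1) lp_trans by (intro exI[of _ "Suc m"] exI[of _ R2]) (auto simp: st_def)
qed

text \<open>Descending from bad child to bad child makes the stack codes increase strictly, so stage
  \<open>n\<close> never falls below \<open>n\<close> and the stack register overflows.\<close>

lemma explore_infinite: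
  assumes "\<not> ok chk S" "S \<noteq> 0" "st R0 S 1 R"
  shows "\<exists>R'. lp P k R0 0 R R' \<and> don R0 0 R'"
proof -
  let ?P = "\<lambda>n R'. (\<exists>S. \<not> ok chk S \<and> n < S \<and> st R0 S 1 R') \<and> (n = 0 --> R' = R)"
  have "\<exists>Rs. \<forall>n. ?P n (Rs n) \<and> lp P k R0 n (Rs n) (Rs (Suc n))"
  proof (rule dependent_nat_choice)
    show "\<exists>R'. ?P 0 R'" using assms by auto
    fix R1 n assume "?P n R1"
    then obtain S where S: "\<not> ok chk S" "n < S" "st R0 S 1 R1" by blast
    then obtain q R2 where R2: "\<not> ok chk (pr S q)" "S < pr S q" "lp P k R0 S R1 R2" "st R0 (pr S q) 1 R2"
      using explore_bad[of S R1] by auto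
    then have "Suc n < pr S q" using S(2) by simp
    moreover have "lp P k R0 n R1 R2" using lp_mono[OF R2(3)] S(2) by simp
    ultimately show "\<exists>R2. ?P (Suc n) R2 \<and> lp P k R0 n R1 R2" using R2 by blast
  qed
  then obtain Rs where Rs: "!!n. lp P k R0 n (Rs n) (Rs (Suc n))" "Rs 0 = R" by blast
  from lp_lim[of "\<lambda>n. n" Rs 0, OF Rs(1)] show ?thesis using Rs(2) by (auto simp: don_def)
qed

lemma loop_result:
  assumes "st R0 S 1 R" "S \<noteq> 0" "p1 S = 0"
  shows "\<exists>R'. sg P z k (agree r R0) (k, R) (k + csz LOOP, R') \<and> agree r R0 R' \<and> R' r = (if ok chk S then 1 else 0)"
proof (cases "ok chk S")
  case True
  then obtain R1 where R1: "lp P k R0 S R R1" "don R0 S R1" using explore_ok assms by blast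
  then show ?thesis using exit_it[of R1] assms True sg_trans[OF lp_sg[OF R1(1)]] by (auto simp: don_def)
next
  case False
  then obtain R1 where R1: "lp P k R0 0 R R1" "don R0 0 R1" using explore_infinite assms by blast
  then show ?thesis using exit_it[of R1] False sg_trans[OF lp_sg[OF R1(1)]] by (auto simp: don_def)
qed

end

lemma LOOP_ht:
  assumes "base R0 R" "R (r+1) = S" "S \<noteq> 0" "p1 S = 0" "R (r+2) = 1" "R (r+3) = 1"
  shows "ht z (agree r R0) LOOP R (\<lambda>R'. R' r = (if ok chk S then 1 else 0))"
  unfolding ht_def
proof (intro allI impI)
  fix P k assume "placed P k (code LOOP k)"
  moreover have "st R0 S 1 R" using assms by (simp add: st_def)
  ultimately show "\<exists>R'. sg P z k (agree r R0) (k, R) (k + csz LOOP, R') \<and> agree r R0 R' \<and> R' r = (if ok chk S then 1 else 0)"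
    using assms(3,4) by (rule loop_result)
qed

end

section \<open>Every predicate of the class is decidable\<close>

text \<open>Predecessor by iteration: the pair remembers the previous value beside the current one,
  starting from \<open>0 = pr 0 0\<close>.\<close>

lemma pred_funpow: "p1 (((\<lambda>w. pr (p2 w) (Suc (p2 w))) ^^ n) 0) = n - 1"
proof -
  have "((\<lambda>w. pr (p2 w) (Suc (p2 w))) ^^ n) 0 = (if n = 0 then 0 else pr (n - 1) n)" by (induction n) auto
  then show ?thesis by simp
qed

lemma Fn_pred: "Fn f ==> Fn (\<lambda>n. f n - 1)"
  unfolding pred_funpow[symmetric] by (intro Fnc Fn_funpow)

lemma Fn_minus: "Fn f ==> Fn g ==> Fn (\<lambda>n. f n - g n)"
proof -
  have *: "((\<lambda>w. w - 1) ^^ b) a = a - b" for a b :: nat by (induction b) auto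
  assume "Fn f" "Fn g"
  from Fn_funpow[OF Fn_pred[OF Fn_id] this(2,1)] show ?thesis by (simp only: *)
qed

text \<open>A stack is \<open>pr S (Suc (pr i v))\<close> with \<open>S\<close> the stack below, \<open>v\<close> the top entry and \<open>i\<close> its
height. An element fails to lie in \<open>W R\<close> iff there is \<open>h\<close> starting with it such that
\<open>R (h j) b (h (Suc (pr j b)))\<close> for all \<open>j\<close>, \<open>b\<close>; the stacks are the finite initial parts of such \<open>h\<close>.\<close>

definition ix :: "nat => nat" where "ix T = p1 (p2 T - 1)"
definition vl :: "nat => nat" where "vl T = p2 (p2 T - 1)"
definition rt :: "nat => nat" where "rt a = pr 0 (Suc (pr 0 a))"

text \<open>If the stack below has height \<open>pr j b\<close>, popping it
  \<open>pr j b - j\<close> times uncovers the entry at height \<open>j\<close>, for which the new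
  top must be a premise at index \<open>b\<close>.\<close>

definition lnk :: "nat => nat" where
  "lnk T = pr (vl ((p1 ^^ (ix (p1 T) - p1 (ix (p1 T)))) (p1 T))) (pr (p2 (ix (p1 T))) (vl T))"

definition chk :: "(nat => nat => nat => bool) => nat => bool" where
  "chk R T \<longleftrightarrow> ix T = Suc (ix (p1 T)) \<and> R (p1 (lnk T)) (p1 (p2 (lnk T))) (p2 (p2 (lnk T)))"

text \<open>A stack none of whose entries is in \<open>W R\<close> can always be prolonged by
  another such entry, so a well-founded stack has an entry in \<open>W R\<close>. Conversely, the
  entries of an infinite branch refute every index for every entry, so no member of
  \<open>W R\<close> occurs among them.\<close>

lemma ok_W: "ok (chk R) (rt a) \<longleftrightarrow> W R a"
proof
  have "ok (chk R) S ==> \<exists>i \<le> ix S. W R (vl ((p1 ^^ i) S))" for S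
  proof (induction rule: ok.induct)
    case (ok_intro S)
    show ?case
    proof (rule ccontr)
      assume n: "\<not> ?thesis"
      let ?n = "ix S"
      let ?x = "vl ((p1 ^^ (?n - p1 ?n)) S)"
      have "\<not> W R ?x" using n by simp
      then obtain c where c: "R ?x (p2 ?n) c" "\<not> W R c" using W_intro[where R = R and a = ?x] by metis
      let ?T = "pr S (Suc (pr (Suc ?n) c))"
      have "chk R ?T" using c(1) by (simp add: chk_def lnk_def ix_def vl_def)
      then obtain i where i: "i \<le> ix ?T" "W R (vl ((p1 ^^ i) ?T))" using ok_intro.IH[of "Suc (pr (Suc ?n) c)"] by auto
      show False
      proof (cases i)
        case 0 then show ?thesis using i c(2) by (simp add: vl_def)
      next
        case (Suc i')
        then have "i' \<le> ?n" "W R (vl ((p1 ^^ i') S))" using i by (simp_all add: ix_def funpow_swap1)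
        then show ?thesis using n by blast
      qed
    qed
  qed
  from this[of "rt a"] show "ok (chk R) (rt a) ==> W R a" by (auto simp: rt_def ix_def vl_def)
next
  assume w: "W R a"
  show "ok (chk R) (rt a)"
  proof (rule ccontr)
    assume n: "\<not> ok (chk R) (rt a)"
    have "\<exists>T. \<forall>n. (\<not> ok (chk R) (T n) \<and> ix (T n) = n \<and> (n = 0 --> T n = rt a)) \<and>
        (chk R (T (Suc n)) \<and> p1 (T (Suc n)) = T n)"
    proof (rule dependent_nat_choice)
      show "\<exists>T. \<not> ok (chk R) T \<and> ix T = 0 \<and> (0 = 0 --> T = rt a)" using n by (simp add: rt_def ix_def)
      fix T n assume "\<not> ok (chk R) T \<and> ix T = n \<and> (n = 0 --> T = rt a)"
      then obtain q where q: "chk R (pr T q)" "\<not> ok (chk R) (pr T q)" and i: "ix T = n" using ok_intro[of "chk R" T] by blast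
      have "ix (pr T q) = Suc n" using q(1) i by (simp add: chk_def)
      then show "\<exists>T'. (\<not> ok (chk R) T' \<and> ix T' = Suc n \<and> (Suc n = 0 --> T' = rt a)) \<and> (chk R T' \<and> p1 T' = T)"
        using q by (intro exI[of _ "pr T q"]) auto
    qed
    then obtain T where T: "!!n. ix (T n) = n" "T 0 = rt a" "!!n. chk R (T (Suc n))" "!!n. p1 (T (Suc n)) = T n" by blast
    have pop: "(p1 ^^ i) (T (i + n)) = T n" for i n by (induction i) (simp_all add: T(4) funpow_swap1)
    have pop': "(p1 ^^ (n - j)) (T n) = T j" if "j \<le> n" for n j using pop[of "n - j" j] that by simp
    have R: "R (vl (T j)) b (vl (T (Suc (pr j b))))" for j b
    proof -
      have "(p1 ^^ (pr j b - j)) (T (pr j b)) = T j" by (rule pop') (rule le_prod_encode_1)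
      then show ?thesis using T(3)[of "pr j b"] by (simp add: chk_def lnk_def T(1,4))
    qed
    have "W R v ==> \<forall>j. v \<noteq> vl (T j)" for v
      by (induction rule: W.induct) (use R in blast)
    from this[OF w] have "a \<noteq> vl (T 0)" by blast
    then show False by (simp add: T(2) rt_def vl_def)
  qed
qed

definition cprog :: "(nat set => nat => bool) => nat => com => bool" where
  "cprog p r c \<longleftrightarrow> (\<forall>z R. ht z (agree r R) c R (\<lambda>R'. R' r = (if p z (R r) then 1 else 0)))"

lemma cprog_ht:
  "cprog p t c ==> agree r R S ==> r \<le> t ==>
    (!!S'. agree t S S' ==> S' t = (if p z (S t) then 1 else 0) ==> Q S') ==> ht z (agree r R) c S Q"
  unfolding cprog_def by (rule ht_sub[of z t S c "\<lambda>R'. R' t = (if p z (S t) then 1 else 0)"]) auto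

definition computes :: "(nat set => nat => bool) => bool" where
  "computes p \<longleftrightarrow> (\<forall>r. \<exists>c. cprog p r c)"

lemma computes_orc: assumes "Fn f" shows "computes (\<lambda>z n. f n \<in> z)"
  unfolding computes_def
proof
  fix r obtain c where c: "fprog f r c" using Fn_prog[OF assms] by blast
  show "\<exists>c. cprog (\<lambda>z n. f n \<in> z) r c" unfolding cprog_def
    by (intro exI[of _ "Sq c (IfO r (Sq (Ze r) (In r)) (Ze r))"] allI ht_Sq fprog_ht[OF c] ht_IfO ht_atoms)
       (auto simp: agree_def)
qed

lemma computes_eq: assumes "Fn f" "Fn g" shows "computes (\<lambda>z n. f n = g n)"
  unfolding computes_def
proof
  fix r obtain c where c: "fprog f (r+1) c" using Fn_prog[OF assms(1)] by blast
  obtain d where d: "fprog g (r+2) d" using Fn_prog[OF assms(2)] by blast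
  show "\<exists>c. cprog (\<lambda>z n. f n = g n) r c" unfolding cprog_def
    by (intro exI[of _ "Sq (Cp r (r+1)) (Sq c (Sq (Cp r (r+2)) (Sq d (IfE (r+1) (r+2) (Sq (Ze r) (In r)) (Ze r)))))"]
        allI ht_Sq fprog_ht[OF c] fprog_ht[OF d] ht_IfE ht_atoms) (auto simp: agree_def)
qed

lemma computes_neg: assumes "computes p" shows "computes (\<lambda>z n. \<not> p z n)"
  unfolding computes_def
proof
  fix r obtain c where c: "cprog p r c" using assms unfolding computes_def by blast
  show "\<exists>c. cprog (\<lambda>z n. \<not> p z n) r c" unfolding cprog_def
    by (intro exI[of _ "Sq c (Sq (Ze (r+1)) (IfE r (r+1) (Sq (Ze r) (In r)) (Ze r)))"]
        allI ht_Sq cprog_ht[OF c] ht_IfE ht_atoms) (auto simp: agree_def split: if_splits)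
qed

lemma computes_conj: assumes "computes p" "computes q" shows "computes (\<lambda>z n. p z n \<and> q z n)"
  unfolding computes_def
proof
  fix r obtain c where c: "cprog p (r+1) c" using assms(1) unfolding computes_def by blast
  obtain d where d: "cprog q (r+2) d" using assms(2) unfolding computes_def by blast
  show "\<exists>c. cprog (\<lambda>z n. p z n \<and> q z n) r c" unfolding cprog_def
    by (intro exI[of _ "Sq (Cp r (r+1)) (Sq c (Sq (Cp r (r+2)) (Sq d (Sq (Ze (r+3))
           (IfE (r+1) (r+3) (Ze r) (IfE (r+2) (r+3) (Ze r) (Sq (Ze r) (In r))))))))"]
        allI ht_Sq cprog_ht[OF c] cprog_ht[OF d] ht_IfE ht_atoms) (auto simp: agree_def split: if_splits)
qed

lemma computes_sub: assumes "computes p" "Fn f" shows "computes (\<lambda>z n. p z (f n))"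
  unfolding computes_def
proof
  fix r obtain c where c: "cprog p r c" using assms(1) unfolding computes_def by blast
  obtain d where d: "fprog f r d" using Fn_prog[OF assms(2)] by blast
  show "\<exists>c. cprog (\<lambda>z n. p z (f n)) r c" unfolding cprog_def
    by (intro exI[of _ "Sq d c"] allI ht_Sq fprog_ht[OF d] cprog_ht[OF c]) (auto simp: agree_def)
qed

lemma computes_W:
  assumes "computes (\<lambda>z n. R z (p1 n) (p1 (p2 n)) (p2 (p2 n)))" shows "computes (\<lambda>z n. W (R z) n)"
  unfolding computes_def
proof
  fix r
  have Fix: "Fn ix" and Fvl: "Fn vl" and Frt: "Fn rt" unfolding ix_def vl_def rt_def by (intro Fnc Fn_pred)+
  have Fc: "Fn f ==> Fn (\<lambda>n. ix (f n))" "Fn f ==> Fn (\<lambda>n. vl (f n))" for f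
    using Fn_comp[OF Fix] Fn_comp[OF Fvl] by blast+
  have "Fn lnk" unfolding lnk_def by (intro Fnc Fn_minus Fn_funpow Fc)
  then have "computes (\<lambda>z. chk (R z))"
    unfolding chk_def by (intro computes_conj computes_eq computes_sub[OF assms] Fnc Fc)
  then obtain pc where pc: "cprog (\<lambda>z. chk (R z)) (r+8) pc" unfolding computes_def by blast
  obtain rc where rc: "fprog rt (r+8) rc" using Fn_prog[OF Frt] by blast
  let ?L = "dfs.LOOP r pc"
  have "ht z (agree r R0) (Sq (Cp r (r+8)) (Sq rc (Sq (Cp (r+8) (r+1)) (Sq (Ze (r+2)) (Sq (In (r+2)) (Sq (Ze (r+3))
     (Sq (In (r+3)) (Sq (Ze (r+4)) (Sq (Ze (r+5)) (Sq (In (r+5)) (Sq (Ze (r+6)) ?L))))))))))) R0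
     (\<lambda>R'. R' r = (if W (R z) (R0 r) then 1 else 0))" for z R0
  proof -
    interpret dfs z r "chk (R z)" pc by unfold_locales (use pc in \<open>simp add: cprog_def\<close>)
    have L: "ht z (agree r R0) LOOP S (\<lambda>R'. R' r = (if W (R z) (R0 r) then 1 else 0))"
      if "base R0 S" "S (r+1) = rt (R0 r)" "S (r+2) = 1" "S (r+3) = 1" for S
    proof -
      have "rt (R0 r) \<noteq> 0" using le_prod_encode_2[of "Suc (pr 0 (R0 r))" 0] by (simp add: rt_def)
      moreover have "p1 (rt (R0 r)) = 0" by (simp add: rt_def)
      ultimately show ?thesis using LOOP_ht[of R0 S "rt (R0 r)"] that by (simp add: ok_W)
    qed
    show ?thesis
      by (intro ht_Sq fprog_ht[OF rc] ht_atoms L) (auto simp: agree_def base_def)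
  qed
  then show "\<exists>c. cprog (\<lambda>z n. W (R z) n) r c" unfolding cprog_def by blast
qed

lemma C_computes: "C p ==> computes p"
proof (induction rule: C.induct)
  case (C_orc f) then show ?case by (rule computes_orc)
next
  case (C_eq f g) then show ?case by (rule computes_eq)
next
  case (C_neg p) show ?case by (rule computes_neg) (rule C_neg.IH)
next
  case (C_conj p q) show ?case by (rule computes_conj) (rule C_conj.IH)+
next
  case (C_sub p f) show ?case by (rule computes_sub) (rule C_sub.IH C_sub.hyps)+
next
  case (C_W R) show ?case by (rule computes_W) (rule C_W.IH)
qed

theorem C_halts:
  assumes "C p" obtains P where "!!z i. halts_with P z i (if p z i then 1 else 0)"
proof -
  obtain c where c: "cprog p 0 c" using C_computes[OF assms] unfolding computes_def by blast
  have "halts_with (code c 0) z i (if p z i then 1 else 0)" for z i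
  proof -
    have "placed (code c 0) 0 (code c 0)" by (simp add: placed_def)
    then obtain R' V where "seg (code c 0) z (0, (\<lambda>r. 0)(0 := i)) V (csz c, R')" "R' 0 = (if p z i then 1 else 0)"
      using c unfolding cprog_def ht_def sg_def by (metis add_0 fun_upd_same)
    then show ?thesis by (intro seg_halts) auto
  qed
  with that show ?thesis by blast
qed

theorem mainTheorem5:
  fixes x y :: "nat set"
  assumes "itrm_recognizable x"
    and "itrm_c_random y"
    and "itrm_reducible x y"
  shows "itrm_computable x"
proof -
  obtain Q where Q: "!!w. halts_with Q w 0 (if w \<in> {x} then 1 else 0)"
    using assms(1) unfolding itrm_recognizable_def itrm_decidable_def by blast
  obtain P where P: "!!i. halts_with P y i (if i \<in> x then 1 else 0)"
    using assms(3) unfolding itrm_reducible_def by blast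
  define p where "p z i = Hp P z i 1" for z i
  define A where "A z n = Hp Q {i. p z i} 0 1" for z and n :: nat
  have Cp: "C p" unfolding p_def by (intro C_Hp Fnc)
  have CA: "C A" unfolding A_def by (rule C_oracle_sub[OF _ Cp, of "\<lambda>z n. Hp Q z 0 1"]) (intro C_Hp Fnc)
  \<comment> \<open>Exact because \<open>Q\<close> halts on every oracle, whatever real
    \<open>p\<close> extracts from \<open>z\<close>.\<close>
  have A: "A z n \<longleftrightarrow> {i. p z i} = x" for z n
  proof -
    have "Hp Q w 0 1 \<longleftrightarrow> w = x" for w
      using halts_Hp[OF Q[of w]] Hp_unique[of Q w 0] by (cases "w = x") auto
    then show ?thesis by (simp add: A_def)
  qed
  have "p y i \<longleftrightarrow> i \<in> x" for i
    using halts_Hp[OF P[of i]] Hp_unique[of P y i] by (cases "i \<in> x") (auto simp: p_def)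
  then have y: "A y 0" by (simp add: A)
  obtain D where "!!z i. halts_with D z i (if A z i then 1 else 0)" using C_halts[OF CA] by blast
  then have "itrm_decidable {z. A z 0}" unfolding itrm_decidable_def by (intro exI[of _ D]) simp
  then have nm: "\<not> meager {z. A z 0}" using assms(2) y unfolding itrm_c_random_def by blast
  have dec: "decisive A" using C_force[OF CA] by blast
  have "\<exists>s. force A s 0"
  proof (rule ccontr)
    assume "\<not> ?thesis"
    \<comment> \<open>Condition 0 has length 0, so its cylinder contains all reals.\<close>
    then have "force (\<lambda>z n. \<not> A z n) 0 0" unfolding force_neg[OF dec] by blast
    then show False using nm by (simp add: force_def cy_def)
  qed
  then obtain s where s: "force A s 0" by blast
  \<comment> \<open>On a comeager part of \<open>cy s\<close> the real extracted by \<open>p\<close>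
    is \<open>x\<close>, so \<open>s\<close> decides each of its bits as \<open>x\<close>
    does.\<close>
  have x: "force p s i \<longleftrightarrow> i \<in> x" for i
  proof
    assume "i \<in> x"
    then have "{z \<in> cy s. \<not> p z i} \<subseteq> {z \<in> cy s. \<not> A z 0}" by (auto simp: A)
    with s show "force p s i" unfolding force_def by (rule meager_subset)
  next
    assume f: "force p s i"
    show "i \<in> x"
    proof (rule ccontr)
      assume "i \<notin> x"
      then have "cy s \<subseteq> {z \<in> cy s. \<not> A z 0} \<union> {z \<in> cy s. \<not> p z i}" by (auto simp: A)
      moreover have "meager ({z \<in> cy s. \<not> A z 0} \<union> {z \<in> cy s. \<not> p z i})"
        using s f unfolding force_def by (rule meager_Un)
      ultimately show False using baire meager_subset by blast
    qed
  qed
  have "C (\<lambda>_ n. force p s n)" by (rule C_app2[OF conjunct2[OF C_force[OF Cp]]]) (intro Fnc)+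
  then obtain E where "!!z i. halts_with E z i (if force p s i then 1 else 0)" using C_halts by blast
  then show ?thesis unfolding itrm_computable_def itrm_reducible_def x by blast
qed

end
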